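(* Let $\gamma>1$, $\varrho_0>0$, and let $(\varrho_h,\mathbf u_h,\mathbf B_h,\mathbf E_h)$ be a solution of Scheme-I (see context), with $\mathbf j_h=\mathbf E_h+\mathbf u_h\times\mathbf B_h^\triangleleft$. Then there exist $\xi\in\mathrm{co}\{\varrho_h^\triangleleft,\varrho_h\}$ and $\zeta\in\mathrm{co}\{\varrho_h^{\rm in},\varrho_h^{\rm out}\}$ for any $\sigma\in\mathcal E^I$ such that $$D_t\int_\Omega\Big(\tfrac12\varrho_h|\widehat{\mathbf u_h}|^2+\mathcal H(\varrho_h)+\tfrac12|\mathbf B_h|^2\Big)dx+\mu\|\nabla_h\mathbf u_h\|_{L^2}^2+\nu\|\mathrm{div}_h\mathbf u_h\|_{L^2}^2+\|\mathbf j_h\|_{L^2}^2$$ $$=-\frac{\Delta t}2\int_\Omega\varrho_h^\triangleleft|D_t\widehat{\mathbf u_h}|^2dx-\frac{\Delta t}2\int_\Omega|D_t\mathbf B_h|^2dx-\frac{\Delta t}2\int_\Omega\mathcal H''(\xi)|D_t\varrho_h|^2dx$$ $$-\sum_{\sigma\in\mathcal E^I}\int_\sigma\Big(\varrho_h^{\rm up}\frac{|u_\sigma|}2+h^\varepsilon\{\!\{\varrho_h\}\!\}_\sigma\Big)|[[\widehat{\mathbf u_h}]]|^2dS-\sum_{\sigma\in\mathcal E^I}\int_\sigma\mathcal H''(\zeta)[[\varrho_h]]^2\Big(h^\varepsilon+\frac{|u_\sigma|}2\Big)dS\ \le\ 0 .$$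
   Context: **Setting.** $\Omega\subset\mathbb R^d$, $d\in\{2,3\}$, is a bounded domain (no-slip case) or the flat torus (periodic case). Parameters: $\mu>0$, $\nu=\frac{d-2}d\mu+\lambda\ge0$, $p(\varrho)=a\varrho^\gamma$, $a>0$; $\mathcal H(\varrho)=\frac a{\gamma-1}\varrho^\gamma$; initial data $\varrho_0,\mathbf u_0,\mathbf B_0$. $\mathrm{co}\{a,b\}=[\min(a,b),\max(a,b)]$. **Mesh.** $\Omega_h$ is a regular triangulation of $\Omega$ of size $h\in(0,1)$; $\mathcal E$ the set of faces, $\mathcal E^B$ the boundary faces, $\mathcal E^I=\mathcal E\setminus\mathcal E^B$; each $\sigma\in\mathcal E$ has a unit normal $\mathbf n_\sigma$. $\Delta t\approx h$, $t^k=k\Delta t$, $k=1,\dots,N_T=T/\Delta t$. **Spaces.** $\mathcal P^m_n$: $\mathbb R^m$-valued polynomials of degree at most $n$. $Q_h=\{v\in L^2(\Omega):v|_K\in\mathcal P_0^1\ \forall K\in\Omega_h\}$. Crouzeix–Raviart space $V_h=\{\mathbf v\in L^2:\mathbf v|_K\in\mathcal P_1^d\ \forall K,\ \int_\sigma[[\mathbf v]]dS=0\ \forall\sigma\in\mathcal E^I\}$. $H(\mathrm{div})$-Nédélec type space $\mathcal R_h=\{\mathbf v,\mathrm{div}\,\mathbf v\in L^2:\mathbf v|_K\in\mathcal P_0^d\oplus\mathcal P_0^1\mathbf x\ \forall K,\ \int_\sigma[[\mathbf v\cdot\mathbf n]]dS=0\ \forall\sigma\in\mathcal E^I\}$. $H(\mathrm{curl})$-Nédélec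 type space $\mathcal N_h=\{\mathbf v,\mathbf{curl}\,\mathbf v\in L^2:\mathbf v|_K\in\mathcal P_0^d\oplus\mathcal P_0^1\mathbf x\ \forall K,\ \int_\sigma[[\mathbf v\times\mathbf n]]dS=0\ \forall\sigma\in\mathcal E^I\}$. $V_{0,h},\mathcal R_{0,h},\mathcal N_{0,h}$: subspaces with, respectively, $\int_\sigma\mathbf v\,dS=0$, $\int_\sigma\mathbf v\cdot\mathbf n\,dS=0$, $\int_\sigma\mathbf v\times\mathbf n\,dS=0$ for all $\sigma\in\mathcal E^B$. $\Pi_Q$: elementwise mean, also written $\widehat f=\Pi_Qf$. $\Pi_V$ onto $V_h$: $\int_\sigma\Pi_V\mathbf v\,dS=\int_\sigma\mathbf v\,dS$ for all $\sigma$; $\Pi_{\mathcal R}$ onto $\mathcal R_h$: $\int_\sigma\Pi_{\mathcal R}\mathbf v\cdot\mathbf n\,dS=\int_\sigma\mathbf v\cdot\mathbf n\,dS$ for all $\sigma$. $\nabla_h,\mathrm{div}_h,\mathbf{curl}_h$: the continuous operators applied on each element. **Time discretization.** Discrete functions are piecewise constant in time: $v_h(t)=v_h^0$ for $t\le0$, $v_h(t)=v_h^k$ for $t\in((k-1)\Delta t,k\Delta t]$. $v_h^\triangleleft(t)=v_h(t-\Delta t)$, $D_tv_h=(v_h-v_h^\triangleleft)/\Delta t$. **Fluxes.** For $\sigma\in\mathcal E$: $f^{\rm in},f^{\rm out}$ are the traces from the side $-\mathbf n_\sigma$, $+\mathbf n_\sigma$; $[[f]]=f^{\rm out}-f^{\rm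 in}$, $\{\!\{f\}\!\}_\sigma=\frac12(f^{\rm out}+f^{\rm in})$. $u_\sigma=\frac1{|\sigma|}\int_\sigma\mathbf u_h\,dS\cdot\mathbf n_\sigma$, $r_h^{\rm up}=r_h^{\rm in}$ if $u_\sigma\ge0$ and $r_h^{\rm out}$ otherwise. $F_h^\varepsilon(r_h,\mathbf u_h)=r_h^{\rm up}u_\sigma-h^\varepsilon[[r_h]]$, $\varepsilon>-1$. **Scheme-I.** With $(\varrho_h^0,\mathbf u_h^0,\mathbf B_h^0)=(\Pi_Q\varrho_0,\Pi_V\mathbf u_0,\Pi_{\mathcal R}\mathbf B_0)$, find $(\varrho_h,\mathbf u_h,\mathbf B_h,\mathbf E_h)$, piecewise constant in time with values in $Q_h\times V_{0,h}\times\mathcal R_{0,h}\times\mathcal N_{0,h}$, such that, with $p_h=p(\varrho_h)$ and $\mathbf j_h=\mathbf E_h+\mathbf u_h\times\mathbf B_h^\triangleleft$: $$\int_\Omega D_t\varrho_h\,\phi_h\,dx-\sum_{\sigma\in\mathcal E^I}\int_\sigma F_h^\varepsilon(\varrho_h,\mathbf u_h)[[\phi_h]]dS=0\quad\forall\phi_h\in Q_h;$$ $$\int_\Omega D_t(\varrho_h\widehat{\mathbf u_h})\cdot\mathbf v_h-\sum_{\sigma\in\mathcal E^I}\int_\sigma F_h^\varepsilon(\varrho_h\widehat{\mathbf u_h},\mathbf u_h)\cdot[[\widehat{\mathbf v_h}]]dS+\mu\int_\Omega\nabla_h\mathbf u_h:\nabla_h\mathbf v_h+\int_\Omega(\nu\,\mathrm{div}_h\mathbf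 u_h-p_h)\mathrm{div}_h\mathbf v_h-\int_\Omega(\mathbf j_h\times\mathbf B_h^\triangleleft)\cdot\mathbf v_h=0\quad\forall\mathbf v_h\in V_h;$$ $$\int_\Omega(D_t\mathbf B_h\cdot\mathbf C_h+\mathbf E_h\cdot\mathbf{curl}_h\mathbf C_h)\,dx=0\quad\forall\mathbf C_h\in\mathcal R_h;$$ $$\int_\Omega(\mathbf j_h\cdot\boldsymbol\psi_h-\mathbf B_h\cdot\mathbf{curl}_h\boldsymbol\psi_h)dx=0\quad\forall\boldsymbol\psi_h\in\mathcal N_h.$$ *)

theory Defs
  imports "HOL-Analysis.Analysis"
begin

section \<open>Domain and mesh\<close>

text \<open>
  A bounded domain and a flat torus are treated together.  The torus is the quotient of the whole
  space by a lattice of periods; functions on it are periodic functions on the whole space, and its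
  elements and faces are given by one representative each.  For a bounded domain the only period
  is zero.

  The field \<open>coord\<close> numbers the coordinate axes by \<open>1, \<dots>, d\<close>.  It is only used to identify
  \<open>d\<close>-vectors with 3-vectors in cross products and curls (see \<open>emb\<close> below).
\<close>

record ('n::finite) mesh =
  periods :: "(real^'n) set"
  region :: "(real^'n) set"
  elems :: "(real^'n) set set"
  faces :: "(real^'n) set set"
  normal :: "(real^'n) set \<Rightarrow> real^'n"
  msize :: real
  coord :: "'n \<Rightarrow> nat"

definition period_lattice :: "(real^'n::finite) set \<Rightarrow> bool" where
  "period_lattice L \<longleftrightarrow> (\<exists>b :: 'n \<Rightarrow> real^'n. inj b \<and> independent (range b) \<and>
      L = range (\<lambda>k :: 'n \<Rightarrow> int. \<Sum>i\<in>UNIV. of_int (k i) *\<^sub>R b i))"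

definition bounded_domain :: "'n::finite mesh \<Rightarrow> bool" where
  "bounded_domain M \<longleftrightarrow> periods M = {0} \<and> region M \<noteq> {} \<and> open (region M) \<and>
      connected (region M) \<and> bounded (region M)"

definition flat_torus :: "'n::finite mesh \<Rightarrow> bool" where
  "flat_torus M \<longleftrightarrow> period_lattice (periods M) \<and> region M = UNIV"

text \<open>All translates of the elements by periods.\<close>

definition cover :: "'n::finite mesh \<Rightarrow> (real^'n) set set" where
  "cover M = {(+) l ` K | l K. l \<in> periods M \<and> K \<in> elems M}"

text \<open>The torus has no boundary faces, as the frontier of the whole space is empty.\<close>

definition bdry_faces :: "'n::finite mesh \<Rightarrow> (real^'n) set set" where
  "bdry_faces M = {\<sigma> \<in> faces M. \<sigma> \<subseteq> frontier (region M)}"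

definition int_faces :: "'n::finite mesh \<Rightarrow> (real^'n) set set" where
  "int_faces M = faces M - bdry_faces M"

definition triangulated :: "'n::finite mesh \<Rightarrow> bool" where
  "triangulated M \<longleftrightarrow>
     finite (elems M) \<and> elems M \<noteq> {} \<and>
     (\<forall>K\<in>elems M. int CARD('n) simplex K) \<and>
     (\<forall>K\<in>elems M. \<forall>l\<in>periods M. (+) l ` K \<in> elems M \<longrightarrow> l = 0) \<and>
     (\<forall>K\<in>cover M. \<forall>K'\<in>cover M. K \<inter> K' face_of K \<and> K \<inter> K' face_of K') \<and>
     region M = interior (\<Union> (cover M)) \<and>
     msize M = Max (diameter ` elems M) \<and> 0 < msize M \<and> msize M < 1"

definition faces_of_mesh :: "'n::finite mesh \<Rightarrow> bool" where
  "faces_of_mesh M \<longleftrightarrow>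
     finite (faces M) \<and>
     (\<forall>\<sigma>\<in>faces M. \<exists>K\<in>cover M. \<sigma> facet_of K) \<and>
     (\<forall>K\<in>cover M. \<forall>F. F facet_of K \<longrightarrow> (\<exists>!\<sigma>. \<sigma> \<in> faces M \<and> (\<exists>l\<in>periods M. F = (+) l ` \<sigma>)))"

text \<open>Unit normals; on boundary faces they point out of the domain, so that there the trace from
  the side of \<open>- normal M \<sigma>\<close> is the trace from within the domain.\<close>

definition normals_of_mesh :: "'n::finite mesh \<Rightarrow> bool" where
  "normals_of_mesh M \<longleftrightarrow>
     (\<forall>\<sigma>\<in>faces M. norm (normal M \<sigma>) = 1 \<and> (\<forall>x\<in>\<sigma>. \<forall>y\<in>\<sigma>. normal M \<sigma> \<bullet> (y - x) = 0)) \<and>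
     (\<forall>\<sigma>\<in>bdry_faces M. \<forall>K\<in>cover M. \<sigma> facet_of K \<longrightarrow>
        (\<forall>x\<in>\<sigma>. \<forall>y\<in>K. normal M \<sigma> \<bullet> (y - x) \<le> 0))"

definition mhd_mesh :: "'n::finite mesh \<Rightarrow> bool" where
  "mhd_mesh M \<longleftrightarrow>
     (CARD('n) = 2 \<or> CARD('n) = 3) \<and> bij_betw (coord M) UNIV {1..CARD('n)} \<and>
     (bounded_domain M \<or> flat_torus M) \<and>
     triangulated M \<and> faces_of_mesh M \<and> normals_of_mesh M"


section \<open>Integrals\<close>

definition periodic :: "'n::finite mesh \<Rightarrow> (real^'n \<Rightarrow> 'b) \<Rightarrow> bool" where
  "periodic M f \<longleftrightarrow> (\<forall>l\<in>periods M. \<forall>x. f (x + l) = f x)"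

text \<open>For a bounded domain, \<open>body\<close> is its closure, which differs from the domain by a null set; for
  the torus it is a fundamental domain.\<close>

definition body :: "'n::finite mesh \<Rightarrow> (real^'n) set" where
  "body M = \<Union> (elems M)"

definition vol_int :: "'n::finite mesh \<Rightarrow> (real^'n \<Rightarrow> 'b::euclidean_space) \<Rightarrow> 'b" where
  "vol_int M f = set_lebesgue_integral lebesgue (body M) f"

definition L2 :: "'n::finite mesh \<Rightarrow> (real^'n \<Rightarrow> 'b::euclidean_space) set" where
  "L2 M = {f. periodic M f \<and> set_borel_measurable lebesgue (body M) f \<and>
              set_integrable lebesgue (body M) (\<lambda>x. (norm (f x))\<^sup>2)}"

definition L2_norm :: "'n::finite mesh \<Rightarrow> (real^'n \<Rightarrow> 'b::euclidean_space) \<Rightarrow> real" where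
  "L2_norm M f = sqrt (vol_int M (\<lambda>x. (norm (f x))\<^sup>2))"

text \<open>
  The surface measure of a flat face \<open>\<sigma>\<close> with unit normal \<open>n\<close> is the Lebesgue measure of the
  prism of height one erected over it.  Points of the prism are projected to \<open>\<sigma>\<close> along \<open>n\<close>, which
  on the prism is what \<open>closest_point \<sigma>\<close> does.
\<close>

definition prism :: "'n::finite mesh \<Rightarrow> (real^'n) set \<Rightarrow> (real^'n) set" where
  "prism M \<sigma> = {x + s *\<^sub>R normal M \<sigma> | x s. x \<in> \<sigma> \<and> 0 \<le> s \<and> s \<le> 1}"

definition surf_int :: "'n::finite mesh \<Rightarrow> (real^'n) set \<Rightarrow> (real^'n \<Rightarrow> 'b::euclidean_space) \<Rightarrow> 'b" where
  "surf_int M \<sigma> f = set_lebesgue_integral lebesgue (prism M \<sigma>) (\<lambda>y. f (closest_point \<sigma> y))"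

definition surf_integrable :: "'n::finite mesh \<Rightarrow> (real^'n) set \<Rightarrow> (real^'n \<Rightarrow> 'b::euclidean_space) \<Rightarrow> bool" where
  "surf_integrable M \<sigma> f \<longleftrightarrow> set_integrable lebesgue (prism M \<sigma>) (\<lambda>y. f (closest_point \<sigma> y))"

definition area :: "'n::finite mesh \<Rightarrow> (real^'n) set \<Rightarrow> real" where
  "area M \<sigma> = surf_int M \<sigma> (\<lambda>_. 1)"


section \<open>Differential operators\<close>

text \<open>
  Discrete functions are polynomials in the interior of each element, so that there the classical
  derivatives are those of the broken operators.  The values on the skeleton of the mesh do not
  matter, since the operators only occur under volume integrals.
\<close>

definition pd :: "'n::finite \<Rightarrow> (real^'n \<Rightarrow> 'b::euclidean_space) \<Rightarrow> real^'n \<Rightarrow> 'b" where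
  "pd i f x = frechet_derivative f (at x) (axis i 1)"

text \<open>On a vector field, \<open>grad u x $ i $ j\<close> is the derivative of \<open>u $ j\<close> in direction \<open>i\<close>; inner product
  and norm of such matrices are those of Frobenius.\<close>

definition grad :: "(real^'n::finite \<Rightarrow> 'b::euclidean_space) \<Rightarrow> real^'n \<Rightarrow> 'b^'n" where
  "grad f x = (\<chi> i. pd i f x)"

definition divg :: "(real^'n::finite \<Rightarrow> real^'n) \<Rightarrow> real^'n \<Rightarrow> real" where
  "divg v x = (\<Sum>i\<in>UNIV. pd i v x $ i)"

text \<open>
  In three dimensions \<open>emb\<close> only renames the coordinates.  In two dimensions it is the usual
  identification of the vector with components \<open>v1, v2\<close> with the one with components \<open>v1, v2, 0\<close>,
  by which cross product and curl are understood.
\<close>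

definition emb :: "'n::finite mesh \<Rightarrow> real^'n \<Rightarrow> real^3" where
  "emb M v = (\<Sum>i\<in>UNIV. v $ i *\<^sub>R axis (of_nat (coord M i)) 1)"

definition curl :: "'n::finite mesh \<Rightarrow> (real^'n \<Rightarrow> real^'n) \<Rightarrow> real^'n \<Rightarrow> real^3" where
  "curl M v x = (\<Sum>i\<in>UNIV. cross3 (emb M (axis i 1)) (emb M (pd i v x)))"

primrec Ck :: "nat \<Rightarrow> (real^'n::finite \<Rightarrow> real) \<Rightarrow> bool" where
  "Ck 0 f \<longleftrightarrow> continuous_on UNIV f"
| "Ck (Suc k) f \<longleftrightarrow> (\<forall>x. f differentiable (at x)) \<and> (\<forall>i. Ck k (pd i f))"

text \<open>Smooth functions with compact support in the domain; on the torus, all smooth functions.\<close>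

definition test_fun :: "'n::finite mesh \<Rightarrow> (real^'n \<Rightarrow> real) \<Rightarrow> bool" where
  "test_fun M \<phi> \<longleftrightarrow> (\<forall>k. Ck k \<phi>) \<and> periodic M \<phi> \<and> closure {x. \<phi> x \<noteq> 0} \<subseteq> region M"

definition weak_div :: "'n::finite mesh \<Rightarrow> (real^'n \<Rightarrow> real^'n) \<Rightarrow> (real^'n \<Rightarrow> real) \<Rightarrow> bool" where
  "weak_div M v g \<longleftrightarrow> (\<forall>\<phi>. test_fun M \<phi> \<longrightarrow>
      vol_int M (\<lambda>x. \<phi> x * g x) = - vol_int M (\<lambda>x. grad \<phi> x \<bullet> v x))"

definition weak_curl :: "'n::finite mesh \<Rightarrow> (real^'n \<Rightarrow> real^'n) \<Rightarrow> (real^'n \<Rightarrow> real^3) \<Rightarrow> bool" where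
  "weak_curl M v g \<longleftrightarrow> (\<forall>\<phi>. test_fun M \<phi> \<longrightarrow>
      vol_int M (\<lambda>x. \<phi> x *\<^sub>R g x) = - vol_int M (\<lambda>x. cross3 (emb M (grad \<phi> x)) (emb M (v x))))"


section \<open>Traces, discrete spaces and projections\<close>

definition tr_in :: "'n::finite mesh \<Rightarrow> (real^'n) set \<Rightarrow> (real^'n \<Rightarrow> 'b::euclidean_space) \<Rightarrow> real^'n \<Rightarrow> 'b" where
  "tr_in M \<sigma> f x = Lim (at_right 0) (\<lambda>s. f (x - s *\<^sub>R normal M \<sigma>))"

definition tr_out :: "'n::finite mesh \<Rightarrow> (real^'n) set \<Rightarrow> (real^'n \<Rightarrow> 'b::euclidean_space) \<Rightarrow> real^'n \<Rightarrow> 'b" where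
  "tr_out M \<sigma> f x = Lim (at_right 0) (\<lambda>s. f (x + s *\<^sub>R normal M \<sigma>))"

definition jump :: "'n::finite mesh \<Rightarrow> (real^'n) set \<Rightarrow> (real^'n \<Rightarrow> 'b::euclidean_space) \<Rightarrow> real^'n \<Rightarrow> 'b" where
  "jump M \<sigma> f x = tr_out M \<sigma> f x - tr_in M \<sigma> f x"

definition avg :: "'n::finite mesh \<Rightarrow> (real^'n) set \<Rightarrow> (real^'n \<Rightarrow> 'b::euclidean_space) \<Rightarrow> real^'n \<Rightarrow> 'b" where
  "avg M \<sigma> f x = (1/2) *\<^sub>R (tr_out M \<sigma> f x + tr_in M \<sigma> f x)"

definition Qh :: "'n::finite mesh \<Rightarrow> (real^'n \<Rightarrow> real) set" where
  "Qh M = {v \<in> L2 M. \<forall>K\<in>cover M. \<exists>c. \<forall>x\<in>interior K. v x = c}"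

definition Vh :: "'n::finite mesh \<Rightarrow> (real^'n \<Rightarrow> real^'n) set" where
  "Vh M = {v \<in> L2 M.
     (\<forall>K\<in>cover M. \<exists>(A :: real^'n^'n) b. \<forall>x\<in>interior K. v x = A *v x + b) \<and>
     (\<forall>\<sigma>\<in>int_faces M. surf_int M \<sigma> (jump M \<sigma> v) = 0)}"

definition Rh :: "'n::finite mesh \<Rightarrow> (real^'n \<Rightarrow> real^'n) set" where
  "Rh M = {v \<in> L2 M. (\<exists>g\<in>L2 M. weak_div M v g) \<and>
     (\<forall>K\<in>cover M. \<exists>a (b :: real). \<forall>x\<in>interior K. v x = a + b *\<^sub>R x) \<and>
     (\<forall>\<sigma>\<in>int_faces M. surf_int M \<sigma> (jump M \<sigma> (\<lambda>x. v x \<bullet> normal M \<sigma>)) = 0)}"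

definition Nh :: "'n::finite mesh \<Rightarrow> (real^'n \<Rightarrow> real^'n) set" where
  "Nh M = {v \<in> L2 M. (\<exists>g\<in>L2 M. weak_curl M v g) \<and>
     (\<forall>K\<in>cover M. \<exists>a (b :: real). \<forall>x\<in>interior K. v x = a + b *\<^sub>R x) \<and>
     (\<forall>\<sigma>\<in>int_faces M.
        surf_int M \<sigma> (jump M \<sigma> (\<lambda>x. cross3 (emb M (v x)) (emb M (normal M \<sigma>)))) = 0)}"

definition V0h :: "'n::finite mesh \<Rightarrow> (real^'n \<Rightarrow> real^'n) set" where
  "V0h M = {v \<in> Vh M. \<forall>\<sigma>\<in>bdry_faces M. surf_int M \<sigma> (tr_in M \<sigma> v) = 0}"

definition R0h :: "'n::finite mesh \<Rightarrow> (real^'n \<Rightarrow> real^'n) set" where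
  "R0h M = {v \<in> Rh M. \<forall>\<sigma>\<in>bdry_faces M. surf_int M \<sigma> (tr_in M \<sigma> (\<lambda>x. v x \<bullet> normal M \<sigma>)) = 0}"

definition N0h :: "'n::finite mesh \<Rightarrow> (real^'n \<Rightarrow> real^'n) set" where
  "N0h M = {v \<in> Nh M. \<forall>\<sigma>\<in>bdry_faces M.
      surf_int M \<sigma> (tr_in M \<sigma> (\<lambda>x. cross3 (emb M (v x)) (emb M (normal M \<sigma>)))) = 0}"

text \<open>The elementwise mean.  On the skeleton, where no element contains \<open>x\<close> in its interior, its value
  is irrelevant.\<close>

definition PiQ :: "'n::finite mesh \<Rightarrow> (real^'n \<Rightarrow> 'b::euclidean_space) \<Rightarrow> real^'n \<Rightarrow> 'b" where
  "PiQ M f x = (let K = (THE K. K \<in> cover M \<and> x \<in> interior K)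
                in (1 / measure lebesgue K) *\<^sub>R set_lebesgue_integral lebesgue K f)"

definition is_PiQ :: "'n::finite mesh \<Rightarrow> (real^'n \<Rightarrow> real) \<Rightarrow> (real^'n \<Rightarrow> real) \<Rightarrow> bool" where
  "is_PiQ M f w \<longleftrightarrow> w \<in> Qh M \<and> (\<forall>K\<in>cover M. \<forall>x\<in>interior K. w x = PiQ M f x)"

text \<open>In the next two definitions the face integral of the discrete function \<open>w\<close> is the same for both
  traces on interior faces, by the jump condition in the spaces.\<close>

definition is_PiV :: "'n::finite mesh \<Rightarrow> (real^'n \<Rightarrow> real^'n) \<Rightarrow> (real^'n \<Rightarrow> real^'n) \<Rightarrow> bool" where
  "is_PiV M v w \<longleftrightarrow> w \<in> Vh M \<and>
     (\<forall>\<sigma>\<in>faces M. surf_int M \<sigma> (tr_in M \<sigma> w) = surf_int M \<sigma> v)"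

definition is_PiR :: "'n::finite mesh \<Rightarrow> (real^'n \<Rightarrow> real^'n) \<Rightarrow> (real^'n \<Rightarrow> real^'n) \<Rightarrow> bool" where
  "is_PiR M v w \<longleftrightarrow> w \<in> Rh M \<and>
     (\<forall>\<sigma>\<in>faces M. surf_int M \<sigma> (tr_in M \<sigma> (\<lambda>x. w x \<bullet> normal M \<sigma>))
                  = surf_int M \<sigma> (\<lambda>x. v x \<bullet> normal M \<sigma>))"


section \<open>Time discretization and fluxes\<close>

definition pw_const_time :: "real \<Rightarrow> nat \<Rightarrow> (real \<Rightarrow> 'b) \<Rightarrow> bool" where
  "pw_const_time \<tau> N v \<longleftrightarrow> (\<exists>w :: nat \<Rightarrow> 'b. (\<forall>t\<le>0. v t = w 0) \<and>
      (\<forall>k\<in>{1..N}. \<forall>t. real (k - 1) * \<tau> < t \<and> t \<le> real k * \<tau> \<longrightarrow> v t = w k))"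

definition Dt :: "real \<Rightarrow> (real \<Rightarrow> 'b::real_vector) \<Rightarrow> real \<Rightarrow> 'b" where
  "Dt \<tau> v t = (v t - v (t - \<tau>)) /\<^sub>R \<tau>"

text \<open>The discrete time derivative of a function of time and space.\<close>

definition Dtx :: "real \<Rightarrow> (real \<Rightarrow> real^'n::finite \<Rightarrow> 'b::real_vector) \<Rightarrow> real \<Rightarrow> real^'n \<Rightarrow> 'b" where
  "Dtx \<tau> v t x = Dt \<tau> (\<lambda>s. v s x) t"

definition u_sig :: "'n::finite mesh \<Rightarrow> (real^'n \<Rightarrow> real^'n) \<Rightarrow> (real^'n) set \<Rightarrow> real" where
  "u_sig M u \<sigma> = ((1 / area M \<sigma>) *\<^sub>R surf_int M \<sigma> (tr_in M \<sigma> u)) \<bullet> normal M \<sigma>"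

definition upw :: "'n::finite mesh \<Rightarrow> (real^'n \<Rightarrow> real^'n) \<Rightarrow> (real^'n) set \<Rightarrow>
    (real^'n \<Rightarrow> 'b::euclidean_space) \<Rightarrow> real^'n \<Rightarrow> 'b" where
  "upw M u \<sigma> r x = (if u_sig M u \<sigma> \<ge> 0 then tr_in M \<sigma> r x else tr_out M \<sigma> r x)"

definition flux :: "'n::finite mesh \<Rightarrow> real \<Rightarrow> (real^'n) set \<Rightarrow> (real^'n \<Rightarrow> 'b::euclidean_space) \<Rightarrow>
    (real^'n \<Rightarrow> real^'n) \<Rightarrow> real^'n \<Rightarrow> 'b" where
  "flux M \<epsilon> \<sigma> r u x = u_sig M u \<sigma> *\<^sub>R upw M u \<sigma> r x - (msize M powr \<epsilon>) *\<^sub>R jump M \<sigma> r x"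


section \<open>The scheme\<close>

definition pressure :: "real \<Rightarrow> real \<Rightarrow> real \<Rightarrow> real" where
  "pressure a \<gamma> r = a * r powr \<gamma>"

definition Hpot :: "real \<Rightarrow> real \<Rightarrow> real \<Rightarrow> real" where
  "Hpot a \<gamma> r = a / (\<gamma> - 1) * r powr \<gamma>"

definition Hpot'' :: "real \<Rightarrow> real \<Rightarrow> real \<Rightarrow> real" where
  "Hpot'' a \<gamma> = deriv (deriv (Hpot a \<gamma>))"

definition current :: "'n::finite mesh \<Rightarrow> real \<Rightarrow> (real \<Rightarrow> real^'n \<Rightarrow> real^'n) \<Rightarrow>
    (real \<Rightarrow> real^'n \<Rightarrow> real^'n) \<Rightarrow> (real \<Rightarrow> real^'n \<Rightarrow> real^'n) \<Rightarrow> real \<Rightarrow> real^'n \<Rightarrow> real^3" where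
  "current M \<tau> u B E t x = emb M (E t x) + cross3 (emb M (u t x)) (emb M (B (t - \<tau>) x))"

definition continuity_eq :: "'n::finite mesh \<Rightarrow> real \<Rightarrow> real \<Rightarrow> (real \<Rightarrow> real^'n \<Rightarrow> real) \<Rightarrow>
    (real \<Rightarrow> real^'n \<Rightarrow> real^'n) \<Rightarrow> real \<Rightarrow> bool" where
  "continuity_eq M \<epsilon> \<tau> \<rho> u t \<longleftrightarrow> (\<forall>\<phi>\<in>Qh M.
     vol_int M (\<lambda>x. Dtx \<tau> \<rho> t x * \<phi> x)
     - (\<Sum>\<sigma>\<in>int_faces M. surf_int M \<sigma> (\<lambda>x. flux M \<epsilon> \<sigma> (\<rho> t) (u t) x * jump M \<sigma> \<phi> x)) = 0)"

definition momentum_eq :: "'n::finite mesh \<Rightarrow> real \<Rightarrow> real \<Rightarrow> real \<Rightarrow> real \<Rightarrow> real \<Rightarrow> real \<Rightarrow>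
    (real \<Rightarrow> real^'n \<Rightarrow> real) \<Rightarrow> (real \<Rightarrow> real^'n \<Rightarrow> real^'n) \<Rightarrow> (real \<Rightarrow> real^'n \<Rightarrow> real^'n) \<Rightarrow>
    (real \<Rightarrow> real^'n \<Rightarrow> real^'n) \<Rightarrow> real \<Rightarrow> bool" where
  "momentum_eq M \<mu> \<nu> a \<gamma> \<epsilon> \<tau> \<rho> u B E t \<longleftrightarrow> (\<forall>v\<in>Vh M.
     vol_int M (\<lambda>x. Dtx \<tau> (\<lambda>s y. \<rho> s y *\<^sub>R PiQ M (u s) y) t x \<bullet> v x)
     - (\<Sum>\<sigma>\<in>int_faces M. surf_int M \<sigma> (\<lambda>x.
          flux M \<epsilon> \<sigma> (\<lambda>y. \<rho> t y *\<^sub>R PiQ M (u t) y) (u t) x \<bullet> jump M \<sigma> (PiQ M v) x))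
     + \<mu> * vol_int M (\<lambda>x. grad (u t) x \<bullet> grad v x)
     + vol_int M (\<lambda>x. (\<nu> * divg (u t) x - pressure a \<gamma> (\<rho> t x)) * divg v x)
     - vol_int M (\<lambda>x. cross3 (current M \<tau> u B E t x) (emb M (B (t - \<tau>) x)) \<bullet> emb M (v x)) = 0)"

definition induction_eq :: "'n::finite mesh \<Rightarrow> real \<Rightarrow> (real \<Rightarrow> real^'n \<Rightarrow> real^'n) \<Rightarrow>
    (real \<Rightarrow> real^'n \<Rightarrow> real^'n) \<Rightarrow> real \<Rightarrow> bool" where
  "induction_eq M \<tau> B E t \<longleftrightarrow> (\<forall>C\<in>Rh M.
     vol_int M (\<lambda>x. Dtx \<tau> B t x \<bullet> C x + emb M (E t x) \<bullet> curl M C x) = 0)"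

definition ampere_eq :: "'n::finite mesh \<Rightarrow> real \<Rightarrow> (real \<Rightarrow> real^'n \<Rightarrow> real^'n) \<Rightarrow>
    (real \<Rightarrow> real^'n \<Rightarrow> real^'n) \<Rightarrow> (real \<Rightarrow> real^'n \<Rightarrow> real^'n) \<Rightarrow> real \<Rightarrow> bool" where
  "ampere_eq M \<tau> u B E t \<longleftrightarrow> (\<forall>\<psi>\<in>Nh M.
     vol_int M (\<lambda>x. current M \<tau> u B E t x \<bullet> emb M (\<psi> x) - emb M (B t x) \<bullet> curl M \<psi> x) = 0)"

text \<open>The number of time steps is \<open>N\<close> and the final time is \<open>N * \<tau>\<close>.\<close>

definition scheme_I :: "'n::finite mesh \<Rightarrow> real \<Rightarrow> real \<Rightarrow> real \<Rightarrow> real \<Rightarrow> real \<Rightarrow> real \<Rightarrow> nat \<Rightarrow>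
    (real^'n \<Rightarrow> real) \<Rightarrow> (real^'n \<Rightarrow> real^'n) \<Rightarrow> (real^'n \<Rightarrow> real^'n) \<Rightarrow>
    (real \<Rightarrow> real^'n \<Rightarrow> real) \<Rightarrow> (real \<Rightarrow> real^'n \<Rightarrow> real^'n) \<Rightarrow> (real \<Rightarrow> real^'n \<Rightarrow> real^'n) \<Rightarrow>
    (real \<Rightarrow> real^'n \<Rightarrow> real^'n) \<Rightarrow> bool" where
  "scheme_I M \<mu> \<nu> a \<gamma> \<epsilon> \<tau> N \<rho>0 u0 B0 \<rho> u B E \<longleftrightarrow>
     pw_const_time \<tau> N \<rho> \<and> pw_const_time \<tau> N u \<and> pw_const_time \<tau> N B \<and> pw_const_time \<tau> N E \<and>
     is_PiQ M \<rho>0 (\<rho> 0) \<and> is_PiV M u0 (u 0) \<and> is_PiR M B0 (B 0) \<and>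
     (\<forall>t. 0 < t \<and> t \<le> real N * \<tau> \<longrightarrow>
        \<rho> t \<in> Qh M \<and> u t \<in> V0h M \<and> B t \<in> R0h M \<and> E t \<in> N0h M \<and>
        continuity_eq M \<epsilon> \<tau> \<rho> u t \<and>
        momentum_eq M \<mu> \<nu> a \<gamma> \<epsilon> \<tau> \<rho> u B E t \<and>
        induction_eq M \<tau> B E t \<and>
        ampere_eq M \<tau> u B E t)"

text \<open>Data for which the projections of the initial values are defined.\<close>

definition initial_data :: "'n::finite mesh \<Rightarrow> (real^'n \<Rightarrow> real) \<Rightarrow> (real^'n \<Rightarrow> real^'n) \<Rightarrow>
    (real^'n \<Rightarrow> real^'n) \<Rightarrow> bool" where
  "initial_data M \<rho>0 u0 B0 \<longleftrightarrow>
     periodic M \<rho>0 \<and> periodic M u0 \<and> periodic M B0 \<and>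
     set_integrable lebesgue (body M) \<rho>0 \<and>
     (\<forall>\<sigma>\<in>faces M. surf_integrable M \<sigma> u0 \<and> surf_integrable M \<sigma> (\<lambda>x. B0 x \<bullet> normal M \<sigma>))"

text \<open>The closed interval between two reals.\<close>

definition co :: "real \<Rightarrow> real \<Rightarrow> real set" where
  "co a b = {min a b .. max a b}"

definition total_energy :: "'n::finite mesh \<Rightarrow> real \<Rightarrow> real \<Rightarrow> (real^'n \<Rightarrow> real) \<Rightarrow>
    (real^'n \<Rightarrow> real^'n) \<Rightarrow> (real^'n \<Rightarrow> real^'n) \<Rightarrow> real" where
  "total_energy M a \<gamma> \<rho> u B =
     vol_int M (\<lambda>x. 1/2 * \<rho> x * (norm (PiQ M u x))\<^sup>2 + Hpot a \<gamma> (\<rho> x) + 1/2 * (norm (B x))\<^sup>2)"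

definition dissipation :: "'n::finite mesh \<Rightarrow> real \<Rightarrow> real \<Rightarrow> real \<Rightarrow> real \<Rightarrow>
    (real \<Rightarrow> real^'n \<Rightarrow> real) \<Rightarrow> (real \<Rightarrow> real^'n \<Rightarrow> real^'n) \<Rightarrow> (real \<Rightarrow> real^'n \<Rightarrow> real^'n) \<Rightarrow>
    (real^'n \<Rightarrow> real) \<Rightarrow> ((real^'n) set \<Rightarrow> real) \<Rightarrow> real \<Rightarrow> real" where
  "dissipation M a \<gamma> \<epsilon> \<tau> \<rho> u B \<xi> \<zeta> t =
     - \<tau> / 2 * vol_int M (\<lambda>x. \<rho> (t - \<tau>) x * (norm (Dtx \<tau> (\<lambda>s. PiQ M (u s)) t x))\<^sup>2)
     - \<tau> / 2 * vol_int M (\<lambda>x. (norm (Dtx \<tau> B t x))\<^sup>2)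
     - \<tau> / 2 * vol_int M (\<lambda>x. Hpot'' a \<gamma> (\<xi> x) * \<bar>Dtx \<tau> \<rho> t x\<bar>\<^sup>2)
     - (\<Sum>\<sigma>\<in>int_faces M. surf_int M \<sigma> (\<lambda>x.
          (upw M (u t) \<sigma> (\<rho> t) x * (\<bar>u_sig M (u t) \<sigma>\<bar> / 2) + msize M powr \<epsilon> * avg M \<sigma> (\<rho> t) x)
          * (norm (jump M \<sigma> (PiQ M (u t)) x))\<^sup>2))
     - (\<Sum>\<sigma>\<in>int_faces M. surf_int M \<sigma> (\<lambda>x.
          Hpot'' a \<gamma> (\<zeta> \<sigma>) * (jump M \<sigma> (\<rho> t) x)\<^sup>2 * (msize M powr \<epsilon> + \<bar>u_sig M (u t) \<sigma>\<bar> / 2)))"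

end

theory Submission
  imports Defs
begin

text \<open>
  The balance results from testing each equation with the quantity conjugate to it: the momentum equation with
  \<open>u\<close>, the continuity equation with \<open>Hpot' \<rho> - \<bar>w\<bar>\<^sup>2 / 2\<close>, where \<open>w\<close> is the cell mean of \<open>u\<close>, the induction equation with
  \<open>B\<close> and Ampere's law with \<open>E\<close>.  In every cell the time differences become differences of energies plus squares
  (\<open>cell_energy_identity\<close>, \<open>magnetic_identity\<close>).  On every interior face the upwind fluxes and the artificial
  diffusion become squares of jumps: those of the velocity by \<open>kinetic_face_identity\<close>, those of the density by Taylor
  expansion of the potential (\<open>ex_face_dissipation_at\<close>), once the work of the pressure has been written as a sum over
  faces.  The work of the Lorentz force is the resistive loss (\<open>lorentz_work\<close>).  The terms \<open>E \<bullet> curl B\<close> and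
  \<open>B \<bullet> curl E\<close> both vanish, as the curl of \<open>a + b x\<close> is zero (\<open>curl_homothetic\<close>).  The pieces are put together in
  \<open>energy_identity\<close>.

  The work of the pressure is moved to the faces by the divergence theorem on each cell (\<open>vol_int_mult_divg\<close>).  For an
  affine field both sides are expressed by the values at the vertices and the gradients of the barycentric coordinates:
  the volume integral by linear algebra (\<open>divergence_algebra\<close>), a surface integral by \<open>prism_integral_affine\<close>.  The
  latter rests on a dissection of the prism over a facet into as many pieces of equal volume as the facet has
  vertices, each the image of the cell under an affine map of known determinant.  To regroup the facets of the elements
  by faces one needs that an interior face has exactly one cell on each side and a boundary face has none outside (\<open>ex1_cell_in\<close>, \<open>ex1_cell_out\<close>,
  \<open>no_cell_outside\<close>), and that the facets of the elements match the pairs of a face and an adjacent cell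
  up to periods (\<open>bij_attach\<close>).

  The expansion of the potential and the sign of the right-hand side require the density to be positive.  It stays
  so from one time step to the next, because the upwind and diffusive fluxes cannot carry mass out of the set where it is not
  (\<open>density_positive_step\<close>).
\<close>

section \<open>Volumes under rank-one affine maps\<close>

text \<open>By Cramer's rule: the matrix is the identity with its \<open>k\<close>-th column replaced.\<close>
lemma det_rank_one_update_axis:
  fixes a :: "real^'m"
  shows "det (matrix (\<lambda>x. x + x $ k *\<^sub>R a)) = 1 + a $ k"
proof -
  have "matrix (\<lambda>x. x + x $ k *\<^sub>R a) =
      (\<chi> i j. if j = k then ((mat 1 :: real^'m^'m) *v (axis k 1 + a)) $ i else (mat 1 :: real^'m^'m) $ i $ j)"
    by (auto simp: matrix_def vec_eq_iff axis_def mat_def matrix_vector_mul_lid[unfolded mat_def])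
  then show ?thesis
    using cramer_lemma[where A = "mat 1 :: real^'m^'m" and x = "axis k 1 + a" and k = k] by simp
qed

text \<open>A rotation taking \<open>g\<close> to a coordinate axis turns the map into the one of
  \<open>det_rank_one_update_axis\<close>.\<close>
lemma measure_rank_one_image_wellorder:
  fixes g a :: "real^'m::{finite,wellorder}"
  assumes S: "S \<in> lmeasurable"
  shows "measure lebesgue ((\<lambda>x. x + (g \<bullet> x) *\<^sub>R a) ` S) = \<bar>1 + g \<bullet> a\<bar> * measure lebesgue S"
proof -
  obtain k :: 'm where True by blast
  obtain Q :: "(real, 'm) vec \<Rightarrow> (real, 'm) vec" where Q: "orthogonal_transformation Q" and Qg: "Q g = norm g *\<^sub>R axis k 1"
    using orthogonal_transformation_exists[of g "norm g *\<^sub>R axis k 1"] by auto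
  have linQ: "linear Q" and Qi: "Q x \<bullet> Q y = x \<bullet> y" for x y
    using Q by (auto simp: orthogonal_transformation_def)
  define L where "L x = x + (g \<bullet> x) *\<^sub>R a" for x
  define N where "N = (\<lambda>x. x + x $ k *\<^sub>R (norm g *\<^sub>R Q a))"
  have linN: "linear N" unfolding N_def
    by (rule linearI) (auto simp: algebra_simps)
  have linL: "linear L" unfolding L_def
    by (rule linearI) (auto simp: algebra_simps inner_right_distrib)
  have gx: "g \<bullet> x = norm g * Q x $ k" for x
    using Qi[of g x] by (simp add: Qg inner_axis' )
  have QL: "Q (L x) = N (Q x)" for x
    unfolding L_def N_def by (simp add: gx linear_add[OF linQ] linear_cmul[OF linQ] mult.commute)
  have detN: "det (matrix N) = 1 + g \<bullet> a"
    unfolding N_def det_rank_one_update_axis by (simp add: gx)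
  have LS: "L ` S \<in> lmeasurable" using measurable_linear_image[OF linL S] .
  have "measure lebesgue (L ` S) = measure lebesgue (Q ` L ` S)"
    using measure_orthogonal_image[OF Q LS] by simp
  also have "Q ` L ` S = N ` Q ` S" by (simp add: image_image QL)
  also have "measure lebesgue \<dots> = \<bar>det (matrix N)\<bar> * measure lebesgue (Q ` S)"
    by (rule measure_linear_image[OF linN measurable_orthogonal_image[OF Q S]])
  also have "\<dots> = \<bar>1 + g \<bullet> a\<bar> * measure lebesgue S"
    using measure_orthogonal_image[OF Q S] by (simp add: detN)
  finally show ?thesis unfolding L_def .
qed

lemma distr_reindex_lborel:
  fixes \<pi> :: "'m::finite \<Rightarrow> 'n::finite"
  assumes \<pi>: "bij \<pi>"
  shows "distr lborel borel (\<lambda>x::real^'n. \<chi> j. x $ \<pi> j) = (lborel :: (real^'m) measure)"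
proof (rule lborel_eqI[symmetric])
  let ?\<Phi> = "\<lambda>x::real^'n. (\<chi> j. x $ \<pi> j) :: real^'m"
  have lin: "linear ?\<Phi>" by (rule linearI) (auto simp: vec_eq_iff)
  then have meas: "?\<Phi> \<in> borel_measurable borel"
    by (intro borel_measurable_continuous_onI linear_continuous_on linear_conv_bounded_linear[THEN iffD1])
  show "sets (distr lborel borel ?\<Phi>) = sets borel" by simp
  fix l u :: "real^'m" assume lu: "\<And>b. b \<in> Basis \<Longrightarrow> l \<bullet> b \<le> u \<bullet> b"
  let ?l = "(\<chi> i. l $ inv \<pi> i) :: real^'n" and ?u = "(\<chi> i. u $ inv \<pi> i) :: real^'n"
  have lu': "l $ j \<le> u $ j" for j
    using lu[of "axis j 1"] by (simp add: inner_axis axis_in_Basis_iff)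
  have inv: "inv \<pi> (\<pi> j) = j" "\<pi> (inv \<pi> i) = i" for i j
    using \<pi> by (simp_all add: bij_is_inj bij_is_surj surj_f_inv_f)
  have "?\<Phi> -` box l u = box ?l ?u"
    by (auto simp: mem_box_cart) (metis inv)+
  then have "emeasure (distr lborel borel ?\<Phi>) (box l u) = emeasure lborel (box ?l ?u)"
    using meas by (simp add: emeasure_distr)
  also have "\<dots> = (\<Prod>b\<in>Basis. (?u - ?l) \<bullet> b)"
    using lu' by (intro emeasure_lborel_box) (auto simp: Basis_vec_def inner_axis)
  also have "(\<Prod>b\<in>Basis. (?u - ?l) \<bullet> b) = (\<Prod>i\<in>UNIV. (?u - ?l) $ i)"
    by (auto simp: Basis_vec_def UNION_singleton_eq_range inner_axis inj_on_def axis_eq_axis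
        intro!: prod.reindex_cong[of "\<lambda>i. axis i 1"])
  also have "\<dots> = (\<Prod>j\<in>UNIV. (u - l) $ j)"
    by (rule prod.reindex_bij_betw[OF \<pi>, symmetric, THEN trans]) (simp add: inv)
  also have "\<dots> = (\<Prod>b\<in>Basis. (u - l) \<bullet> b)"
    by (auto simp: Basis_vec_def UNION_singleton_eq_range inner_axis inj_on_def axis_eq_axis
        intro!: prod.reindex_cong[of "\<lambda>i. axis i 1", symmetric])
  finally show "emeasure (distr lborel borel ?\<Phi>) (box l u) = (\<Prod>b\<in>Basis. (u - l) \<bullet> b)" .
qed

text \<open>The index type of the mesh carries no order.  Renumbering the coordinates by a bijection with a
  well-ordered index type preserves volumes and inner products, and a rank-one map is described by
  inner products alone; so its volume factor survives the renumbering.\<close>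
lemma measure_rank_one_image_reindexed:
  fixes g a :: "real^'n::finite" and \<pi> :: "'m::{finite,wellorder} \<Rightarrow> 'n"
  assumes \<pi>: "bij \<pi>" and S: "S \<in> lmeasurable"
  shows "(\<lambda>x. x + (g \<bullet> x) *\<^sub>R a) ` S \<in> lmeasurable \<and>
    measure lebesgue ((\<lambda>x. x + (g \<bullet> x) *\<^sub>R a) ` S) = \<bar>1 + g \<bullet> a\<bar> * measure lebesgue S"
proof -
  let ?L = "\<lambda>x. x + (g \<bullet> x) *\<^sub>R a"
  define \<Phi> where "\<Phi> x = ((\<chi> j. x $ \<pi> j) :: (real, 'm) vec)" for x :: "real^'n"
  define \<Psi> where "\<Psi> y = ((\<chi> i. y $ inv \<pi> i) :: real^'n)" for y :: "(real, 'm) vec"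
  have inv: "inv \<pi> (\<pi> j) = j" "\<pi> (inv \<pi> i) = i" for i j
    using \<pi> by (simp_all add: bij_is_inj bij_is_surj surj_f_inv_f)
  have \<Phi>\<Psi>: "\<Phi> (\<Psi> y) = y" and \<Psi>\<Phi>: "\<Psi> (\<Phi> x) = x" for x y
    by (auto simp: \<Phi>_def \<Psi>_def inv vec_eq_iff)
  have lin: "linear \<Phi>" "linear \<Psi>"
    by (auto intro!: linearI simp: vec_eq_iff \<Phi>_def \<Psi>_def)
  have inner: "\<Phi> x \<bullet> \<Phi> y = x \<bullet> y" for x y
    unfolding \<Phi>_def inner_vec_def using sum.reindex_bij_betw[OF \<pi>, of "\<lambda>i. x $ i \<bullet> y $ i"] by simp
  have linL: "linear ?L" by (rule linearI) (auto simp: algebra_simps inner_right_distrib)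
  have meas: "\<Phi> \<in> borel_measurable borel" "\<Psi> \<in> borel_measurable borel"
    using lin by (auto intro!: borel_measurable_continuous_onI linear_continuous_on
        linear_conv_bounded_linear[THEN iffD1])
  have vol: "measure lebesgue (\<Psi> ` T) = measure lebesgue T" if "compact T" for T
  proof -
    have T: "T \<in> sets borel" using that by (simp add: compact_imp_closed)
    have "compact (\<Psi> ` T)"
      using that lin by (intro compact_continuous_image linear_continuous_on) (auto simp: linear_conv_bounded_linear)
    then have T': "\<Psi> ` T \<in> sets borel" by (simp add: compact_imp_closed)
    have "\<Psi> ` T = \<Phi> -` T" using \<Phi>\<Psi> \<Psi>\<Phi> by (auto simp: image_iff) metis
    then have "emeasure lborel (\<Psi> ` T) = emeasure (distr lborel borel \<Phi>) T"
      using meas T by (simp add: emeasure_distr)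
    also have "\<dots> = emeasure lborel T"
      using distr_reindex_lborel[OF \<pi>] by (simp add: \<Phi>_def[abs_def])
    finally show ?thesis using T T' by (simp add: measure_def)
  qed
  have boxes: "measure lebesgue (?L ` cbox l u) = \<bar>1 + g \<bullet> a\<bar> * measure lebesgue (cbox l u)" for l u
  proof -
    let ?L' = "\<lambda>y. y + (\<Phi> g \<bullet> y) *\<^sub>R \<Phi> a"
    have linL': "linear ?L'" by (rule linearI) (auto simp: algebra_simps inner_right_distrib)
    let ?T = "\<Phi> ` cbox l u"
    have cT: "compact ?T"
      using lin by (intro compact_continuous_image linear_continuous_on) (auto simp: linear_conv_bounded_linear)
    have cT': "compact (?L' ` ?T)"
      using linL' cT by (intro compact_continuous_image[of ?T] linear_continuous_on) (auto simp: linear_conv_bounded_linear)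
    have "?L x = \<Psi> (?L' (\<Phi> x))" for x
      by (simp add: linear_add[OF lin(2)] linear_cmul[OF lin(2)] \<Psi>\<Phi> inner)
    then have "?L ` cbox l u = \<Psi> ` ?L' ` ?T" by (simp add: image_image)
    then have "measure lebesgue (?L ` cbox l u) = measure lebesgue (?L' ` ?T)"
      using vol[OF cT'] by simp
    also have "\<dots> = \<bar>1 + g \<bullet> a\<bar> * measure lebesgue ?T"
      using cT by (subst measure_rank_one_image_wellorder) (auto simp: inner lmeasurable_compact)
    also have "measure lebesgue ?T = measure lebesgue (\<Psi> ` ?T)" using vol[OF cT] by simp
    also have "\<Psi> ` ?T = cbox l u" by (simp add: image_image \<Psi>\<Phi>)
    finally show ?thesis .
  qed
  show ?thesis
    using measure_linear_sufficient[OF linL S boxes] by auto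
qed

text \<open>Shears (\<open>g \<bullet> a = 0\<close>), reflections (\<open>g \<bullet> a = -2\<close>) and stretchings in one direction are all of
  this form.\<close>
lemma measure_rank_one_image:
  fixes g a :: "real^'n::finite"
  assumes d: "CARD('n) = 2 \<or> CARD('n) = 3" and S: "S \<in> lmeasurable"
  shows "(\<lambda>x. x + (g \<bullet> x + c) *\<^sub>R a) ` S \<in> lmeasurable"
    and "measure lebesgue ((\<lambda>x. x + (g \<bullet> x + c) *\<^sub>R a) ` S) = \<bar>1 + g \<bullet> a\<bar> * measure lebesgue S"
proof -
  let ?L = "\<lambda>x. x + (g \<bullet> x) *\<^sub>R a"
  have eq: "(\<lambda>x. x + (g \<bullet> x + c) *\<^sub>R a) ` S = (+) (c *\<^sub>R a) ` ?L ` S"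
    by (simp add: image_image algebra_simps)
  have *: "?L ` S \<in> lmeasurable \<and> measure lebesgue (?L ` S) = \<bar>1 + g \<bullet> a\<bar> * measure lebesgue S"
    using d
  proof
    assume "CARD('n) = 2"
    then obtain \<pi> :: "2 \<Rightarrow> 'n" where "bij \<pi>"
      using finite_same_card_bij[of "UNIV :: 2 set" "UNIV :: 'n set"] by auto
    then show ?thesis using measure_rank_one_image_reindexed S by blast
  next
    assume "CARD('n) = 3"
    then obtain \<pi> :: "3 \<Rightarrow> 'n" where "bij \<pi>"
      using finite_same_card_bij[of "UNIV :: 3 set" "UNIV :: 'n set"] by auto
    then show ?thesis using measure_rank_one_image_reindexed S by blast
  qed
  show "(\<lambda>x. x + (g \<bullet> x + c) *\<^sub>R a) ` S \<in> lmeasurable"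
    unfolding eq by (intro measurable_translation conjunct1[OF *])
  from * have "measure lebesgue (?L ` S) = \<bar>1 + g \<bullet> a\<bar> * measure lebesgue S" by (rule conjunct2)
  then show "measure lebesgue ((\<lambda>x. x + (g \<bullet> x + c) *\<^sub>R a) ` S) = \<bar>1 + g \<bullet> a\<bar> * measure lebesgue S"
    unfolding eq measure_translation .
qed

text \<open>A reflection is its own inverse, so the preimages of boxes are their images.\<close>
lemma distr_rank_one_lborel:
  fixes g a :: "real^'n::finite"
  assumes d: "CARD('n) = 2 \<or> CARD('n) = 3" and inv: "g \<bullet> a = -2"
  shows "distr lborel borel (\<lambda>x. x + (g \<bullet> x + c) *\<^sub>R a) = lborel"
proof (rule lborel_eqI[symmetric])
  let ?f = "\<lambda>x. x + (g \<bullet> x + c) *\<^sub>R a"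
  have meas: "?f \<in> borel_measurable borel"
    by (intro borel_measurable_continuous_onI continuous_intros)
  have ff: "?f (?f x) = x" for x using inv by (simp add: inner_right_distrib algebra_simps)
  show "sets (distr lborel borel ?f) = sets borel" by simp
  fix l u :: "real^'n" assume lu: "\<And>b. b \<in> Basis \<Longrightarrow> l \<bullet> b \<le> u \<bullet> b"
  have pre: "?f -` box l u = ?f ` box l u" proof safe
    fix x assume "?f x \<in> box l u"
    then have "?f (?f x) \<in> ?f ` box l u" by (rule imageI)
    then show "x \<in> ?f ` box l u" by (simp only: ff)
  next
    fix x assume "x \<in> box l u"
    then have "?f (?f x) \<in> box l u" by (simp only: ff)
    then show "?f x \<in> ?f -` box l u" by (rule vimageI2)
  qed
  have "?f ` box l u \<in> sets borel" unfolding pre[symmetric]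
    using measurable_sets_borel[OF meas] by simp
  then have "emeasure lborel (?f ` box l u) = emeasure lebesgue (?f ` box l u)"
    by simp
  also have "\<dots> = emeasure lebesgue (box l u)"
    using measure_rank_one_image[OF d, of "box l u" g c a] inv by (simp add: emeasure_eq_measure2)
  finally have "emeasure lborel (?f ` box l u) = emeasure lborel (box l u)" by simp
  then show "emeasure (distr lborel borel ?f) (box l u) = (\<Prod>b\<in>Basis. (u - l) \<bullet> b)"
    using meas lu by (simp add: emeasure_distr pre)
qed

section \<open>Barycentric coordinates of a simplex\<close>

locale full_simplex =
  fixes C :: "'a::euclidean_space set"
  assumes indep: "\<not> affine_dependent C" and card_C: "card C = Suc DIM('a)"
begin

lemma finite_C: "finite C"
  using indep aff_independent_finite by blast

lemma affine_hull_C: "affine hull C = UNIV"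
proof -
  have "aff_dim C = int DIM('a)"
    using aff_dim_affine_independent[OF indep] card_C by simp
  then show ?thesis by (simp add: aff_dim_eq_full)
qed

text \<open>The gradient of a barycentric coordinate is the component of an edge at \<open>v\<close> orthogonal to the
  opposite facet, suitably scaled.\<close>
lemma ex_grad:
  assumes v: "v \<in> C"
  shows "\<exists>q. \<forall>w\<in>C - {v}. q \<bullet> (w - v) = -1"
proof -
  have "card (C - {v}) = DIM('a)" using card_C v finite_C by simp
  then obtain w0 where w0: "w0 \<in> C - {v}"
    by (metis DIM_positive card_gt_0_iff ex_in_conv)
  define S where "S = span ((+) (- w0) ` (C - {v}))"
  obtain y z where y: "y \<in> S" and z: "\<And>w. w \<in> S \<Longrightarrow> orthogonal z w" and eq: "v - w0 = y + z"
    using orthogonal_subspace_decomp_exists[of "(+) (- w0) ` (C - {v})" "v - w0"] unfolding S_def by metis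
  have zz: "z \<noteq> 0"
  proof
    assume "z = 0"
    then have "v - w0 \<in> S" using eq y by simp
    then have "v \<in> affine hull (C - {v})"
      using affine_hull_span_gen[OF hull_inc[OF w0]] unfolding S_def
      by (metis add.commute diff_add_cancel image_eqI)
    then show False using indep v by (auto simp: affine_dependent_def)
  qed
  have "((1 / (z \<bullet> z)) *\<^sub>R z) \<bullet> (w - v) = -1" if w: "w \<in> C - {v}" for w
  proof -
    have "w - w0 \<in> S" unfolding S_def using w by (intro span_base) (auto simp: image_iff)
    then have "z \<bullet> (w - w0) = 0" "z \<bullet> y = 0" using z y by (auto simp: orthogonal_def)
    moreover have "z \<bullet> (w - v) = z \<bullet> (w - w0) - (z \<bullet> y + z \<bullet> z)"
      unfolding inner_add_right[symmetric] eq[symmetric] inner_diff_right[symmetric] by simp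
    ultimately have "z \<bullet> (w - v) = - (z \<bullet> z)" by simp
    then show ?thesis using zz by simp
  qed
  then show ?thesis by blast
qed

text \<open>The gradient of the affine function that is \<open>1\<close> at the vertex \<open>v\<close> and \<open>0\<close> at the other vertices.
  The defining condition refers to differences of vertices only, so that \<open>grd\<close> is unchanged when the
  simplex is translated.\<close>
definition grd :: "'a \<Rightarrow> 'a" where
  "grd v = (SOME q. \<forall>w\<in>C - {v}. q \<bullet> (w - v) = -1)"

definition bary :: "'a \<Rightarrow> 'a \<Rightarrow> real" where
  "bary v x = 1 + grd v \<bullet> (x - v)"

lemma bary_diff: "bary v x - bary v y = grd v \<bullet> (x - y)"
  by (simp add: bary_def inner_diff_right)

lemma bary_vertex: "v \<in> C \<Longrightarrow> w \<in> C \<Longrightarrow> bary v w = (if v = w then 1 else 0)"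
  using someI_ex[OF ex_grad[of v]] by (auto simp: bary_def grd_def)

lemma bary_affine_comb:
  assumes "finite D" "sum u D = 1"
  shows "bary v (\<Sum>w\<in>D. u w *\<^sub>R w) = (\<Sum>w\<in>D. u w * bary v w)"
proof -
  have "(\<Sum>w\<in>D. u w * bary v w) = sum u D * (1 - grd v \<bullet> v) + (\<Sum>w\<in>D. u w * (grd v \<bullet> w))"
    by (simp add: bary_def inner_diff_right algebra_simps sum.distrib sum_distrib_left sum_subtractf sum_distrib_right)
  then show ?thesis using assms
    by (simp add: bary_def inner_diff_right inner_sum_right)
qed

lemma bary_comb:
  assumes "sum u C = 1" "v \<in> C"
  shows "bary v (\<Sum>w\<in>C. u w *\<^sub>R w) = u v"
proof -
  have "(\<Sum>w\<in>C. u w * bary v w) = (\<Sum>w\<in>C. if v = w then u w else 0)"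
    using assms(2) by (intro sum.cong) (auto simp: bary_vertex)
  then show ?thesis using assms finite_C by (simp add: bary_affine_comb)
qed

lemma bary_repr: "(\<Sum>v\<in>C. bary v x) = 1" "(\<Sum>v\<in>C. bary v x *\<^sub>R v) = x"
proof -
  obtain u where u: "sum u C = 1" "(\<Sum>v\<in>C. u v *\<^sub>R v) = x"
    using affine_hull_C affine_hull_finite[OF finite_C] by auto
  have "bary v x = u v" if "v \<in> C" for v using bary_comb[OF u(1) that] u(2) by simp
  then show "(\<Sum>v\<in>C. bary v x) = 1" "(\<Sum>v\<in>C. bary v x *\<^sub>R v) = x" using u by auto
qed

lemma mem_hull_iff: "x \<in> convex hull C \<longleftrightarrow> (\<forall>v\<in>C. 0 \<le> bary v x)"
proof
  assume "x \<in> convex hull C"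
  then obtain u where "\<And>v. v \<in> C \<Longrightarrow> 0 \<le> u v" "sum u C = 1" "(\<Sum>v\<in>C. u v *\<^sub>R v) = x"
    using convex_hull_finite[OF finite_C] by auto
  then show "\<forall>v\<in>C. 0 \<le> bary v x" using bary_comb by metis
next
  assume "\<forall>v\<in>C. 0 \<le> bary v x"
  then show "x \<in> convex hull C"
    using bary_repr[of x] unfolding convex_hull_finite[OF finite_C] by auto
qed

lemma sum_grd: "(\<Sum>v\<in>C. grd v) = 0"
proof -
  have "(\<Sum>v\<in>C. grd v) \<bullet> x = 0" for x
  proof -
    have "(\<Sum>v\<in>C. bary v x - bary v 0) = 0" using bary_repr by (simp add: sum_subtractf)
    then show ?thesis by (simp add: bary_diff inner_sum_left)
  qed
  then show ?thesis using inner_eq_zero_iff by blast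
qed

lemma grd_repr: "(\<Sum>v\<in>C. (grd v \<bullet> x) *\<^sub>R v) = x"
proof -
  have "(\<Sum>v\<in>C. (bary v x - bary v 0) *\<^sub>R v) = x - 0"
    by (simp only: scaleR_diff_left sum_subtractf bary_repr)
  then show ?thesis by (simp add: bary_diff)
qed

lemma face_decomposition:
  assumes v: "v \<in> C"
  shows "x \<in> convex hull (C - {v}) \<longleftrightarrow> bary v x = 0 \<and> (\<forall>w\<in>C - {v}. 0 \<le> bary w x)"
proof
  assume "x \<in> convex hull (C - {v})"
  then obtain u where u: "\<And>w. w \<in> C - {v} \<Longrightarrow> 0 \<le> u w" "sum u (C - {v}) = 1" "(\<Sum>w\<in>C - {v}. u w *\<^sub>R w) = x"
    using convex_hull_finite[of "C - {v}"] finite_C by auto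
  then have "bary v x = (\<Sum>w\<in>C - {v}. u w * bary v w)"
    using bary_affine_comb[of "C - {v}" u v] finite_C by simp
  also have "\<dots> = (\<Sum>w\<in>C - {v}. 0)" using v by (intro sum.cong) (auto simp: bary_vertex)
  finally have "bary v x = 0" by simp
  moreover have "x \<in> convex hull C"
    using \<open>x \<in> convex hull (C - {v})\<close> hull_mono[of "C - {v}" C] by blast
  ultimately show "bary v x = 0 \<and> (\<forall>w\<in>C - {v}. 0 \<le> bary w x)" by (simp add: mem_hull_iff)
next
  assume *: "bary v x = 0 \<and> (\<forall>w\<in>C - {v}. 0 \<le> bary w x)"
  have "(\<Sum>w\<in>C - {v}. bary w x) = 1" "(\<Sum>w\<in>C - {v}. bary w x *\<^sub>R w) = x"
    using bary_repr[of x] * by (simp_all add: sum_diff1 finite_C v)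
  then show "x \<in> convex hull (C - {v})"
    using * finite_C unfolding convex_hull_finite[OF finite_Diff[OF finite_C]] by auto
qed

end

text \<open>The vectors \<open>grd v\<close> and the vertices resolve the identity (\<open>grd_repr\<close>), and a trace can be
  computed from any such resolution.\<close>
lemma (in full_simplex) trace_grd:
  fixes f :: "'a \<Rightarrow> 'a"
  assumes f: "linear f"
  shows "(\<Sum>v\<in>C. grd v \<bullet> f v) = (\<Sum>b\<in>Basis. f b \<bullet> b)"
proof -
  have "(\<Sum>b\<in>Basis. f b \<bullet> b) = (\<Sum>b\<in>Basis. (\<Sum>v\<in>C. (grd v \<bullet> b) *\<^sub>R f v) \<bullet> b)"
    by (intro sum.cong refl arg_cong2[where f = inner])
       (metis (no_types, lifting) grd_repr f linear_sum linear_cmul sum.cong)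
  also have "\<dots> = (\<Sum>v\<in>C. \<Sum>b\<in>Basis. (grd v \<bullet> b) * (f v \<bullet> b))"
    by (simp add: inner_sum_left sum.swap[of _ Basis])
  also have "\<dots> = (\<Sum>v\<in>C. grd v \<bullet> f v)"
    by (simp add: euclidean_inner[of "grd _" "f _"])
  finally show ?thesis ..
qed

text \<open>The divergence theorem for an affine field in terms of its values at the vertices: up to the factor
  volume, the summand of \<open>v\<close> is the outward flux through the facet opposite to \<open>v\<close>, since
  \<open>- grd v\<close> is an outward normal of it.  With the terms \<open>w = v\<close> included, the double sum would vanish, as
  the gradients add up to zero; hence it equals the sum of these terms with the opposite sign, which is the trace.\<close>
lemma (in full_simplex) divergence_algebra:
  fixes f :: "'a \<Rightarrow> 'a"
  assumes f: "linear f"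
  shows "(\<Sum>b\<in>Basis. f b \<bullet> b) = (\<Sum>v\<in>C. - (\<Sum>w\<in>C - {v}. grd v \<bullet> (f w + c)))"
proof -
  have "(\<Sum>v\<in>C. - (\<Sum>w\<in>C - {v}. grd v \<bullet> (f w + c)))
      = (\<Sum>v\<in>C. grd v \<bullet> (f v + c) - (\<Sum>w\<in>C. grd v \<bullet> (f w + c)))"
    by (intro sum.cong) (auto simp: sum_diff1 finite_C)
  also have "\<dots> = (\<Sum>v\<in>C. grd v \<bullet> f v) + (\<Sum>v\<in>C. grd v \<bullet> c) - (\<Sum>v\<in>C. grd v \<bullet> (\<Sum>w\<in>C. f w + c))"
    unfolding inner_sum_right[symmetric] by (simp add: sum_subtractf inner_add_right sum.distrib)
  also have "\<dots> = (\<Sum>v\<in>C. grd v \<bullet> f v)"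
    unfolding inner_sum_left[symmetric] by (simp add: sum_grd)
  finally show ?thesis using trace_grd[OF f] by simp
qed

text \<open>A normal of the facet opposite to \<open>v\<close> defines an affine function that is constant on the facet,
  hence a multiple of the barycentric coordinate of \<open>v\<close> up to a constant.\<close>
lemma (in full_simplex) normal_height:
  assumes v: "v \<in> C" and n: "\<And>w w'. w \<in> C - {v} \<Longrightarrow> w' \<in> C - {v} \<Longrightarrow> n \<bullet> (w - w') = 0"
    and w: "w \<in> C - {v}"
  shows "n \<bullet> (x - w) = bary v x * (n \<bullet> (v - w))" and "n = (n \<bullet> (v - w)) *\<^sub>R grd v"
proof -
  have eq: "n \<bullet> (x - w) = bary v x * (n \<bullet> (v - w))" for x
  proof -
    have "n \<bullet> x = (\<Sum>w'\<in>C. bary w' x * (n \<bullet> w'))"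
      using arg_cong[OF bary_repr(2)[of x], of "inner n"] by (simp add: inner_sum_right)
    also have "\<dots> = bary v x * (n \<bullet> v) + (\<Sum>w'\<in>C - {v}. bary w' x * (n \<bullet> w))"
      using v finite_C n[OF _ w] by (subst sum.remove[of _ v]) (auto simp: inner_diff_right)
    also have "(\<Sum>w'\<in>C - {v}. bary w' x * (n \<bullet> w)) = (1 - bary v x) * (n \<bullet> w)"
      using bary_repr(1)[of x] v finite_C by (simp add: sum_distrib_right[symmetric] sum_diff1)
    finally show ?thesis by (simp add: inner_diff_right algebra_simps)
  qed
  then show "n \<bullet> (x - w) = bary v x * (n \<bullet> (v - w))" .
  have "n \<bullet> y = ((n \<bullet> (v - w)) *\<^sub>R grd v) \<bullet> y" for y
    using eq[of y] eq[of 0] bary_diff[of v y 0] by (simp add: inner_diff_right algebra_simps)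
  then show "n = (n \<bullet> (v - w)) *\<^sub>R grd v"
    by (metis vector_eq_rdot)
qed

section \<open>Integrals over the prism erected on a facet\<close>

text \<open>The facet \<open>base\<close> of a simplex opposite to its vertex \<open>v\<close>, with a unit normal \<open>n\<close>, and the prism
  \<open>slab\<close> of height one over it.  The elevation of a point over the hyperplane of the facet is \<open>elev\<close>, and
  \<open>height\<close> is the one of \<open>v\<close>; both are signed by the direction of \<open>n\<close>.  The function \<open>\<beta> w\<close> is the
  barycentric coordinate of the foot of the perpendicular, and \<open>grad_\<beta> w\<close> its gradient.\<close>
locale facet_prism = full_simplex C for C :: "(real^'n::finite) set" +
  fixes v n :: "real^'n"
  assumes v: "v \<in> C" and dim: "CARD('n) = 2 \<or> CARD('n) = 3" and unit: "norm n = 1"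
    and perp: "\<And>w w'. w \<in> C - {v} \<Longrightarrow> w' \<in> C - {v} \<Longrightarrow> n \<bullet> (w - w') = 0"
begin

definition base :: "(real^'n) set" where "base = C - {v}"
definition w0 :: "real^'n" where "w0 = (SOME w. w \<in> base)"
definition height :: real where "height = n \<bullet> (v - w0)"
definition elev :: "real^'n \<Rightarrow> real" where "elev y = n \<bullet> (y - w0)"
definition grad_\<beta> :: "real^'n \<Rightarrow> real^'n" where "grad_\<beta> w = grd w - (grd w \<bullet> n) *\<^sub>R n"
definition \<beta> :: "real^'n \<Rightarrow> real^'n \<Rightarrow> real" where "\<beta> w y = bary w (y - elev y *\<^sub>R n)"
definition slab :: "(real^'n) set" where "slab = {x + t *\<^sub>R n | x t. x \<in> convex hull base \<and> 0 \<le> t \<and> t \<le> 1}"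

lemma finite_base: "finite base" and card_base: "card base = CARD('n)" and w0: "w0 \<in> base"
proof -
  show "finite base" and c: "card base = CARD('n)" using finite_C card_C v by (simp_all add: base_def)
  then have "base \<noteq> {}" by force
  then show "w0 \<in> base" unfolding w0_def by (simp add: some_in_eq)
qed

lemma base_subset: "w \<in> base \<Longrightarrow> w \<in> C" and base_neq: "w \<in> base \<Longrightarrow> w \<noteq> v"
  by (auto simp: base_def)

lemma nn: "n \<bullet> n = 1" using unit by (simp add: norm_eq_1)

lemma elev_base: "w \<in> base \<Longrightarrow> elev w = 0"
  using perp w0 by (simp add: elev_def base_def)

lemma elev_add: "elev (y + z) = elev y + n \<bullet> z" by (simp add: elev_def inner_diff_right inner_add_right)

lemma height_eq: "w \<in> base \<Longrightarrow> n \<bullet> (v - w) = height"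
  using elev_base[of w] by (simp add: height_def elev_def inner_diff_right)

lemma elev_bary: "elev x = bary v x * height"
  using normal_height(1)[OF v perp, of w0 x] w0 unfolding elev_def height_def base_def by simp

lemma n_eq: "n = height *\<^sub>R grd v"
  using normal_height(2)[OF v perp, of w0] w0 unfolding elev_def height_def base_def by simp

lemma height_nz: "height \<noteq> 0" using n_eq unit by auto

lemma \<beta>_add: "\<beta> w (y + z) = \<beta> w y + grad_\<beta> w \<bullet> z"
proof -
  have "\<beta> w (y + z) - \<beta> w y = grd w \<bullet> (z - (n \<bullet> z) *\<^sub>R n)"
    unfolding \<beta>_def bary_diff elev_add by (simp add: algebra_simps)
  then show ?thesis by (simp add: grad_\<beta>_def inner_diff_right inner_diff_left algebra_simps)
qed

lemma \<beta>_affine: "\<beta> w y = grad_\<beta> w \<bullet> y + \<beta> w 0"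
  using \<beta>_add[of w 0 y] by simp

lemma grad_\<beta>_n: "grad_\<beta> w \<bullet> n = 0" by (simp add: grad_\<beta>_def inner_diff_left nn)

lemma foot_bary: "bary v (y - elev y *\<^sub>R n) = 0"
proof -
  have "elev (y - elev y *\<^sub>R n) = 0" using elev_add[of y "- elev y *\<^sub>R n"] nn by simp
  then show ?thesis using elev_bary height_nz by simp
qed

lemma sum_\<beta>: "(\<Sum>w\<in>base. \<beta> w y) = 1" "(\<Sum>w\<in>base. \<beta> w y *\<^sub>R w) = y - elev y *\<^sub>R n"
  using bary_repr[of "y - elev y *\<^sub>R n"] foot_bary[of y] finite_C v
  by (simp_all add: \<beta>_def base_def sum_diff1)

lemma \<beta>_base: "w \<in> base \<Longrightarrow> w' \<in> base \<Longrightarrow> \<beta> w w' = (if w = w' then 1 else 0)"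
  by (simp add: \<beta>_def elev_base bary_vertex base_subset)

lemma grad_\<beta>_base: "w \<in> base \<Longrightarrow> w' \<in> base \<Longrightarrow> w'' \<in> base \<Longrightarrow>
    grad_\<beta> w \<bullet> (w' - w'') = (if w = w' then 1 else 0) - (if w = w'' then 1 else 0)"
  using \<beta>_add[of w w'' "w' - w''"] \<beta>_base[of w w'] \<beta>_base[of w w''] by simp

lemma hull_base_iff: "x \<in> convex hull base \<longleftrightarrow> elev x = 0 \<and> (\<forall>w\<in>base. 0 \<le> bary w x)"
  using face_decomposition[OF v, of x] elev_bary[of x] height_nz by (auto simp: base_def)

lemma foot_in_base: "(\<forall>w\<in>base. 0 \<le> \<beta> w y) \<longleftrightarrow> y - elev y *\<^sub>R n \<in> convex hull base"
  using elev_add[of y "- elev y *\<^sub>R n"] nn by (simp add: hull_base_iff \<beta>_def)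

text \<open>The coordinates \<open>\<beta>\<close> and \<open>elev\<close> make the prism a product, so that it can be cut up by inequalities.\<close>
lemma mem_slab: "y \<in> slab \<longleftrightarrow> (\<forall>w\<in>base. 0 \<le> \<beta> w y) \<and> 0 \<le> elev y \<and> elev y \<le> 1"
proof
  assume "y \<in> slab"
  then obtain x t where y: "y = x + t *\<^sub>R n" and x: "x \<in> convex hull base" and t: "0 \<le> t" "t \<le> 1"
    unfolding slab_def by auto
  have "elev y = t" using x nn unfolding y elev_add by (simp add: hull_base_iff)
  then show "(\<forall>w\<in>base. 0 \<le> \<beta> w y) \<and> 0 \<le> elev y \<and> elev y \<le> 1"
    using t x by (simp add: foot_in_base y)
next
  assume "(\<forall>w\<in>base. 0 \<le> \<beta> w y) \<and> 0 \<le> elev y \<and> elev y \<le> 1"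
  then have "y - elev y *\<^sub>R n \<in> convex hull base" "0 \<le> elev y" "elev y \<le> 1"
    using foot_in_base by auto
  moreover have "y = (y - elev y *\<^sub>R n) + elev y *\<^sub>R n" by simp
  ultimately show "y \<in> slab" unfolding slab_def by blast
qed

lemma compact_slab: "compact slab"
proof -
  have "slab = (\<lambda>(x, t). x + t *\<^sub>R n) ` ((convex hull base) \<times> {0..1})"
    unfolding slab_def by (force simp: image_iff)
  moreover have "compact ((\<lambda>(x, t). x + t *\<^sub>R n) ` ((convex hull base) \<times> {0..1::real}))"
    by (intro compact_continuous_image compact_Times finite_imp_compact_convex_hull finite_base)
       (auto intro!: continuous_intros simp: case_prod_unfold)
  ultimately show ?thesis by simp
qed

lemma closest_point_slab:
  assumes "y \<in> slab" shows "closest_point (convex hull base) y = y - elev y *\<^sub>R n"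
proof (rule closest_point_unique[symmetric])
  let ?x = "y - elev y *\<^sub>R n"
  show "convex (convex hull base)" by simp
  show "closed (convex hull base)"
    by (simp add: compact_imp_closed finite_base finite_imp_compact_convex_hull)
  show x: "?x \<in> convex hull base" using assms mem_slab foot_in_base by blast
  show "\<forall>z\<in>convex hull base. dist y ?x \<le> dist y z"
  proof
    fix z assume "z \<in> convex hull base"
    then have "n \<bullet> (z - ?x) = 0" using x elev_add[of ?x "z - ?x"] by (simp add: hull_base_iff)
    then have "\<bar>elev y\<bar> = \<bar>n \<bullet> (y - z)\<bar>" using nn
      by (simp add: inner_diff_right)
    also have "\<dots> \<le> norm (y - z)" using Cauchy_Schwarz_ineq2[of n "y - z"] unit by simp
    finally show "dist y ?x \<le> dist y z" using unit by (simp add: dist_norm)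
  qed
qed

text \<open>The affine reflection that exchanges the vertices \<open>w\<close> and \<open>w'\<close> of the facet and fixes the other ones.
  It shows that all vertices of the facet contribute equally to the integral of an affine function.\<close>
definition swap :: "real^'n \<Rightarrow> real^'n \<Rightarrow> real^'n \<Rightarrow> real^'n" where
  "swap w w' y = y + (\<beta> w y - \<beta> w' y) *\<^sub>R (w' - w)"

lemma swap_commute: "swap w w' = swap w' w"
  by (auto simp: swap_def fun_eq_iff algebra_simps)

lemma swap_rank_one: "swap w w' = (\<lambda>y. y + ((grad_\<beta> w - grad_\<beta> w') \<bullet> y + (\<beta> w 0 - \<beta> w' 0)) *\<^sub>R (w' - w))"
proof
  fix y show "swap w w' y = y + ((grad_\<beta> w - grad_\<beta> w') \<bullet> y + (\<beta> w 0 - \<beta> w' 0)) *\<^sub>R (w' - w)"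
    unfolding swap_def \<beta>_affine[of w y] \<beta>_affine[of w' y] by (simp add: inner_diff_left)
qed

context
  fixes w w' assumes w: "w \<in> base" "w' \<in> base" "w \<noteq> w'"
begin

lemma elev_swap: "elev (swap w w' y) = elev y"
  using perp w unfolding swap_def elev_add by (simp add: base_def)

lemma \<beta>_swap: "u \<in> base \<Longrightarrow> \<beta> u (swap w w' y) = (if u = w then \<beta> w' y else if u = w' then \<beta> w y else \<beta> u y)"
  using w grad_\<beta>_base[of u w' w] unfolding swap_def \<beta>_add by simp

lemma \<beta>_swap_nonneg: "(\<forall>u\<in>base. 0 \<le> \<beta> u (swap w w' y)) \<longleftrightarrow> (\<forall>u\<in>base. 0 \<le> \<beta> u y)"
  using w by (auto simp: \<beta>_swap split: if_splits)

lemma swap_swap: "swap w w' (swap w w' y) = y"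
  unfolding swap_def[of w w' "swap w w' y"] using w by (simp add: \<beta>_swap) (simp add: swap_def algebra_simps)

lemma swap_slab: "swap w w' y \<in> slab \<longleftrightarrow> y \<in> slab"
  by (simp add: mem_slab \<beta>_swap_nonneg elev_swap)

lemma swap_det: "(grad_\<beta> w - grad_\<beta> w') \<bullet> (w' - w) = -2"
  using w grad_\<beta>_base[of w w' w] grad_\<beta>_base[of w' w' w] by (simp add: inner_diff_left)

end

text \<open>The part of the prism below the graph of \<open>\<beta> w\<close>.  Up to a null set it is the simplex with the same facet
  and with apex \<open>w + n\<close>.\<close>
definition wedge :: "real^'n \<Rightarrow> (real^'n) set" where
  "wedge w = {y. (\<forall>u\<in>base. 0 \<le> \<beta> u y) \<and> 0 \<le> elev y \<and> elev y < \<beta> w y}"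

lemma continuous_\<beta>: "continuous_on A (\<lambda>y. \<beta> w y)" and continuous_elev: "continuous_on A (\<lambda>y. elev y)"
proof -
  have "continuous_on A (\<lambda>y. grad_\<beta> w \<bullet> y + \<beta> w 0)" by (intro continuous_intros)
  then show "continuous_on A (\<lambda>y. \<beta> w y)" unfolding \<beta>_affine[symmetric] .
  show "continuous_on A (\<lambda>y. elev y)" unfolding elev_def by (intro continuous_intros)
qed

lemma borel_\<beta> [measurable]: "\<beta> w \<in> borel_measurable borel" and borel_elev [measurable]: "elev \<in> borel_measurable borel"
  using borel_measurable_continuous_onI continuous_\<beta> continuous_elev by blast+

lemma slice_lmeasurable:
  assumes [measurable]: "f \<in> borel_measurable borel" "g \<in> borel_measurable borel" and
    fg: "\<And>y. \<forall>u\<in>base. 0 \<le> \<beta> u y \<Longrightarrow> 0 \<le> f y \<and> g y \<le> (1::real)"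
  shows "{y. (\<forall>u\<in>base. 0 \<le> \<beta> u y) \<and> f y \<le> elev y \<and> elev y < g y} \<in> lmeasurable"
proof (rule bounded_set_imp_lmeasurable)
  show "bounded {y. (\<forall>u\<in>base. 0 \<le> \<beta> u y) \<and> f y \<le> elev y \<and> elev y < g y}"
    using fg by (intro bounded_subset[OF compact_imp_bounded[OF compact_slab]]) (force simp: mem_slab)
  have "{y. (\<forall>u\<in>base. 0 \<le> \<beta> u y) \<and> f y \<le> elev y \<and> elev y < g y} \<in> sets borel"
    using finite_base by measurable
  then show "{y. (\<forall>u\<in>base. 0 \<le> \<beta> u y) \<and> f y \<le> elev y \<and> elev y < g y} \<in> sets lebesgue"
    by simp
qed

lemma \<beta>_le_1: "\<forall>u\<in>base. 0 \<le> \<beta> u y \<Longrightarrow> A \<subseteq> base \<Longrightarrow> (\<Sum>u\<in>A. \<beta> u y) \<le> 1"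
  unfolding sum_\<beta>(1)[of y, symmetric] by (rule sum_mono2) (auto simp: finite_base)

lemma wedge_lmeasurable: "w \<in> base \<Longrightarrow> wedge w \<in> lmeasurable"
  unfolding wedge_def using \<beta>_le_1[of _ "{w}"] by (intro slice_lmeasurable) auto

lemma measure_wedge_eq:
  assumes "w \<in> base" "w' \<in> base" shows "measure lebesgue (wedge w) = measure lebesgue (wedge w')"
proof (cases "w = w'")
  case False
  note w = assms False
  have sub: "swap w w' ` wedge w \<subseteq> wedge w'" if w: "w \<in> base" "w' \<in> base" "w \<noteq> w'" for w w'
    using w by (auto simp: wedge_def \<beta>_swap_nonneg[OF w] elev_swap[OF w] \<beta>_swap[OF w])
  have "swap w w' ` wedge w = wedge w'"
  proof
    show "wedge w' \<subseteq> swap w w' ` wedge w"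
    proof
      fix y assume "y \<in> wedge w'"
      then have "swap w w' y \<in> wedge w" using sub[of w' w] w swap_commute[of w w'] by auto
      then have "swap w w' (swap w w' y) \<in> swap w w' ` wedge w" by blast
      then show "y \<in> swap w w' ` wedge w" by (simp add: swap_swap[OF w])
    qed
  qed (rule sub[OF w])
  moreover have "measure lebesgue (swap w w' ` wedge w) = measure lebesgue (wedge w)"
    unfolding swap_rank_one using measure_rank_one_image(2)[OF dim wedge_lmeasurable[OF assms(1)]] swap_det[OF w]
    by simp
  ultimately show ?thesis by simp
qed simp

text \<open>The coordinates \<open>\<beta>\<close> add up to one.  Stacking the graphs of their partial sums therefore cuts the prism into as many
  layers as the facet has vertices, and a shear along \<open>n\<close> moves each layer down to a wedge.\<close>
lemma measure_slab:
  assumes w: "w \<in> base"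
  shows "measure lebesgue slab = CARD('n) * measure lebesgue (wedge w)"
proof -
  obtain e where e: "bij_betw e {..<CARD('n)} base"
    using ex_bij_betw_nat_finite[OF finite_base] by (auto simp: card_base atLeast0LessThan)
  define S where "S k y = (\<Sum>j<k. \<beta> (e j) y)" for k y
  define A where "A k = {y. (\<forall>u\<in>base. 0 \<le> \<beta> u y) \<and> S k y \<le> elev y \<and> elev y < S (Suc k) y}" for k
  have eb: "e j \<in> base" if "j < CARD('n)" for j using e that by (auto simp: bij_betw_def)
  have S_mono: "S j y \<le> S k y" if "\<forall>u\<in>base. 0 \<le> \<beta> u y" "j \<le> k" "k \<le> CARD('n)" for j k y
    unfolding S_def using that eb by (intro sum_mono2) auto
  have S0: "S 0 y = 0" for y by (simp add: S_def)
  have Sd: "S (CARD('n)) y = 1" for y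
    unfolding S_def using sum.reindex_bij_betw[OF e, of "\<lambda>u. \<beta> u y"] sum_\<beta>(1) by simp
  have S_borel: "S k \<in> borel_measurable borel" for k unfolding S_def[abs_def] by measurable
  have A_meas: "A k \<in> lmeasurable" if k: "k < CARD('n)" for k
    unfolding A_def
  proof (rule slice_lmeasurable[OF S_borel S_borel])
    fix y assume y: "\<forall>u\<in>base. 0 \<le> \<beta> u y"
    show "0 \<le> S k y \<and> S (Suc k) y \<le> 1"
      using S_mono[OF y, of 0 k] S_mono[OF y, of "Suc k" "CARD('n)"] k by (simp add: S0 Sd)
  qed
  have A_measure: "measure lebesgue (A k) = measure lebesgue (wedge w)" if k: "k < CARD('n)" for k
  proof -
    let ?\<Gamma> = "\<Sum>j<k. grad_\<beta> (e j)"
    have \<Gamma>n: "?\<Gamma> \<bullet> n = 0" by (simp add: inner_sum_left grad_\<beta>_n)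
    have Sa: "S k y = ?\<Gamma> \<bullet> y + S k 0" for y
      unfolding S_def inner_sum_left \<beta>_affine[of _ y] by (simp add: sum.distrib)
    \<comment> \<open>\<open>f 1\<close> lifts the wedge to the \<open>k\<close>-th layer, \<open>f (-1)\<close> is its inverse\<close>
    define f where "f c y = y + (c * S k y) *\<^sub>R n" for c y
    have Sf: "S j (f c y) = S j y" for j c y
      unfolding S_def f_def \<beta>_add by (simp add: grad_\<beta>_n)
    have \<beta>f: "\<beta> u (f c y) = \<beta> u y" for u c y
      unfolding \<beta>_add f_def by (simp add: grad_\<beta>_n)
    have sf: "elev (f c y) = elev y + c * S k y" for c y
      unfolding elev_add f_def by (simp add: nn)
    have SS: "S (Suc k) y = S k y + \<beta> (e k) y" for y by (simp add: S_def)
    have "f 1 ` wedge (e k) = A k"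
    proof (intro equalityI subsetI)
      fix y assume "y \<in> f 1 ` wedge (e k)"
      then show "y \<in> A k" by (auto simp: A_def wedge_def \<beta>f sf Sf SS)
    next
      fix y assume "y \<in> A k"
      then have "f (-1) y \<in> wedge (e k)" by (simp add: A_def wedge_def \<beta>f sf SS)
      moreover have "f 1 (f (-1) y) = y"
        unfolding f_def[of 1] Sf by (simp add: f_def)
      ultimately show "y \<in> f 1 ` wedge (e k)" by (metis image_eqI)
    qed
    moreover have f1: "f 1 = (\<lambda>y. y + (?\<Gamma> \<bullet> y + S k 0) *\<^sub>R n)"
      unfolding f_def Sa[symmetric] by simp
    have "measure lebesgue (f 1 ` wedge (e k)) = \<bar>1 + ?\<Gamma> \<bullet> n\<bar> * measure lebesgue (wedge (e k))"
      unfolding f1 by (rule measure_rank_one_image(2)[OF dim wedge_lmeasurable[OF eb[OF k]]])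
    then have "measure lebesgue (f 1 ` wedge (e k)) = measure lebesgue (wedge (e k))"
      unfolding \<Gamma>n by simp
    ultimately show ?thesis using measure_wedge_eq[OF eb[OF k] w] by simp
  qed
  have disj: "A j \<inter> A k = {}" if jk: "j < k" "k < CARD('n)" for j k
  proof -
    have False if "y \<in> A j" "y \<in> A k" for y
      using that S_mono[of y "Suc j" k] jk by (auto simp: A_def)
    then show ?thesis by auto
  qed
  have union: "(\<Union>k<CARD('n). A k) = {y \<in> slab. elev y < 1}"
  proof (intro equalityI subsetI)
    fix y assume "y \<in> (\<Union>k<CARD('n). A k)"
    then obtain k where k: "k < CARD('n)" "y \<in> A k" by auto
    then have y: "\<forall>u\<in>base. 0 \<le> \<beta> u y" by (simp add: A_def)
    show "y \<in> {y \<in> slab. elev y < 1}"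
      using S_mono[OF y, of 0 k] S_mono[OF y, of "Suc k" "CARD('n)"] k y by (auto simp: S0 Sd A_def mem_slab)
  next
    fix y assume y: "y \<in> {y \<in> slab. elev y < 1}"
    have "\<exists>k<CARD('n). (\<forall>i\<le>k. \<not> elev y < S i y) \<and> elev y < S (Suc k) y"
      using y by (intro ex_least_nat_less) (auto simp: S0 Sd mem_slab)
    then show "y \<in> (\<Union>k<CARD('n). A k)" using y by (auto simp: A_def mem_slab not_less)
  qed
  have "measure lebesgue slab = measure lebesgue (\<Union>k<CARD('n). A k)"
  proof (rule measure_negligible_symdiff)
    show "(\<Union>k<CARD('n). A k) \<in> lmeasurable" using A_meas by auto
    have "(\<Union>k<CARD('n). A k) \<subseteq> slab" unfolding union by auto
    moreover have "slab - (\<Union>k<CARD('n). A k) \<subseteq> {x. n \<bullet> x = 1 + n \<bullet> w0}"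
      unfolding union by (auto simp: mem_slab elev_def inner_diff_right)
    moreover have "negligible {x. n \<bullet> x = 1 + n \<bullet> w0}" using unit by (intro negligible_hyperplane) auto
    ultimately show "negligible (((\<Union>k<CARD('n). A k) - slab) \<union> (slab - (\<Union>k<CARD('n). A k)))"
      by (metis Diff_eq_empty_iff negligible_subset sup_bot_left)
  qed
  also have "\<dots> = (\<Sum>k<CARD('n). measure lebesgue (A k))"
  proof (rule measure_negligible_finite_Union_image)
    show "pairwise (\<lambda>j k. negligible (A j \<inter> A k)) {..<CARD('n)}"
      unfolding pairwise_def using disj by (metis Int_commute lessThan_iff linorder_neqE_nat negligible_empty)
  qed (use A_meas in auto)
  also have "\<dots> = CARD('n) * measure lebesgue (wedge w)" using A_measure by simp
  finally show ?thesis .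
qed

text \<open>The rank-one map that fixes the hyperplane of the facet and takes \<open>w + n\<close> to \<open>v\<close> carries the wedge
  to the simplex and multiplies volumes by the absolute value of the height.\<close>
lemma measure_simplex_wedge:
  assumes w: "w \<in> base"
  shows "measure lebesgue (convex hull C) = \<bar>height\<bar> * measure lebesgue (wedge w)"
proof -
  let ?a = "v - w - n"
  define \<Theta> where "\<Theta> y = y + elev y *\<^sub>R ?a" for y
  have na: "n \<bullet> ?a = height - 1" using height_eq[OF w] nn by (simp add: inner_diff_right)
  have elev\<Theta>: "elev (\<Theta> y) = elev y * height" for y
    unfolding \<Theta>_def elev_add inner_scaleR_right na by (simp add: algebra_simps)
  then have bv: "bary v (\<Theta> y) = elev y" for y using elev_bary[of "\<Theta> y"] height_nz by simp
  have bu: "bary u (\<Theta> y) = \<beta> u y - (if u = w then elev y else 0)" if u: "u \<in> base" for u y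
  proof -
    have "bary u (\<Theta> y) - bary u (y - elev y *\<^sub>R n) = elev y * (grd u \<bullet> (v - w))"
      unfolding bary_diff \<Theta>_def by (simp add: algebra_simps inner_diff_right)
    also have "grd u \<bullet> (v - w) = - (if u = w then 1 else 0)"
      unfolding bary_diff[symmetric] using u w v by (simp add: bary_vertex base_subset base_neq)
    finally show ?thesis by (cases "u = w") (simp_all add: \<beta>_def)
  qed
  have im: "\<Theta> ` wedge w = {x \<in> convex hull C. 0 < bary w x}"
  proof (intro equalityI subsetI)
    fix x assume "x \<in> \<Theta> ` wedge w"
    then obtain y where y: "y \<in> wedge w" "x = \<Theta> y" by auto
    have "0 \<le> bary u x" if "u \<in> C" for u
      using y that bu[of u y] bv[of y] by (cases "u = v") (auto simp: wedge_def base_def)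
    moreover have "0 < bary w x" using y bu[OF w] by (auto simp: wedge_def)
    ultimately show "x \<in> {x \<in> convex hull C. 0 < bary w x}" by (simp add: mem_hull_iff)
  next
    fix x assume x: "x \<in> {x \<in> convex hull C. 0 < bary w x}"
    define y where "y = x + (- bary v x) *\<^sub>R ?a"
    have sy: "elev y = bary v x"
      unfolding y_def elev_add inner_scaleR_right na elev_bary[of x] by (simp add: algebra_simps)
    then have xy: "\<Theta> y = x" by (simp add: \<Theta>_def y_def)
    have "\<beta> u y = bary u x + (if u = w then elev y else 0)" if "u \<in> base" for u
      using bu[OF that, of y] xy by simp
    then have "y \<in> wedge w" using x w v by (auto simp: wedge_def sy mem_hull_iff base_def)
    then show "x \<in> \<Theta> ` wedge w" using xy by blast
  qed
  have \<Theta>: "\<Theta> = (\<lambda>y. y + (n \<bullet> y + (- (n \<bullet> w0))) *\<^sub>R ?a)"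
    by (auto simp: \<Theta>_def elev_def inner_diff_right)
  have "measure lebesgue (convex hull C) = measure lebesgue (\<Theta> ` wedge w)"
  proof (rule measure_negligible_symdiff)
    show "\<Theta> ` wedge w \<in> lmeasurable"
      unfolding \<Theta> by (rule measure_rank_one_image(1)[OF dim wedge_lmeasurable[OF w]])
    have "\<Theta> ` wedge w \<subseteq> convex hull C" unfolding im by auto
    moreover have "convex hull C - \<Theta> ` wedge w \<subseteq> {x. grd w \<bullet> x = grd w \<bullet> w - 1}"
      unfolding im using base_subset[OF w] by (auto simp: mem_hull_iff bary_def inner_diff_right) force
    moreover have "grd w \<noteq> 0"
      using bary_diff[of w w v] bary_vertex[of w w] bary_vertex[of w v] w v base_subset base_neq by auto
    then have "negligible {x. grd w \<bullet> x = grd w \<bullet> w - 1}" by (intro negligible_hyperplane) auto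
    ultimately show "negligible ((\<Theta> ` wedge w - convex hull C) \<union> (convex hull C - \<Theta> ` wedge w))"
      by (metis Diff_eq_empty_iff negligible_subset sup_bot_left)
  qed
  also have "\<dots> = \<bar>height\<bar> * measure lebesgue (wedge w)"
    unfolding \<Theta> using measure_rank_one_image(2)[OF dim wedge_lmeasurable[OF w], of n "- (n \<bullet> w0)" ?a] na by simp
  finally show ?thesis .
qed

lemma measure_wedge:
  "w \<in> base \<Longrightarrow> measure lebesgue (wedge w) = measure lebesgue (convex hull C) / \<bar>height\<bar>"
  using measure_simplex_wedge height_nz by simp

lemma area_prism: "measure lebesgue slab = CARD('n) * measure lebesgue (convex hull C) / \<bar>height\<bar>"
  using measure_slab[OF w0] measure_wedge[OF w0] by simp

lemma integrable_\<beta>: "integrable lborel (\<lambda>y. indicator slab y *\<^sub>R \<beta> w y)"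
  by (rule borel_integrable_compact[OF compact_slab continuous_\<beta>])

lemma borel_slab [measurable]: "slab \<in> sets borel"
  using compact_slab by (simp add: compact_imp_closed)

text \<open>By the reflections the integrals agree for all vertices of the facet, and together they give the volume of the prism.\<close>
lemma integral_\<beta>:
  assumes w: "w \<in> base"
  shows "(\<integral>y. indicator slab y *\<^sub>R \<beta> w y \<partial>lborel) = measure lebesgue (convex hull C) / \<bar>height\<bar>"
proof -
  have eq: "(\<integral>y. indicator slab y *\<^sub>R \<beta> w' y \<partial>lborel) = (\<integral>y. indicator slab y *\<^sub>R \<beta> w y \<partial>lborel)"
    if w': "w' \<in> base" for w'
  proof (cases "w = w'")
    case False
    note ww = w w' False
    have d: "distr lborel borel (swap w w') = lborel"
      unfolding swap_rank_one by (rule distr_rank_one_lborel[OF dim swap_det[OF ww]])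
    have [measurable]: "swap w w' \<in> borel_measurable borel"
      unfolding swap_def[abs_def] by measurable
    have "(\<integral>y. indicator slab y *\<^sub>R \<beta> w y \<partial>lborel) = (\<integral>y. indicator slab y *\<^sub>R \<beta> w y \<partial>(distr lborel borel (swap w w')))"
      by (simp add: d)
    also have "\<dots> = (\<integral>y. indicator slab (swap w w' y) *\<^sub>R \<beta> w (swap w w' y) \<partial>lborel)"
      by (rule integral_distr) measurable
    also have "\<dots> = (\<integral>y. indicator slab y *\<^sub>R \<beta> w' y \<partial>lborel)"
      using w by (simp add: indicator_def swap_slab[OF ww] \<beta>_swap[OF ww])
    finally show ?thesis ..
  qed simp
  have "CARD('n) * (\<integral>y. indicator slab y *\<^sub>R \<beta> w y \<partial>lborel) = (\<Sum>w'\<in>base. \<integral>y. indicator slab y *\<^sub>R \<beta> w' y \<partial>lborel)"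
    using eq by (simp add: card_base)
  also have "\<dots> = (\<integral>y. (\<Sum>w'\<in>base. indicator slab y *\<^sub>R \<beta> w' y) \<partial>lborel)"
    by (rule Bochner_Integration.integral_sum[symmetric]) (rule integrable_\<beta>)
  also have "\<dots> = (\<integral>y. indicator slab y \<partial>lborel)"
    by (simp add: sum_distrib_left[symmetric] sum_\<beta>)
  also have "\<dots> = measure lebesgue slab" by simp
  also have "\<dots> = CARD('n) * (measure lebesgue (convex hull C) / \<bar>height\<bar>)" using area_prism by simp
  finally show ?thesis by (simp del: times_divide_eq_right)
qed

text \<open>An affine function of the foot point is the combination of its vertex values with weights \<open>\<beta>\<close>.  The common
  weight in the result is stated through the volume of the simplex rather than the area of the facet, as needed for the
  divergence theorem.\<close>
lemma prism_integral_affine: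
  fixes f :: "real^'n \<Rightarrow> 'b::euclidean_space"
  assumes f: "linear f"
  shows "set_integrable lebesgue slab (\<lambda>y. f (closest_point (convex hull base) y) + c)"
    and "set_lebesgue_integral lebesgue slab (\<lambda>y. f (closest_point (convex hull base) y) + c)
      = (measure lebesgue (convex hull C) / \<bar>height\<bar>) *\<^sub>R (\<Sum>w\<in>base. f w + c)"
proof -
  let ?g = "\<lambda>y. \<Sum>w\<in>base. (indicator slab y *\<^sub>R \<beta> w y) *\<^sub>R (f w + c)"
  have pt: "indicator slab y *\<^sub>R (f (closest_point (convex hull base) y) + c) = ?g y" for y
  proof (cases "y \<in> slab")
    case True
    have "f (closest_point (convex hull base) y) = (\<Sum>w\<in>base. \<beta> w y *\<^sub>R f w)"
      unfolding closest_point_slab[OF True] sum_\<beta>(2)[symmetric] linear_sum[OF f] linear_cmul[OF f] ..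
    moreover have "c = (\<Sum>w\<in>base. \<beta> w y) *\<^sub>R c" by (simp add: sum_\<beta>)
    ultimately show ?thesis using True
      by (simp add: scaleR_add_right sum.distrib scaleR_sum_left)
  qed simp
  have int: "integrable lborel ?g"
    by (intro Bochner_Integration.integrable_sum integrable_scaleR_left) (rule integrable_\<beta>)
  then have int': "integrable lebesgue ?g" by (subst integrable_completion) (auto simp: borel_measurable_integrable)
  then show "set_integrable lebesgue slab (\<lambda>y. f (closest_point (convex hull base) y) + c)"
    unfolding set_integrable_def pt .
  have "integral\<^sup>L lebesgue ?g = integral\<^sup>L lborel ?g"
    using int by (intro integral_completion) auto
  also have "\<dots> = (\<Sum>w\<in>base. (\<integral>y. indicator slab y *\<^sub>R \<beta> w y \<partial>lborel) *\<^sub>R (f w + c))"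
    using integrable_\<beta> by (subst Bochner_Integration.integral_sum) (auto simp del: real_scaleR_def)
  also have "\<dots> = (measure lebesgue (convex hull C) / \<bar>height\<bar>) *\<^sub>R (\<Sum>w\<in>base. f w + c)"
    by (simp add: integral_\<beta>[simplified] scaleR_sum_right)
  finally show "set_lebesgue_integral lebesgue slab (\<lambda>y. f (closest_point (convex hull base) y) + c)
      = (measure lebesgue (convex hull C) / \<bar>height\<bar>) *\<^sub>R (\<Sum>w\<in>base. f w + c)"
    unfolding set_lebesgue_integral_def pt .
qed

text \<open>Feet on the relative boundary of the facet have a vanishing coordinate \<open>\<beta> w\<close>, which confines the point to a hyperplane.\<close>
lemma AE_foot_rel_interior:
  "AE y in lebesgue. y \<in> slab \<longrightarrow> closest_point (convex hull base) y \<in> rel_interior (convex hull base)"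
proof (rule AE_I')
  let ?N = "\<Union>w\<in>base. {y. grad_\<beta> w \<bullet> y = - \<beta> w 0}"
  have "negligible {y. grad_\<beta> w \<bullet> y = - \<beta> w 0}" if w: "w \<in> base" for w
  proof -
    have "base \<noteq> {w}" using card_base dim by auto
    then obtain w' where "w' \<in> base" "w' \<noteq> w" using w by auto
    then have "grad_\<beta> w \<noteq> 0" using grad_\<beta>_base[OF w w, of w'] by auto
    then show ?thesis by (intro negligible_hyperplane) auto
  qed
  then show "?N \<in> null_sets lebesgue"
    using finite_base by (auto simp: negligible_iff_null_sets[symmetric] intro!: negligible_Union)
  have indep_base: "\<not> affine_dependent base"
    using affine_independent_subset[OF indep, of base] by (auto simp: base_def)
  have "closest_point (convex hull base) y \<in> rel_interior (convex hull base)"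
    if y: "y \<in> slab" "y \<notin> ?N" for y
  proof -
    have "0 < \<beta> w y" if "w \<in> base" for w
      using y that \<beta>_affine[of w y] by (force simp: mem_slab less_le)
    then have "\<exists>c. (\<forall>w\<in>base. 0 < c w) \<and> sum c base = 1 \<and> (\<Sum>w\<in>base. c w *\<^sub>R w) = closest_point (convex hull base) y"
      unfolding closest_point_slab[OF y(1)] using sum_\<beta>[of y] by (intro exI[of _ "\<lambda>w. \<beta> w y"]) auto
    then show ?thesis
      unfolding rel_interior_convex_hull_explicit[OF indep_base] by simp
  qed
  then show "{y \<in> space lebesgue. \<not> (y \<in> slab \<longrightarrow> closest_point (convex hull base) y \<in> rel_interior (convex hull base))} \<subseteq> ?N"
    by auto
qed

text \<open>Going off the facet along the normal, on the side of \<open>v\<close>, one enters the simplex at once: the coordinate of \<open>v\<close>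
  becomes positive and the others stay positive.\<close>
lemma eventually_interior:
  assumes x: "x \<in> rel_interior (convex hull base)"
  shows "eventually (\<lambda>t. x + (t * sgn height) *\<^sub>R n \<in> interior (convex hull C)) (at_right 0)"
proof -
  have indep_base: "\<not> affine_dependent base"
    using affine_independent_subset[OF indep, of base] by (auto simp: base_def)
  obtain u where u: "\<And>w. w \<in> base \<Longrightarrow> 0 < u w" "sum u base = 1" "x = (\<Sum>w\<in>base. u w *\<^sub>R w)"
    using x unfolding rel_interior_convex_hull_explicit[OF indep_base] by auto
  have xb: "bary w x = u w" if w: "w \<in> base" for w
  proof -
    have "bary w x = (\<Sum>w'\<in>base. u w' * bary w w')"
      unfolding u(3) by (rule bary_affine_comb[OF finite_base u(2)])
    also have "\<dots> = (\<Sum>w'\<in>base. if w = w' then u w' else 0)"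
      using w by (intro sum.cong) (auto simp: bary_vertex base_subset)
    finally show ?thesis using w finite_base by simp
  qed
  have sx: "elev x = 0"
    using x rel_interior_subset hull_base_iff by blast
  have ev: "eventually (\<lambda>t. 0 < bary w (x + (t * sgn height) *\<^sub>R n)) (at_right 0)" if w: "w \<in> base" for w
  proof -
    have eq: "bary w (x + (t * sgn height) *\<^sub>R n) = u w + t * (sgn height * (grd w \<bullet> n))" for t
      using bary_diff[of w "x + (t * sgn height) *\<^sub>R n" x] by (simp add: xb[OF w])
    have "((\<lambda>t. u w + t * (sgn height * (grd w \<bullet> n))) \<longlongrightarrow> u w + 0 * (sgn height * (grd w \<bullet> n))) (at_right 0)"
      by (intro tendsto_intros)
    then show ?thesis unfolding eq using u(1)[OF w] by (auto dest: order_tendstoD(1))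
  qed
  have "eventually (\<lambda>t. \<forall>w\<in>base. 0 < bary w (x + (t * sgn height) *\<^sub>R n)) (at_right 0)"
    using ev finite_base by (simp add: eventually_ball_finite_distrib)
  moreover have "eventually (\<lambda>t::real. 0 < t) (at_right 0)"
    by (simp add: eventually_at_right_less)
  ultimately show ?thesis
  proof eventually_elim
    case (elim t)
    let ?y = "x + (t * sgn height) *\<^sub>R n"
    have "bary v ?y * height = t * sgn height"
      using sx unfolding elev_bary[symmetric] elev_add by (simp add: nn)
    then have "bary v ?y * \<bar>height\<bar> = t" using height_nz by (auto simp: sgn_if abs_if split: if_splits)
    then have "0 < bary v ?y" using elim by (metis abs_ge_zero mult_nonpos_nonneg not_le)
    then have pos: "\<forall>w\<in>C. 0 < bary w ?y" using elim by (auto simp: base_def)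
    have "open {y. \<forall>w\<in>C. 0 < bary w y}"
      unfolding Collect_ball_eq bary_def
      by (intro open_INT finite_C ballI open_Collect_less continuous_intros)
    moreover have "{y. \<forall>w\<in>C. 0 < bary w y} \<subseteq> convex hull C"
      by (auto simp: mem_hull_iff less_imp_le)
    ultimately have "{y. \<forall>w\<in>C. 0 < bary w y} \<subseteq> interior (convex hull C)"
      by (rule interior_maximal[rotated])
    then show "?y \<in> interior (convex hull C)" using pos by blast
  qed
qed

lemma hull_side: "x \<in> convex hull base \<Longrightarrow> y \<in> convex hull C \<Longrightarrow> 0 \<le> (n \<bullet> (y - x)) * height"
proof -
  assume x: "x \<in> convex hull base" and y: "y \<in> convex hull C"
  have "n \<bullet> (y - x) = bary v y * height"
    using x elev_add[of x "y - x"] elev_bary[of y] by (simp add: hull_base_iff)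
  then have "(n \<bullet> (y - x)) * height = bary v y * (height * height)" by simp
  moreover have "0 \<le> bary v y * (height * height)" using y v by (simp add: mem_hull_iff)
  ultimately show ?thesis by (simp only:)
qed

lemma measure_hull_pos: "0 < measure lebesgue (convex hull C)"
proof -
  have "rel_interior (convex hull C) = interior (convex hull C)"
    by (rule rel_interior_interior) (simp add: affine_hull_C)
  moreover have "rel_interior (convex hull C) \<noteq> {}"
    using v by (auto simp: rel_interior_eq_empty)
  ultimately have "interior (convex hull C) \<noteq> {}" by simp
  then have "\<not> negligible (convex hull C)"
    using negligible_convex_interior by blast
  moreover have "convex hull C \<in> lmeasurable"
    using finite_C by (simp add: lmeasurable_compact finite_imp_compact_convex_hull)
  ultimately show ?thesis
    using negligible_iff_measure by (metis measure_nonneg order_le_imp_less_or_eq)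
qed

end

section \<open>Cells and faces of the mesh\<close>

text \<open>The coefficients of a lattice vector are bounded by its norm, as the basis map is injective and linear.\<close>
lemma finite_bounded_lattice:
  fixes L :: "(real^'n::finite) set"
  assumes "period_lattice L"
  shows "finite {l \<in> L. norm l \<le> r}"
proof -
  obtain b :: "'n \<Rightarrow> real^'n" where b: "inj b" "independent (range b)"
    and L: "L = range (\<lambda>k :: 'n \<Rightarrow> int. \<Sum>i\<in>UNIV. of_int (k i) *\<^sub>R b i)"
    using assms unfolding period_lattice_def by auto
  define T where "T x = (\<Sum>i\<in>UNIV. x $ i *\<^sub>R b i)" for x :: "real^'n"
  have linT: "linear T" unfolding T_def
    by (rule linearI) (simp_all add: sum.distrib scaleR_add_left scaleR_sum_right)
  have "inj T"
  proof (rule linear_inj_on_iff_eq_0[OF linT, THEN iffD2, rule_format]; simp)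
    fix x assume "T x = 0"
    then have "(\<Sum>w\<in>range b. (x $ inv b w) *\<^sub>R w) = 0"
      unfolding T_def by (subst sum.reindex[OF b(1)]) (simp add: b(1))
    then have "\<forall>w\<in>range b. x $ inv b w = 0"
      using b(2) independentD[of "range b" "range b" "\<lambda>w. x $ inv b w"] by auto
    then show "x = 0" using b(1) by (auto simp: vec_eq_iff)
  qed
  then obtain B where B: "B > 0" "\<And>x. B * norm x \<le> norm (T x)"
    using linear_inj_bounded_below_pos[OF linT] by metis
  define m where "m = \<lceil>r / B\<rceil>"
  have "{l \<in> L. norm l \<le> r} \<subseteq> (\<lambda>k. \<Sum>i\<in>UNIV. of_int (k i) *\<^sub>R b i) ` (PiE UNIV (\<lambda>_. {-m..m}))"
  proof
    fix l assume "l \<in> {l \<in> L. norm l \<le> r}"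
    then obtain k :: "'n \<Rightarrow> int" where k: "l = (\<Sum>i\<in>UNIV. of_int (k i) *\<^sub>R b i)" and r: "norm l \<le> r"
      unfolding L by auto
    let ?x = "(\<chi> i. of_int (k i)) :: real^'n"
    have "T ?x = l" unfolding T_def k by simp
    then have "norm ?x \<le> r / B" using B(2)[of ?x] r B(1) by (simp add: field_simps)
    then have "\<bar>of_int (k i)\<bar> \<le> r / B" for i
      using component_le_norm_cart[of ?x i] by simp
    then have "\<bar>k i\<bar> \<le> m" for i
      unfolding m_def by (metis of_int_abs of_int_le_iff le_of_int_ceiling order_trans)
    then have "k i \<in> {-m..m}" for i by (simp add: abs_le_iff minus_le_iff)
    then show "l \<in> (\<lambda>k. \<Sum>i\<in>UNIV. of_int (k i) *\<^sub>R b i) ` (PiE UNIV (\<lambda>_. {-m..m}))"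
      using k by auto
  qed
  moreover have "finite (PiE (UNIV :: 'n set) (\<lambda>_. {-m..m}))" by (intro finite_PiE) auto
  ultimately show ?thesis by (meson finite_imageI finite_subset)
qed

locale mesh_geometry =
  fixes M :: "'n::finite mesh"
  assumes mesh: "mhd_mesh M"
begin

lemma dim: "CARD('n) = 2 \<or> CARD('n) = 3"
  and coord: "bij_betw (coord M) UNIV {1..CARD('n)}"
  and region_cases: "bounded_domain M \<or> flat_torus M"
  and triangulated: "triangulated M" and faces_of: "faces_of_mesh M" and normals_of: "normals_of_mesh M"
  using mesh unfolding mhd_mesh_def by auto

lemma finite_elems: "finite (elems M)"
  and region_eq: "region M = interior (\<Union>(cover M))"
  and msize_pos: "0 < msize M"
  using triangulated by (simp_all add: triangulated_def)

lemma elem_simplex: "K \<in> elems M \<Longrightarrow> int CARD('n) simplex K"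
  and elem_translate: "K \<in> elems M \<Longrightarrow> l \<in> periods M \<Longrightarrow> (+) l ` K \<in> elems M \<Longrightarrow> l = 0"
  and cover_face: "K \<in> cover M \<Longrightarrow> K' \<in> cover M \<Longrightarrow> K \<inter> K' face_of K \<and> K \<inter> K' face_of K'"
  using triangulated by (simp_all add: triangulated_def)

lemma finite_faces: "finite (faces M)"
  and face_cell: "\<sigma> \<in> faces M \<Longrightarrow> \<exists>K\<in>cover M. \<sigma> facet_of K"
  using faces_of by (simp_all add: faces_of_mesh_def)

lemma facet_face:
  assumes "K \<in> cover M" "F facet_of K"
  shows "\<exists>!\<sigma>. \<sigma> \<in> faces M \<and> (\<exists>l\<in>periods M. F = (+) l ` \<sigma>)"
proof -
  have "\<forall>K\<in>cover M. \<forall>F. F facet_of K \<longrightarrow> (\<exists>!\<sigma>. \<sigma> \<in> faces M \<and> (\<exists>l\<in>periods M. F = (+) l ` \<sigma>))"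
    using faces_of unfolding faces_of_mesh_def by (elim conjE)
  from bspec[OF this assms(1), THEN spec, THEN mp, OF assms(2)] show ?thesis .
qed

lemma norm_normal: "\<sigma> \<in> faces M \<Longrightarrow> norm (normal M \<sigma>) = 1"
  and normal_perp: "\<sigma> \<in> faces M \<Longrightarrow> x \<in> \<sigma> \<Longrightarrow> y \<in> \<sigma> \<Longrightarrow> normal M \<sigma> \<bullet> (y - x) = 0"
  and normal_outward: "\<sigma> \<in> bdry_faces M \<Longrightarrow> K \<in> cover M \<Longrightarrow> \<sigma> facet_of K \<Longrightarrow> x \<in> \<sigma> \<Longrightarrow> y \<in> K \<Longrightarrow>
      normal M \<sigma> \<bullet> (y - x) \<le> 0"
  using normals_of unfolding normals_of_mesh_def by auto

lemma periods_cases: "periods M = {0} \<or> period_lattice (periods M)"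
  using region_cases unfolding bounded_domain_def flat_torus_def by auto

lemma period_0: "0 \<in> periods M"
proof -
  have "0 \<in> periods M" if L: "period_lattice (periods M)"
  proof -
    obtain b :: "'n \<Rightarrow> real^'n" where "periods M = range (\<lambda>k :: 'n \<Rightarrow> int. \<Sum>i\<in>UNIV. of_int (k i) *\<^sub>R b i)"
      using L unfolding period_lattice_def by auto
    then show ?thesis by (auto intro!: image_eqI[where x = "\<lambda>_. 0"])
  qed
  moreover have "0 \<in> periods M" if "periods M = {0}" unfolding that by simp
  ultimately show ?thesis using periods_cases by blast
qed

lemma period_diff: assumes "k \<in> periods M" "l \<in> periods M" shows "k - l \<in> periods M"
proof -
  have "k - l \<in> periods M" if L: "period_lattice (periods M)"
  proof -
    obtain b :: "'n \<Rightarrow> real^'n" where b: "periods M = range (\<lambda>k :: 'n \<Rightarrow> int. \<Sum>i\<in>UNIV. of_int (k i) *\<^sub>R b i)"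
      using L unfolding period_lattice_def by auto
    then obtain k' l' :: "'n \<Rightarrow> int" where "k = (\<Sum>i\<in>UNIV. of_int (k' i) *\<^sub>R b i)" "l = (\<Sum>i\<in>UNIV. of_int (l' i) *\<^sub>R b i)"
      using assms by auto
    then have "k - l = (\<Sum>i\<in>UNIV. of_int (k' i - l' i) *\<^sub>R b i)"
      by (simp add: scaleR_diff_left sum_subtractf)
    then show ?thesis unfolding b by (intro image_eqI[where x = "\<lambda>i. k' i - l' i"]) auto
  qed
  moreover have "k - l \<in> periods M" if "periods M = {0}" using assms unfolding that by simp
  ultimately show ?thesis using periods_cases by blast
qed

lemma period_uminus: "l \<in> periods M \<Longrightarrow> - l \<in> periods M"
  using period_diff[OF period_0, of l] by simp

lemma period_add: "k \<in> periods M \<Longrightarrow> l \<in> periods M \<Longrightarrow> k + l \<in> periods M"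
  using period_diff[of k "- l"] period_uminus[of l] by simp

lemma finite_periods: "finite {l \<in> periods M. norm l \<le> r}"
  using periods_cases
proof
  assume "periods M = {0}"
  then have "{l \<in> periods M. norm l \<le> r} \<subseteq> {0}" by blast
  then show ?thesis by (rule finite_subset) simp
qed (rule finite_bounded_lattice)

lemma elems_cover: "K \<in> elems M \<Longrightarrow> K \<in> cover M"
  unfolding cover_def using period_0 by force

lemma coverE:
  assumes "K \<in> cover M" obtains l K0 where "l \<in> periods M" "K0 \<in> elems M" "K = (+) l ` K0"
  using assms unfolding cover_def by auto

lemma cover_translate:
  assumes "K \<in> cover M" "l \<in> periods M" shows "(+) l ` K \<in> cover M"
proof -
  obtain k K0 where k: "k \<in> periods M" "K0 \<in> elems M" "K = (+) k ` K0" using assms(1) by (rule coverE)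
  then have "(+) l ` K = (+) (l + k) ` K0" by (simp add: image_image add.assoc)
  then show ?thesis unfolding cover_def using k assms period_add by blast
qed

lemma cover_simplex: "K \<in> cover M \<Longrightarrow> \<exists>C. full_simplex C \<and> K = convex hull C"
proof -
  assume "K \<in> cover M"
  then obtain l K0 where "l \<in> periods M" and K0: "K0 \<in> elems M" and K: "K = (+) l ` K0" by (rule coverE)
  obtain C where C: "\<not> affine_dependent C" "int (card C) = int CARD('n) + 1" "K0 = convex hull C"
    using elem_simplex[OF K0] unfolding simplex_def by blast
  have "\<not> affine_dependent ((+) l ` C)" using C(1) affine_dependent_translation_eq[of C l] by simp
  moreover have "card ((+) l ` C) = Suc DIM(real^'n)" using C(2) by (simp add: card_image)
  moreover have "K = convex hull ((+) l ` C)" unfolding K C(3) convex_hull_translation ..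
  ultimately show ?thesis unfolding full_simplex_def by blast
qed

lemma cover_convex: "K \<in> cover M \<Longrightarrow> convex K"
  and cover_compact: "K \<in> cover M \<Longrightarrow> compact K"
  and cover_aff_dim: "K \<in> cover M \<Longrightarrow> aff_dim K = int CARD('n)"
proof -
  assume "K \<in> cover M"
  then obtain C where C: "full_simplex C" "K = convex hull C" using cover_simplex by blast
  then show "convex K" by simp
  show "compact K" using C by (simp add: full_simplex.finite_C finite_imp_compact_convex_hull)
  show "aff_dim K = int CARD('n)"
    using full_simplex.affine_hull_C[OF C(1)] aff_dim_eq_full[of C] by (simp add: C(2) aff_dim_convex_hull)
qed

lemma cover_interior: "K \<in> cover M \<Longrightarrow> interior K \<noteq> {}"
proof -
  assume "K \<in> cover M"
  then obtain C where C: "full_simplex C" "K = convex hull C" using cover_simplex by blast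
  have "interior K = rel_interior K"
    using rel_interior_interior[of K] full_simplex.affine_hull_C[OF C(1)] by (simp add: C(2))
  moreover have "C \<noteq> {}" using full_simplex.card_C[OF C(1)] by auto
  ultimately show ?thesis using rel_interior_eq_empty[of K] by (simp add: C(2))
qed

lemma cover_closed: "K \<in> cover M \<Longrightarrow> closed K" by (simp add: cover_compact compact_imp_closed)

lemma cover_lmeasurable: "K \<in> cover M \<Longrightarrow> K \<in> lmeasurable" by (simp add: cover_compact lmeasurable_compact)

lemma cover_rel_interior: "K \<in> cover M \<Longrightarrow> rel_interior K = interior K"
  by (intro rel_interior_nonempty_interior cover_interior)

text \<open>A face that contains an interior point is the whole cell.\<close>
lemma interiors_meet:
  assumes "K \<in> cover M" "K' \<in> cover M" "x \<in> interior K" "x \<in> interior K'"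
  shows "K = K'"
proof -
  have f: "K \<inter> K' face_of K" "K \<inter> K' face_of K'" using cover_face assms by blast+
  have x: "x \<in> K \<inter> K'" using assms interior_subset by blast
  have "K \<inter> K' = K" "K \<inter> K' = K'"
    using face_of_disjoint_rel_interior[OF f(1)] face_of_disjoint_rel_interior[OF f(2)] x assms cover_rel_interior
    by blast+
  then show ?thesis by simp
qed

lemma locally_finite: "finite {K \<in> cover M. K \<inter> cball y r \<noteq> {}}"
proof -
  have "bounded (\<Union>(elems M))"
    using finite_elems cover_compact elems_cover compact_imp_bounded by (intro bounded_Union) auto
  then obtain R where R: "\<And>x. x \<in> \<Union>(elems M) \<Longrightarrow> norm x \<le> R" unfolding bounded_iff by auto
  have "{K \<in> cover M. K \<inter> cball y r \<noteq> {}} \<subseteq>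
      (\<lambda>(l, K). (+) l ` K) ` ({l \<in> periods M. norm l \<le> norm y + r + R} \<times> elems M)"
  proof
    fix K assume "K \<in> {K \<in> cover M. K \<inter> cball y r \<noteq> {}}"
    then obtain z where K: "K \<in> cover M" and z: "z \<in> K" "dist y z \<le> r" by auto
    obtain l K0 where l: "l \<in> periods M" "K0 \<in> elems M" "K = (+) l ` K0" using K by (rule coverE)
    then obtain x where x: "x \<in> K0" "z = l + x" using z by auto
    have "norm x \<le> R" using R x l by blast
    moreover have "norm l = norm ((z - y) + y - x)" using x by simp
    moreover have "norm (z - y) \<le> r" using z by (simp add: dist_norm norm_minus_commute)
    ultimately have "norm l \<le> norm y + r + R"
      using norm_triangle_ineq[of "z - y" y] norm_triangle_ineq4[of "(z - y) + y" x] by linarith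
    then have "(l, K0) \<in> {l \<in> periods M. norm l \<le> norm y + r + R} \<times> elems M" using l by blast
    then have "(\<lambda>(l, K). (+) l ` K) (l, K0) \<in>
      (\<lambda>(l, K). (+) l ` K) ` ({l \<in> periods M. norm l \<le> norm y + r + R} \<times> elems M)" by (rule imageI)
    then show "K \<in> (\<lambda>(l, K). (+) l ` K) ` ({l \<in> periods M. norm l \<le> norm y + r + R} \<times> elems M)"
      unfolding l(3) by simp
  qed
  then show ?thesis by (rule finite_subset) (intro finite_imageI finite_cartesian_product finite_periods finite_elems)
qed

lemma facet_prism_of_face:
  assumes "\<sigma> \<in> faces M" "K \<in> cover M" "\<sigma> facet_of K"
  obtains C v where "facet_prism C v (normal M \<sigma>)" "K = convex hull C" "\<sigma> = convex hull (C - {v})"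
proof -
  obtain C where C: "full_simplex C" "K = convex hull C" using cover_simplex assms by blast
  then interpret full_simplex C by simp
  obtain v where v: "v \<in> C" "\<sigma> = convex hull (C - {v})"
    using assms(3) facet_of_convex_hull_affine_independent[OF indep] C(2) by auto
  have "facet_prism C v (normal M \<sigma>)"
  proof
    show "v \<in> C" by fact
    show "CARD('n) = 2 \<or> CARD('n) = 3" by (rule dim)
    show "norm (normal M \<sigma>) = 1" using norm_normal assms by simp
    show "normal M \<sigma> \<bullet> (w - w') = 0" if "w \<in> C - {v}" "w' \<in> C - {v}" for w w'
      using normal_perp[OF assms(1), of w' w] that hull_subset[of "C - {v}" convex] unfolding v(2)[symmetric] by blast
  qed
  then show ?thesis using that C(2) v(2) by blast
qed

text \<open>The cell \<open>K\<close> has the face \<open>\<sigma>\<close> and is entered from it in direction \<open>\<theta>\<close> times the normal, where \<open>\<theta>\<close> is \<open>1\<close>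
  or \<open>-1\<close>.  This is the form in which traces use the position of a cell.\<close>
definition lies_at :: "real \<Rightarrow> (real^'n) set \<Rightarrow> (real^'n) set \<Rightarrow> bool" where
  "lies_at \<theta> \<sigma> K \<longleftrightarrow> K \<in> cover M \<and> \<sigma> facet_of K \<and>
     (\<forall>x\<in>rel_interior \<sigma>. \<forall>\<^sub>F t in at_right 0. x + (t * \<theta>) *\<^sub>R normal M \<sigma> \<in> interior K)"

lemma rel_interior_face: "\<sigma> \<in> faces M \<Longrightarrow> rel_interior \<sigma> \<noteq> {}"
  by (metis face_cell facet_of_imp_face_of face_of_imp_convex cover_convex facet_of_def rel_interior_eq_empty)

lemma lies_at_unique:
  assumes \<sigma>: "\<sigma> \<in> faces M" and "lies_at \<theta> \<sigma> K" "lies_at \<theta> \<sigma> K'"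
  shows "K = K'"
proof -
  obtain x where "x \<in> rel_interior \<sigma>" using rel_interior_face[OF \<sigma>] by auto
  then have "\<forall>\<^sub>F t in at_right 0. x + (t * \<theta>) *\<^sub>R normal M \<sigma> \<in> interior K \<and> x + (t * \<theta>) *\<^sub>R normal M \<sigma> \<in> interior K'"
    using assms by (auto simp: lies_at_def eventually_conj_iff)
  then obtain t where "x + (t * \<theta>) *\<^sub>R normal M \<sigma> \<in> interior K" "x + (t * \<theta>) *\<^sub>R normal M \<sigma> \<in> interior K'"
    using eventually_happens[of _ "at_right (0::real)"] by (auto simp: trivial_limit_at_right_real)
  then show ?thesis using assms interiors_meet by (auto simp: lies_at_def)
qed

lemma lies_at_sgn_height:
  assumes "facet_prism C v (normal M \<sigma>)" "K = convex hull C" "\<sigma> = convex hull (C - {v})"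
    "K \<in> cover M" "\<sigma> facet_of K"
  shows "lies_at (sgn (facet_prism.height C v (normal M \<sigma>))) \<sigma> K"
proof -
  interpret facet_prism C v "normal M \<sigma>" by fact
  show ?thesis unfolding lies_at_def
    using assms eventually_interior unfolding base_def by simp
qed

lemma lies_at_cases:
  assumes "\<sigma> \<in> faces M" "K \<in> cover M" "\<sigma> facet_of K"
  shows "lies_at (-1) \<sigma> K \<or> lies_at 1 \<sigma> K"
proof -
  obtain C v where C: "facet_prism C v (normal M \<sigma>)" "K = convex hull C" "\<sigma> = convex hull (C - {v})"
    using facet_prism_of_face[OF assms] .
  then show ?thesis using lies_at_sgn_height[OF C assms(2,3)] facet_prism.height_nz[OF C(1)]
    by (cases "facet_prism.height C v (normal M \<sigma>) > 0") auto
qed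

lemma no_cell_outside:
  assumes "\<sigma> \<in> bdry_faces M" shows "\<not> lies_at 1 \<sigma> K"
proof
  assume K: "lies_at 1 \<sigma> K"
  have \<sigma>: "\<sigma> \<in> faces M" using assms by (simp add: bdry_faces_def)
  obtain x where x: "x \<in> rel_interior \<sigma>" using rel_interior_face[OF \<sigma>] by auto
  have "\<forall>\<^sub>F t in at_right 0. x + (t * 1) *\<^sub>R normal M \<sigma> \<in> interior K \<and> 0 < t"
    using K x by (auto simp: lies_at_def eventually_conj_iff eventually_at_right_less)
  then obtain t where t: "x + t *\<^sub>R normal M \<sigma> \<in> interior K" "0 < t"
    using eventually_happens[of _ "at_right (0::real)"] by (auto simp: trivial_limit_at_right_real)
  have "normal M \<sigma> \<bullet> (x + t *\<^sub>R normal M \<sigma> - x) \<le> 0"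
    using normal_outward[OF assms] K x t interior_subset rel_interior_subset unfolding lies_at_def by blast
  then show False using t norm_normal[OF \<sigma>] by (simp add: power2_norm_eq_inner[symmetric])
qed

text \<open>An interior face has a point \<open>y\<close> in its relative interior with a neighbourhood covered by cells.  As the cover
  is locally finite, a cell containing a point \<open>z\<close> close to \<open>y\<close>, opposite to \<open>K\<close>, contains \<open>y\<close> as well.  It meets \<open>K\<close> in a common
  face that contains \<open>\<sigma>\<close>, hence, by dimension, in \<open>\<sigma>\<close> itself.\<close>
lemma int_face_opposite:
  assumes \<sigma>: "\<sigma> \<in> int_faces M" and K: "K \<in> cover M" "\<sigma> facet_of K"
    and C: "facet_prism C v (normal M \<sigma>)" "K = convex hull C" "\<sigma> = convex hull (C - {v})"
  defines "\<theta> \<equiv> sgn (facet_prism.height C v (normal M \<sigma>))"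
  shows "\<exists>K'. lies_at (- \<theta>) \<sigma> K'"
proof -
  let ?n = "normal M \<sigma>"
  have \<theta>: "\<theta> = 1 \<or> \<theta> = -1"
    using facet_prism.height_nz[OF C(1)] by (auto simp: \<theta>_def sgn_if)
  have \<sigma>f: "\<sigma> \<in> faces M" using \<sigma> by (simp add: int_faces_def)
  obtain x0 where x0: "x0 \<in> \<sigma>" "x0 \<notin> frontier (region M)"
    using \<sigma> by (auto simp: int_faces_def bdry_faces_def)
  have sub: "\<sigma> \<subseteq> K" using K(2) by (simp add: facet_of_imp_subset)
  have "x0 \<in> closure (interior K)"
    using x0 sub cover_closed[OF K(1)] convex_closure_interior[OF cover_convex cover_interior, OF K(1) K(1)] by auto
  moreover have "interior K \<subseteq> region M" unfolding region_eq using K(1) by (intro interior_mono) auto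
  ultimately have "x0 \<in> closure (region M)" using closure_mono by blast
  then have "x0 \<in> interior (region M)" using x0(2) by (simp add: frontier_def)
  then obtain r where r: "r > 0" "ball x0 r \<subseteq> \<Union>(cover M)"
    unfolding region_eq interior_interior using mem_interior by blast
  have conv\<sigma>: "convex \<sigma>" using K(2) cover_convex[OF K(1)] facet_of_imp_face_of face_of_imp_convex by blast
  have "x0 \<in> closure (rel_interior \<sigma>)" using x0 convex_closure_rel_interior[OF conv\<sigma>] closure_subset by blast
  then obtain y where y: "y \<in> rel_interior \<sigma>" "dist y x0 < r" using r(1) closure_approachable by blast
  obtain r' where r': "r' > 0" "ball y r' \<subseteq> \<Union>(cover M)"
    using y(2) r(2) by (metis dist_commute mem_ball open_ball open_contains_ball subset_trans)
  \<comment> \<open>the cells near \<open>y\<close> that do not contain \<open>y\<close>; they keep a positive distance from it\<close>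
  define F where "F = {K \<in> cover M. K \<inter> cball y 1 \<noteq> {}} \<inter> {K. y \<notin> K}"
  have "closed (\<Union>F)" unfolding F_def using locally_finite cover_closed by (intro closed_Union) auto
  moreover have "y \<notin> \<Union>F" by (auto simp: F_def)
  ultimately obtain \<delta> where \<delta>: "\<delta> > 0" "ball y \<delta> \<inter> \<Union>F = {}"
    by (metis Compl_iff disjoint_eq_subset_Compl open_Compl open_contains_ball)
  define t where "t = min (min r' \<delta>) 1 / 2"
  have t: "0 < t" "t < r'" "t < \<delta>" "t < 1" using r'(1) \<delta>(1) by (auto simp: t_def min_def)
  define z where "z = y - (t * \<theta>) *\<^sub>R ?n"
  have dz: "dist y z = t" using t \<theta> norm_normal[OF \<sigma>f] by (auto simp: z_def dist_norm)
  obtain K' where K': "K' \<in> cover M" "z \<in> K'"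
    using r'(2) dz t by (metis UnionE mem_ball subsetD)
  have "y \<in> K'"
  proof (rule ccontr)
    assume "y \<notin> K'"
    moreover have "z \<in> K' \<inter> cball y 1" using dz t K' by simp
    ultimately have "K' \<in> F" using K' unfolding F_def by blast
    then show False using \<delta>(2) K' dz t by (metis IntI UnionI empty_iff mem_ball)
  qed
  have y\<sigma>: "y \<in> \<sigma>" using y rel_interior_subset by blast
  have nz: "?n \<bullet> (z - y) = - t * \<theta>"
    using norm_normal[OF \<sigma>f] by (simp add: z_def power2_norm_eq_inner[symmetric])
  have "z \<notin> K"
  proof
    assume "z \<in> K"
    then have "0 \<le> (?n \<bullet> (z - y)) * facet_prism.height C v ?n"
      using facet_prism.hull_side[OF C(1), of y z] y\<sigma> unfolding facet_prism.base_def[OF C(1)] C(2,3) by blast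
    then have "t * \<bar>facet_prism.height C v ?n\<bar> \<le> 0"
      unfolding nz \<theta>_def by (simp add: abs_sgn algebra_simps)
    then show False using t facet_prism.height_nz[OF C(1)] by (simp add: mult_le_0_iff)
  qed
  have fK: "K \<inter> K' face_of K" and fK': "K \<inter> K' face_of K'" using cover_face K(1) K'(1) by blast+
  have \<sigma>sub: "\<sigma> \<subseteq> K \<inter> K'"
    using subset_of_face_of[OF fK sub] y \<open>y \<in> K'\<close> y\<sigma> sub by blast
  have "K \<inter> K' \<noteq> K"
  proof
    assume "K \<inter> K' = K"
    then have "K face_of K'" using fK' by simp
    moreover have "K \<noteq> K'" using \<open>z \<notin> K\<close> K' by blast
    ultimately show False
      using face_of_aff_dim_lt[OF cover_convex[OF K'(1)]] cover_aff_dim K(1) K'(1) by force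
  qed
  then have "aff_dim (K \<inter> K') < int CARD('n)"
    using face_of_aff_dim_lt[OF cover_convex[OF K(1)] fK] cover_aff_dim[OF K(1)] by simp
  moreover have "aff_dim \<sigma> = int CARD('n) - 1"
    using K cover_aff_dim[OF K(1)] by (simp add: facet_of_def)
  moreover have "\<sigma> face_of (K \<inter> K')"
    using face_of_subset[OF facet_of_imp_face_of[OF K(2)] \<sigma>sub] by blast
  moreover have "convex (K \<inter> K')" using cover_convex K(1) K'(1) convex_Int by blast
  ultimately have "\<sigma> = K \<inter> K'" using face_of_aff_dim_lt[of "K \<inter> K'" \<sigma>] by fastforce
  then have facet': "\<sigma> facet_of K'"
    using fK' K(2) cover_aff_dim K(1) K'(1) by (auto simp: facet_of_def)
  obtain C' v' where C': "facet_prism C' v' ?n" "K' = convex hull C'" "\<sigma> = convex hull (C' - {v'})"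
    using facet_prism_of_face[OF \<sigma>f K'(1) facet'] .
  have "0 \<le> (?n \<bullet> (z - y)) * facet_prism.height C' v' ?n"
    using facet_prism.hull_side[OF C'(1), of y z] y\<sigma> K'(2) unfolding facet_prism.base_def[OF C'(1)] C'(2,3) by blast
  then have "sgn (facet_prism.height C' v' ?n) = - \<theta>"
    using t \<theta> facet_prism.height_nz[OF C'(1)] unfolding nz by (auto simp: zero_le_mult_iff mult_le_0_iff sgn_if)
  then show ?thesis using lies_at_sgn_height[OF C' K'(1) facet'] by auto
qed

lemma ex1_cell_in: "\<sigma> \<in> faces M \<Longrightarrow> \<exists>!K. lies_at (-1) \<sigma> K"
  and ex1_cell_out: "\<sigma> \<in> int_faces M \<Longrightarrow> \<exists>!K. lies_at 1 \<sigma> K"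
proof -
  have both: "(\<exists>K. lies_at (-1) \<sigma> K) \<and> (\<exists>K. lies_at 1 \<sigma> K)" if \<sigma>: "\<sigma> \<in> int_faces M" for \<sigma>
  proof -
    have \<sigma>f: "\<sigma> \<in> faces M" using \<sigma> by (simp add: int_faces_def)
    obtain K where K: "K \<in> cover M" "\<sigma> facet_of K" using face_cell[OF \<sigma>f] by auto
    obtain C v where C: "facet_prism C v (normal M \<sigma>)" "K = convex hull C" "\<sigma> = convex hull (C - {v})"
      using facet_prism_of_face[OF \<sigma>f K] .
    show ?thesis
      using lies_at_sgn_height[OF C K] int_face_opposite[OF \<sigma> K C] facet_prism.height_nz[OF C(1)]
      by (cases "facet_prism.height C v (normal M \<sigma>) > 0") auto
  qed
  have bdry: "\<exists>K. lies_at (-1) \<sigma> K" if "\<sigma> \<in> bdry_faces M" for \<sigma>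
  proof -
    have "\<sigma> \<in> faces M" using that by (simp add: bdry_faces_def)
    then show ?thesis using face_cell lies_at_cases no_cell_outside[OF that] by metis
  qed
  show "\<exists>!K. lies_at (-1) \<sigma> K" if "\<sigma> \<in> faces M"
  proof -
    have "\<exists>K. lies_at (-1) \<sigma> K"
      using both[of \<sigma>] bdry[of \<sigma>] that by (auto simp: int_faces_def)
    then show ?thesis using lies_at_unique[OF that] by blast
  qed
  show "\<exists>!K. lies_at 1 \<sigma> K" if "\<sigma> \<in> int_faces M"
    using both[OF that] lies_at_unique[of \<sigma> 1] that by (auto simp: int_faces_def)
qed

definition cell_in :: "(real^'n) set \<Rightarrow> (real^'n) set" where "cell_in \<sigma> = (THE K. lies_at (-1) \<sigma> K)"
definition cell_out :: "(real^'n) set \<Rightarrow> (real^'n) set" where "cell_out \<sigma> = (THE K. lies_at 1 \<sigma> K)"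

lemma cell_in: "\<sigma> \<in> faces M \<Longrightarrow> lies_at (-1) \<sigma> (cell_in \<sigma>)"
  unfolding cell_in_def by (rule theI'[OF ex1_cell_in])

lemma cell_out: "\<sigma> \<in> int_faces M \<Longrightarrow> lies_at 1 \<sigma> (cell_out \<sigma>)"
  unfolding cell_out_def by (rule theI'[OF ex1_cell_out])

end

section \<open>Integrals and traces of piecewise continuous functions\<close>

lemma set_integral_AE_eq:
  fixes f g :: "'a::euclidean_space \<Rightarrow> 'b::euclidean_space"
  assumes ae: "AE x in lebesgue. x \<in> S \<longrightarrow> f x = g x" and g: "set_integrable lebesgue S g"
  shows "set_integrable lebesgue S f" and "set_lebesgue_integral lebesgue S f = set_lebesgue_integral lebesgue S g"
proof -
  have ae': "AE x in lebesgue. indicator S x *\<^sub>R g x = indicator S x *\<^sub>R f x"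
    using ae by eventually_elim (auto simp: indicator_def)
  have g': "(\<lambda>x. indicator S x *\<^sub>R g x) \<in> borel_measurable lebesgue"
    using g unfolding set_integrable_def by (rule borel_measurable_integrable)
  have f': "(\<lambda>x. indicator S x *\<^sub>R f x) \<in> borel_measurable lebesgue"
    by (rule borel_measurable_AE[OF g' ae'])
  show "set_integrable lebesgue S f"
    using g unfolding set_integrable_def using integrable_cong_AE[OF g' f' ae'] by simp
  show "set_lebesgue_integral lebesgue S f = set_lebesgue_integral lebesgue S g"
    unfolding set_lebesgue_integral_def using integral_cong_AE[OF g' f' ae'] by simp
qed

lemma set_integrable_continuous_compact:
  fixes g :: "'a::euclidean_space \<Rightarrow> 'b::euclidean_space"
  assumes "compact K" "continuous_on UNIV g"
  shows "set_integrable lebesgue K g"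
proof -
  have "integrable lborel (\<lambda>x. indicator K x *\<^sub>R g x)"
    using assms continuous_on_subset by (intro borel_integrable_compact) blast+
  then show ?thesis unfolding set_integrable_def
    by (subst integrable_completion) (auto simp: borel_measurable_integrable)
qed

context mesh_geometry
begin

text \<open>Piecewise continuity up to the boundary of the cells, where the values on the skeleton of the mesh do not matter.
  It is stable under all operations that occur in the scheme and implies integrability.\<close>
definition pwc :: "(real^'n \<Rightarrow> 'b::euclidean_space) \<Rightarrow> bool" where
  "pwc f \<longleftrightarrow> (\<forall>K\<in>elems M. \<exists>g. continuous_on UNIV g \<and> (\<forall>x\<in>interior K. f x = g x))"

lemma pwc_const: "pwc (\<lambda>x. c)"
  unfolding pwc_def by (auto intro!: exI[of _ "\<lambda>x. c"])

lemma pwc_comp: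
  assumes "pwc f" "continuous_on UNIV h" shows "pwc (\<lambda>x. h (f x))"
  unfolding pwc_def
proof
  fix K assume "K \<in> elems M"
  then obtain g where g: "continuous_on UNIV g" "\<forall>x\<in>interior K. f x = g x"
    using assms(1) unfolding pwc_def by blast
  then show "\<exists>g. continuous_on UNIV g \<and> (\<forall>x\<in>interior K. h (f x) = g x)"
    using continuous_on_compose2[OF assms(2) g(1)] by (intro exI[of _ "\<lambda>x. h (g x)"]) auto
qed

lemma pwc_Pair:
  assumes "pwc f" "pwc f'" shows "pwc (\<lambda>x. (f x, f' x))"
  unfolding pwc_def
proof
  fix K assume K: "K \<in> elems M"
  obtain g where g: "continuous_on UNIV g" "\<forall>x\<in>interior K. f x = g x"
    using assms(1) K unfolding pwc_def by blast
  obtain g' where g': "continuous_on UNIV g'" "\<forall>x\<in>interior K. f' x = g' x"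
    using assms(2) K unfolding pwc_def by blast
  show "\<exists>g. continuous_on UNIV g \<and> (\<forall>x\<in>interior K. (f x, f' x) = g x)"
    using g g' by (intro exI[of _ "\<lambda>x. (g x, g' x)"]) (auto intro: continuous_on_Pair)
qed

lemma pwc_comp2:
  assumes "pwc f" "pwc f'" "continuous_on UNIV (\<lambda>p. h (fst p) (snd p))"
  shows "pwc (\<lambda>x. h (f x) (f' x))"
  using pwc_comp[OF pwc_Pair[OF assms(1,2)] assms(3)] by simp

lemma pwc_add: "pwc f \<Longrightarrow> pwc f' \<Longrightarrow> pwc (\<lambda>x. f x + f' x)"
  and pwc_diff: "pwc f \<Longrightarrow> pwc f' \<Longrightarrow> pwc (\<lambda>x. f x - f' x)"
  and pwc_inner: "pwc f \<Longrightarrow> pwc f' \<Longrightarrow> pwc (\<lambda>x. f x \<bullet> f' x)"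
  and pwc_mult: "pwc r \<Longrightarrow> pwc r' \<Longrightarrow> pwc (\<lambda>x. r x * r' x :: real)"
  and pwc_norm2: "pwc f \<Longrightarrow> pwc (\<lambda>x. (norm (f x))\<^sup>2)"
  by ((erule (1) pwc_comp2 | erule pwc_comp), intro continuous_intros)+

lemma linear_emb: "linear (emb M)"
  unfolding emb_def by (rule linearI) (simp_all add: scaleR_add_left sum.distrib scaleR_sum_right)

lemma pwc_emb: "pwc f \<Longrightarrow> pwc (\<lambda>x. emb M (f x))"
  by (erule pwc_comp) (simp add: linear_continuous_on linear_emb linear_conv_bounded_linear[symmetric])

lemma pwc_cross: "pwc f \<Longrightarrow> pwc f' \<Longrightarrow> pwc (\<lambda>x. cross3 (f x) (f' x))"
  by (erule (1) pwc_comp2) (intro continuous_on_cross continuous_intros)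

lemma AE_interiors: "AE x in lebesgue. \<forall>K\<in>elems M. x \<in> K \<longrightarrow> x \<in> interior K"
proof (rule AE_I')
  show "\<Union>(frontier ` elems M) \<in> null_sets lebesgue"
    using finite_elems cover_convex[OF elems_cover] negligible_convex_frontier
    by (auto simp: negligible_iff_null_sets[symmetric] intro!: negligible_Union)
  show "{x \<in> space lebesgue. \<not> (\<forall>K\<in>elems M. x \<in> K \<longrightarrow> x \<in> interior K)} \<subseteq> \<Union>(frontier ` elems M)"
    using closure_subset by (auto simp: frontier_def)
qed

text \<open>Almost every point of \<open>body M\<close> lies in the interior of exactly one element.\<close>
lemma vol_int_cellwise:
  fixes f :: "real^'n \<Rightarrow> 'b::euclidean_space"
  assumes g: "\<And>K. K \<in> elems M \<Longrightarrow> continuous_on UNIV (g K)"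
    and fg: "\<And>K x. K \<in> elems M \<Longrightarrow> x \<in> interior K \<Longrightarrow> f x = g K x"
  shows "set_integrable lebesgue (body M) f"
    and "vol_int M f = (\<Sum>K\<in>elems M. set_lebesgue_integral lebesgue K (g K))"
proof -
  let ?h = "\<lambda>x. \<Sum>K\<in>elems M. indicator K x *\<^sub>R g K x"
  have intK: "integrable lebesgue (\<lambda>x. indicator K x *\<^sub>R g K x)" if "K \<in> elems M" for K
    using set_integrable_continuous_compact[OF cover_compact[OF elems_cover[OF that]] g[OF that]]
    unfolding set_integrable_def .
  then have int: "integrable lebesgue ?h" by (rule Bochner_Integration.integrable_sum)
  have out: "indicator (body M) x *\<^sub>R ?h x = ?h x" for x
    by (cases "x \<in> body M") (auto simp: body_def intro!: sum.neutral[symmetric])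
  have "set_integrable lebesgue (body M) ?h" unfolding set_integrable_def out by (rule int)
  moreover have "AE x in lebesgue. x \<in> body M \<longrightarrow> f x = ?h x"
    using AE_interiors
  proof eventually_elim
    case (elim x)
    show ?case
    proof
      assume "x \<in> body M"
      then obtain K where K: "K \<in> elems M" "x \<in> K" unfolding body_def by auto
      have "K' = K" if "K' \<in> elems M" "x \<in> K'" for K'
        using interiors_meet[OF elems_cover elems_cover, of K' K x] elim K that by blast
      then have "indicator K' x *\<^sub>R g K' x = (if K = K' then g K x else 0)" if "K' \<in> elems M" for K'
        using K(2) that by (cases "x \<in> K'") (auto simp: indicator_def)
      then have "?h x = (\<Sum>K'\<in>elems M. if K = K' then g K x else 0)"
        by (intro sum.cong refl)
      also have "\<dots> = f x" using K elim fg finite_elems by simp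
      finally show "f x = ?h x" ..
    qed
  qed
  ultimately show "set_integrable lebesgue (body M) f"
    and "vol_int M f = (\<Sum>K\<in>elems M. set_lebesgue_integral lebesgue K (g K))"
    using set_integral_AE_eq[of "body M" f ?h] Bochner_Integration.integral_sum[OF intK]
    by (auto simp: vol_int_def set_lebesgue_integral_def out)
qed

lemma pwc_integrable:
  assumes "pwc f" shows "set_integrable lebesgue (body M) f"
proof -
  obtain g where "\<And>K. K \<in> elems M \<Longrightarrow> continuous_on UNIV (g K)"
    "\<And>K x. K \<in> elems M \<Longrightarrow> x \<in> interior K \<Longrightarrow> f x = g K x"
    using assms unfolding pwc_def by metis
  then show ?thesis by (rule vol_int_cellwise(1))
qed

lemma vol_int_add: "pwc f \<Longrightarrow> pwc g \<Longrightarrow> vol_int M (\<lambda>x. f x + g x) = vol_int M f + vol_int M g"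
  and vol_int_diff: "pwc f \<Longrightarrow> pwc g \<Longrightarrow> vol_int M (\<lambda>x. f x - g x) = vol_int M f - vol_int M g"
  unfolding vol_int_def by (simp_all add: pwc_integrable set_integral_add set_integral_diff)

lemma vol_int_cmult: "vol_int M (\<lambda>x. c * f x) = c * vol_int M f" for f :: "real^'n \<Rightarrow> real"
  unfolding vol_int_def by simp

lemma vol_int_cong:
  fixes f g :: "real^'n \<Rightarrow> 'b::euclidean_space"
  assumes eq: "\<And>K x. K \<in> elems M \<Longrightarrow> x \<in> interior K \<Longrightarrow> f x = g x" and "pwc g"
  shows "vol_int M f = vol_int M g"
proof -
  obtain h where h: "\<And>K. K \<in> elems M \<Longrightarrow> continuous_on UNIV (h K)"
    "\<And>K x. K \<in> elems M \<Longrightarrow> x \<in> interior K \<Longrightarrow> g x = h K x"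
    using assms(2) unfolding pwc_def by metis
  show ?thesis using vol_int_cellwise(2)[of h f] vol_int_cellwise(2)[of h g] h eq by simp
qed

lemma vol_int_nonneg:
  assumes "\<And>K x. K \<in> elems M \<Longrightarrow> x \<in> interior K \<Longrightarrow> 0 \<le> f x"
  shows "0 \<le> (vol_int M f :: real)"
  unfolding vol_int_def set_lebesgue_integral_def
proof (rule integral_nonneg_AE)
  show "AE x in lebesgue. 0 \<le> indicator (body M) x *\<^sub>R f x"
    using AE_interiors
    by eventually_elim (use assms in \<open>auto simp: indicator_def body_def\<close>)
qed

lemma L2_norm_sq: "(L2_norm M f)\<^sup>2 = vol_int M (\<lambda>x. (norm (f x))\<^sup>2)"
  unfolding L2_norm_def by (intro real_sqrt_pow2 vol_int_nonneg) simp

definition cellwise_const :: "(real^'n \<Rightarrow> 'b) \<Rightarrow> bool" where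
  "cellwise_const f \<longleftrightarrow> (\<forall>K\<in>cover M. \<exists>c. \<forall>x\<in>interior K. f x = c)"

definition cell_val :: "(real^'n \<Rightarrow> 'b) \<Rightarrow> (real^'n) set \<Rightarrow> 'b" where
  "cell_val f K = f (SOME x. x \<in> interior K)"

lemma some_interior: "K \<in> cover M \<Longrightarrow> (SOME x. x \<in> interior K) \<in> interior K"
  using cover_interior by (simp add: some_in_eq)

lemma cell_val: "cellwise_const f \<Longrightarrow> K \<in> cover M \<Longrightarrow> x \<in> interior K \<Longrightarrow> f x = cell_val f K"
  using some_interior[of K] unfolding cellwise_const_def cell_val_def by metis

lemma cellwise_const_comp: "cellwise_const f \<Longrightarrow> cellwise_const (\<lambda>x. h (f x))"
  unfolding cellwise_const_def by metis

lemma cellwise_const_comp2: "cellwise_const f \<Longrightarrow> cellwise_const g \<Longrightarrow> cellwise_const (\<lambda>x. h (f x) (g x))"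
  unfolding cellwise_const_def by metis

lemma cellwise_const_pwc: "cellwise_const f \<Longrightarrow> pwc f"
  unfolding pwc_def using cell_val[of f] elems_cover
  by (metis continuous_on_const)

lemma vol_int_cellwise_const:
  assumes "cellwise_const f"
  shows "vol_int M f = (\<Sum>K\<in>elems M. measure lebesgue K *\<^sub>R cell_val f K)"
proof -
  have "vol_int M f = (\<Sum>K\<in>elems M. set_lebesgue_integral lebesgue K (\<lambda>x. cell_val f K))"
    using cell_val[OF assms elems_cover] by (intro vol_int_cellwise(2)) auto
  also have "\<dots> = (\<Sum>K\<in>elems M. measure lebesgue K *\<^sub>R cell_val f K)"
    using fmeasurableD[OF cover_lmeasurable[OF elems_cover]] fmeasurableD2[OF cover_lmeasurable[OF elems_cover]]
    by (intro sum.cong refl set_integral_const) (simp_all add: infinity_ennreal_def)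
  finally show ?thesis .
qed

lemma cellwise_const_Qh:
  assumes "periodic M f" "cellwise_const f" shows "f \<in> Qh M"
proof -
  have "set_integrable lebesgue (body M) f" by (intro pwc_integrable cellwise_const_pwc assms)
  then have "set_borel_measurable lebesgue (body M) f"
    unfolding set_integrable_def set_borel_measurable_def by (rule borel_measurable_integrable)
  moreover have "set_integrable lebesgue (body M) (\<lambda>x. (norm (f x))\<^sup>2)"
    by (intro pwc_integrable cellwise_const_pwc cellwise_const_comp[of f "\<lambda>y. (norm y)\<^sup>2"] assms)
  ultimately show ?thesis using assms unfolding Qh_def L2_def cellwise_const_def by simp
qed

lemma Qh_cellwise_const: "f \<in> Qh M \<Longrightarrow> cellwise_const f" and Qh_periodic: "f \<in> Qh M \<Longrightarrow> periodic M f"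
  by (simp_all add: Qh_def L2_def cellwise_const_def)

text \<open>Near the relative interior of the face, the points approached by the trace lie in the cell on that side.\<close>
lemma tr_in_eq:
  fixes f :: "real^'n \<Rightarrow> 'b::euclidean_space"
  assumes \<sigma>: "\<sigma> \<in> faces M" and x: "x \<in> rel_interior \<sigma>" and g: "continuous_on UNIV g"
    and fg: "\<And>y. y \<in> interior (cell_in \<sigma>) \<Longrightarrow> f y = g y"
  shows "tr_in M \<sigma> f x = g x"
  unfolding tr_in_def
proof (rule tendsto_Lim)
  have "\<forall>\<^sub>F t in at_right 0. x + (t * (-1)) *\<^sub>R normal M \<sigma> \<in> interior (cell_in \<sigma>)"
    using cell_in[OF \<sigma>] x unfolding lies_at_def by blast
  then have ev: "\<forall>\<^sub>F t in at_right 0. g (x - t *\<^sub>R normal M \<sigma>) = f (x - t *\<^sub>R normal M \<sigma>)"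
    by eventually_elim (simp add: fg)
  have "((\<lambda>t. g (x - t *\<^sub>R normal M \<sigma>)) \<longlongrightarrow> g (x - 0 *\<^sub>R normal M \<sigma>)) (at_right 0)"
    by (intro continuous_on_tendsto_compose[OF g] tendsto_intros) auto
  then show "((\<lambda>t. f (x - t *\<^sub>R normal M \<sigma>)) \<longlongrightarrow> g x) (at_right 0)"
    using tendsto_cong[OF ev] by simp
qed simp

lemma tr_out_eq:
  fixes f :: "real^'n \<Rightarrow> 'b::euclidean_space"
  assumes \<sigma>: "\<sigma> \<in> int_faces M" and x: "x \<in> rel_interior \<sigma>" and g: "continuous_on UNIV g"
    and fg: "\<And>y. y \<in> interior (cell_out \<sigma>) \<Longrightarrow> f y = g y"
  shows "tr_out M \<sigma> f x = g x"
  unfolding tr_out_def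
proof (rule tendsto_Lim)
  have "\<forall>\<^sub>F t in at_right 0. x + (t * 1) *\<^sub>R normal M \<sigma> \<in> interior (cell_out \<sigma>)"
    using cell_out[OF \<sigma>] x unfolding lies_at_def by blast
  then have ev: "\<forall>\<^sub>F t in at_right 0. g (x + t *\<^sub>R normal M \<sigma>) = f (x + t *\<^sub>R normal M \<sigma>)"
    by eventually_elim (simp add: fg)
  have "((\<lambda>t. g (x + t *\<^sub>R normal M \<sigma>)) \<longlongrightarrow> g (x + 0 *\<^sub>R normal M \<sigma>)) (at_right 0)"
    by (intro continuous_on_tendsto_compose[OF g] tendsto_intros) auto
  then show "((\<lambda>t. f (x + t *\<^sub>R normal M \<sigma>)) \<longlongrightarrow> g x) (at_right 0)"
    using tendsto_cong[OF ev] by simp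
qed simp

lemma cell_in_cover: "\<sigma> \<in> faces M \<Longrightarrow> cell_in \<sigma> \<in> cover M"
  and cell_out_cover: "\<sigma> \<in> int_faces M \<Longrightarrow> cell_out \<sigma> \<in> cover M"
  using cell_in cell_out by (auto simp: lies_at_def)

lemma int_faces_faces: "\<sigma> \<in> int_faces M \<Longrightarrow> \<sigma> \<in> faces M" by (simp add: int_faces_def)

lemma tr_in_const: "cellwise_const f \<Longrightarrow> \<sigma> \<in> faces M \<Longrightarrow> x \<in> rel_interior \<sigma> \<Longrightarrow> tr_in M \<sigma> f x = cell_val f (cell_in \<sigma>)"
  by (rule tr_in_eq) (auto intro: cell_val cell_in_cover)

lemma tr_out_const: "cellwise_const f \<Longrightarrow> \<sigma> \<in> int_faces M \<Longrightarrow> x \<in> rel_interior \<sigma> \<Longrightarrow> tr_out M \<sigma> f x = cell_val f (cell_out \<sigma>)"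
  by (rule tr_out_eq) (auto intro: cell_val cell_out_cover)

text \<open>Feet in the relative boundary of the face form a null set, so that traces need to be known in the relative
  interior only.\<close>
lemma surf_int_cong:
  fixes f g :: "real^'n \<Rightarrow> 'b::euclidean_space"
  assumes \<sigma>: "\<sigma> \<in> faces M" and eq: "\<And>x. x \<in> rel_interior \<sigma> \<Longrightarrow> f x = g x" and g: "surf_integrable M \<sigma> g"
  shows "surf_integrable M \<sigma> f" and "surf_int M \<sigma> f = surf_int M \<sigma> g"
proof -
  obtain K where K: "K \<in> cover M" "\<sigma> facet_of K" using face_cell[OF \<sigma>] by auto
  obtain C v where C: "facet_prism C v (normal M \<sigma>)" "K = convex hull C" "\<sigma> = convex hull (C - {v})"
    using facet_prism_of_face[OF \<sigma> K] .
  interpret facet_prism C v "normal M \<sigma>" by fact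
  have slab: "prism M \<sigma> = slab" unfolding prism_def slab_def base_def C(3)[symmetric] ..
  have "AE y in lebesgue. y \<in> slab \<longrightarrow> f (closest_point \<sigma> y) = g (closest_point \<sigma> y)"
    using AE_foot_rel_interior by eventually_elim (simp add: base_def C(3)[symmetric] eq)
  then show "surf_integrable M \<sigma> f" and "surf_int M \<sigma> f = surf_int M \<sigma> g"
    using g set_integral_AE_eq[of slab "\<lambda>y. f (closest_point \<sigma> y)" "\<lambda>y. g (closest_point \<sigma> y)"]
    unfolding surf_integrable_def surf_int_def slab by auto
qed

lemma compact_prism: "\<sigma> \<in> faces M \<Longrightarrow> compact (prism M \<sigma>)"
  and measure_prism_pos: "\<sigma> \<in> faces M \<Longrightarrow> 0 < measure lebesgue (prism M \<sigma>)"
proof -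
  assume \<sigma>: "\<sigma> \<in> faces M"
  obtain K where K: "K \<in> cover M" "\<sigma> facet_of K" using face_cell[OF \<sigma>] by auto
  obtain C v where C: "facet_prism C v (normal M \<sigma>)" "K = convex hull C" "\<sigma> = convex hull (C - {v})"
    using facet_prism_of_face[OF \<sigma> K] .
  interpret facet_prism C v "normal M \<sigma>" by fact
  have slab: "prism M \<sigma> = slab" unfolding prism_def slab_def base_def C(3)[symmetric] ..
  show "compact (prism M \<sigma>)" unfolding slab by (rule compact_slab)
  show "0 < measure lebesgue (prism M \<sigma>)" unfolding slab area_prism using measure_hull_pos height_nz by simp
qed

lemma surf_integrable_const: "\<sigma> \<in> faces M \<Longrightarrow> surf_integrable M \<sigma> (\<lambda>_. c)"
  unfolding surf_integrable_def by (rule set_integrable_continuous_compact[OF compact_prism]) simp_all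

lemma surf_int_measure_prism: "\<sigma> \<in> faces M \<Longrightarrow> surf_int M \<sigma> (\<lambda>_. c) = measure lebesgue (prism M \<sigma>) *\<^sub>R c"
  unfolding surf_int_def using fmeasurableD[OF lmeasurable_compact[OF compact_prism]]
    fmeasurableD2[OF lmeasurable_compact[OF compact_prism]]
  by (intro set_integral_const) (simp_all add: infinity_ennreal_def)

lemma area_eq: "\<sigma> \<in> faces M \<Longrightarrow> area M \<sigma> = measure lebesgue (prism M \<sigma>)"
  by (simp add: area_def surf_int_measure_prism)

lemma area_pos: "\<sigma> \<in> faces M \<Longrightarrow> 0 < area M \<sigma>"
  by (simp add: area_eq measure_prism_pos)

lemma surf_int_const_on:
  fixes f :: "real^'n \<Rightarrow> 'b::euclidean_space"
  assumes "\<sigma> \<in> faces M" "\<And>x. x \<in> rel_interior \<sigma> \<Longrightarrow> f x = c"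
  shows "surf_int M \<sigma> f = area M \<sigma> *\<^sub>R c"
  using surf_int_cong(2)[OF assms surf_integrable_const[OF assms(1)]] assms(1)
  by (simp add: surf_int_measure_prism area_eq)

end

section \<open>Derivatives and cell means of the discrete functions\<close>

lemma lebesgue_integral_translation:
  fixes g :: "'a::euclidean_space \<Rightarrow> 'b::euclidean_space"
  assumes K: "compact K" and g: "continuous_on UNIV g"
  shows "set_lebesgue_integral lebesgue ((+) l ` K) (\<lambda>x. g (x - l)) = set_lebesgue_integral lebesgue K g"
proof -
  let ?h = "\<lambda>x. indicator K x *\<^sub>R g x"
  have Kb: "K \<in> sets borel" using K by (simp add: compact_imp_closed)
  have gb: "g \<in> borel_measurable borel" using g by (rule borel_measurable_continuous_onI)
  have h [measurable]: "?h \<in> borel_measurable borel" using Kb gb by measurable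
  have "x \<in> (+) l ` K \<longleftrightarrow> - l + x \<in> K" for x
    by (auto intro: image_eqI[where x = "- l + x"])
  then have eq: "indicator ((+) l ` K) x *\<^sub>R g (x - l) = ?h (- l + x)" for x
    by (simp add: indicator_def)
  have "set_lebesgue_integral lebesgue ((+) l ` K) (\<lambda>x. g (x - l)) = (\<integral>x. ?h (- l + x) \<partial>lebesgue)"
    unfolding set_lebesgue_integral_def eq ..
  also have "\<dots> = (\<integral>x. ?h (- l + x) \<partial>lborel)" by (rule integral_completion) measurable
  also have "\<dots> = (\<integral>x. ?h x \<partial>(distr lborel borel ((+) (- l))))"
    by (rule integral_distr[symmetric]) measurable
  also have "distr lborel borel ((+) (- l)) = (lborel :: 'a measure)"
    by (rule lborel_distr_plus)
  also have "(\<integral>x. ?h x \<partial>lborel) = set_lebesgue_integral lebesgue K g"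
    unfolding set_lebesgue_integral_def by (rule integral_completion[symmetric]) simp
  finally show ?thesis .
qed

text \<open>Otherwise the translation by \<open>k - l\<close> would map the set into itself, although it raises the maximum of the
  inner product with \<open>k - l\<close>.\<close>
lemma translate_bounded_eq:
  fixes S :: "'a::euclidean_space set"
  assumes S: "compact S" "S \<noteq> {}" and eq: "(+) k ` S = (+) l ` S"
  shows "k = l"
proof -
  let ?d = "k - l"
  obtain x where x: "x \<in> S" "\<And>y. y \<in> S \<Longrightarrow> ?d \<bullet> y \<le> ?d \<bullet> x"
    using continuous_attains_sup[OF S continuous_on_inner[OF continuous_on_const continuous_on_id], of ?d] by blast
  have "k + x \<in> (+) l ` S" using x(1) eq by blast
  then obtain y where "y \<in> S" "k + x = l + y" by auto
  then have "x + ?d \<in> S" by (simp add: algebra_simps)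
  then have "?d \<bullet> ?d \<le> 0" using x(2)[of "x + ?d"] by (simp add: inner_add_right)
  then show ?thesis by (metis eq_iff_diff_eq_0 inner_eq_zero_iff inner_ge_zero order_antisym)
qed

context mesh_geometry
begin

lemma pd_eq:
  fixes f :: "real^'n \<Rightarrow> 'b::euclidean_space"
  assumes "x \<in> interior K" and fL: "\<And>y. y \<in> interior K \<Longrightarrow> f y = L y + c" and L: "linear L"
  shows "pd i f x = L (axis i 1)"
proof -
  have "((\<lambda>y. L y + c) has_derivative L) (at x)"
    using has_derivative_add_const[OF linear_imp_has_derivative[OF L]] by simp
  then have "(f has_derivative L) (at x)"
    by (rule has_derivative_transform_within_open[OF _ open_interior assms(1)]) (simp add: fL)
  then show ?thesis unfolding pd_def using frechet_derivative_at by metis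
qed

definition affine_repr :: "(real^'n \<Rightarrow> real^'n) \<Rightarrow> (real^'n) set \<Rightarrow> real^'n^'n \<Rightarrow> real^'n \<Rightarrow> bool" where
  "affine_repr v K A b \<longleftrightarrow> (\<forall>x\<in>interior K. v x = A *v x + b)"

lemma linear_matrix: "linear ((*v) (A :: real^'n^'n))"
  by (rule matrix_vector_mul_linear)

lemma continuous_affine: "continuous_on S (\<lambda>x. (A :: real^'n^'n) *v x + b)"
  by (intro continuous_intros linear_continuous_on matrix_vector_mul_bounded_linear)

lemma Vh_affine: "v \<in> Vh M \<Longrightarrow> K \<in> cover M \<Longrightarrow> \<exists>A b. affine_repr v K A b"
  by (simp add: Vh_def affine_repr_def)

lemma divg_eq: "affine_repr v K A b \<Longrightarrow> x \<in> interior K \<Longrightarrow> divg v x = (\<Sum>i\<in>UNIV. (A *v axis i 1) $ i)"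
  unfolding divg_def affine_repr_def by (subst pd_eq[OF _ _ linear_matrix]) auto

lemma pwc_Vh: "v \<in> Vh M \<Longrightarrow> pwc v"
  unfolding pwc_def using Vh_affine elems_cover continuous_affine unfolding affine_repr_def by metis

lemma cellwise_const_divg: "v \<in> Vh M \<Longrightarrow> cellwise_const (divg v)"
  unfolding cellwise_const_def using Vh_affine divg_eq by metis

text \<open>The local form shared by the spaces \<open>Rh\<close> and \<open>Nh\<close>.\<close>
definition homothetic :: "(real^'n \<Rightarrow> real^'n) \<Rightarrow> bool" where
  "homothetic v \<longleftrightarrow> (\<forall>K\<in>cover M. \<exists>a (b :: real). \<forall>x\<in>interior K. v x = a + b *\<^sub>R x)"

lemma pwc_homothetic:
  assumes "homothetic v" shows "pwc v"
  unfolding pwc_def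
proof
  fix K assume "K \<in> elems M"
  then obtain a and b :: real where "\<forall>x\<in>interior K. v x = a + b *\<^sub>R x"
    using assms elems_cover unfolding homothetic_def by blast
  then show "\<exists>g. continuous_on UNIV g \<and> (\<forall>x\<in>interior K. v x = g x)"
    by (intro exI[of _ "\<lambda>x. a + b *\<^sub>R x"]) (auto intro!: continuous_intros)
qed

text \<open>The derivative of \<open>a + b x\<close> is a multiple of the identity, and the cross product of a vector with itself vanishes.
  Hence the terms with \<open>E \<bullet> curl B\<close> and \<open>B \<bullet> curl E\<close>, which couple the induction equation and Ampere's law, are
  both zero.\<close>
lemma curl_homothetic:
  assumes v: "homothetic v" and K: "K \<in> elems M" and x: "x \<in> interior K"
  shows "curl M v x = 0"
proof -
  obtain a and b :: real where ab: "\<forall>x\<in>interior K. v x = a + b *\<^sub>R x"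
    using v elems_cover[OF K] unfolding homothetic_def by blast
  have "pd i v x = b *\<^sub>R axis i 1" for i
    using x by (rule pd_eq[where L = "\<lambda>x. b *\<^sub>R x" and c = a]) (auto simp: ab intro!: linearI simp: algebra_simps)
  then show ?thesis
    by (simp add: curl_def linear_cmul[OF linear_emb] cross_mult_right)
qed

lemma Rh_homothetic: "v \<in> Rh M \<Longrightarrow> homothetic v" and Nh_homothetic: "v \<in> Nh M \<Longrightarrow> homothetic v"
  by (simp_all add: Rh_def Nh_def homothetic_def)

lemma PiQ_eq:
  assumes "K \<in> cover M" "x \<in> interior K"
  shows "PiQ M f x = (1 / measure lebesgue K) *\<^sub>R set_lebesgue_integral lebesgue K f"
proof -
  have "(THE K. K \<in> cover M \<and> x \<in> interior K) = K"
    using assms interiors_meet by (intro the_equality) blast+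
  then show ?thesis by (simp add: PiQ_def Let_def)
qed

lemma cellwise_const_PiQ: "cellwise_const (PiQ M f)"
  unfolding cellwise_const_def using PiQ_eq by metis

lemma measure_cover_pos: "K \<in> cover M \<Longrightarrow> 0 < measure lebesgue K"
proof -
  assume K: "K \<in> cover M"
  then have "\<not> negligible K" using cover_interior negligible_convex_interior cover_convex by blast
  then show ?thesis using cover_lmeasurable[OF K] negligible_iff_measure[of K] measure_nonneg[of lebesgue K] by (auto simp: less_le)
qed

lemma interior_translate: "interior ((+) l ` K) = (+) l ` interior K" for K :: "(real^'n) set"
  by (rule interior_translation)

lemma in_interior_translate: "x + l \<in> interior ((+) l ` K) \<longleftrightarrow> x \<in> interior K" for K :: "(real^'n) set"
  unfolding interior_translate by (auto simp: image_iff add.commute)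

lemma set_integral_interior:
  fixes f :: "real^'n \<Rightarrow> 'b::euclidean_space"
  assumes K: "K \<in> cover M" and g: "continuous_on UNIV g" and fg: "\<And>x. x \<in> interior K \<Longrightarrow> f x = g x"
  shows "set_integrable lebesgue K f" "set_lebesgue_integral lebesgue K f = set_lebesgue_integral lebesgue K g"
proof -
  have "frontier K \<in> null_sets lebesgue"
    using negligible_convex_frontier[OF cover_convex[OF K]] by (simp add: negligible_iff_null_sets)
  then have "AE x in lebesgue. x \<in> K \<longrightarrow> f x = g x"
    by (rule AE_I') (use fg closure_subset in \<open>auto simp: frontier_def\<close>)
  then show "set_integrable lebesgue K f" "set_lebesgue_integral lebesgue K f = set_lebesgue_integral lebesgue K g"
    using set_integral_AE_eq set_integrable_continuous_compact[OF cover_compact[OF K] g] by blast+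
qed

text \<open>Periods permute the cells, and the mean of an affine function is invariant under translations.  On the skeleton
  the description in \<open>PiQ\<close> denotes no cell, at \<open>x\<close> and at \<open>x + l\<close> alike.\<close>
lemma PiQ_periodic:
  fixes v :: "real^'n \<Rightarrow> real^'n"
  assumes v: "v \<in> Vh M" shows "periodic M (PiQ M v)"
  unfolding periodic_def
proof (intro ballI allI)
  fix l x assume l: "l \<in> periods M"
  have per: "v (y + l) = v y" for y using v l by (auto simp: Vh_def L2_def periodic_def)
  show "PiQ M v (x + l) = PiQ M v x"
  proof (cases "\<exists>K\<in>cover M. x \<in> interior K")
    case True
    then obtain K where K: "K \<in> cover M" "x \<in> interior K" by blast
    obtain A b where A: "affine_repr v K A b" using Vh_affine[OF v K(1)] by blast
    let ?g = "\<lambda>y. A *v y + b"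
    have K': "(+) l ` K \<in> cover M" by (rule cover_translate[OF K(1) l])
    have "v y = ?g (y - l)" if "y \<in> interior ((+) l ` K)" for y
      using that A per[of "y - l"] unfolding interior_translate affine_repr_def by auto
    moreover have "continuous_on UNIV (\<lambda>y. ?g (y - l))"
      by (rule continuous_on_compose2[OF continuous_affine[of UNIV A b]]) (auto intro!: continuous_intros)
    ultimately have "set_lebesgue_integral lebesgue ((+) l ` K) v
        = set_lebesgue_integral lebesgue ((+) l ` K) (\<lambda>y. ?g (y - l))"
      by (intro set_integral_interior(2)[OF K'])
    also have "\<dots> = set_lebesgue_integral lebesgue K ?g"
      by (rule lebesgue_integral_translation[OF cover_compact[OF K(1)] continuous_affine])
    also have "\<dots> = set_lebesgue_integral lebesgue K v"
      using A by (intro set_integral_interior(2)[OF K(1) continuous_affine, symmetric]) (simp add: affine_repr_def)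
    finally have "set_lebesgue_integral lebesgue ((+) l ` K) v = set_lebesgue_integral lebesgue K v" .
    then show ?thesis
      using PiQ_eq[OF K, of v] PiQ_eq[OF K' in_interior_translate[THEN iffD2, OF K(2)], of v]
      by (simp add: measure_translation)
  next
    case False
    have "\<not> (\<exists>K\<in>cover M. x + l \<in> interior K)"
    proof
      assume "\<exists>K\<in>cover M. x + l \<in> interior K"
      then obtain K where K: "K \<in> cover M" "x + l \<in> interior K" by blast
      have "(x + l) + (- l) \<in> interior ((+) (- l) ` K)"
        unfolding in_interior_translate by (rule K(2))
      then show False using False cover_translate[OF K(1) period_uminus[OF l]] by auto
    qed
    then have "(\<lambda>K. K \<in> cover M \<and> x + l \<in> interior K) = (\<lambda>K. K \<in> cover M \<and> x \<in> interior K)"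
      using False by auto
    then show ?thesis unfolding PiQ_def by presburger
  qed
qed

lemma vol_int_PiQ:
  fixes v c :: "real^'n \<Rightarrow> real^'n"
  assumes v: "pwc v" and c: "cellwise_const c"
  shows "vol_int M (\<lambda>x. c x \<bullet> v x) = vol_int M (\<lambda>x. c x \<bullet> PiQ M v x)"
proof -
  have "\<forall>K\<in>elems M. \<exists>g. continuous_on UNIV g \<and> (\<forall>x\<in>interior K. v x = g x)"
    using v unfolding pwc_def .
  then obtain g where g: "\<And>K. K \<in> elems M \<Longrightarrow> continuous_on UNIV (g K)"
    "\<And>K x. K \<in> elems M \<Longrightarrow> x \<in> interior K \<Longrightarrow> v x = g K x" by metis
  have "vol_int M (\<lambda>x. c x \<bullet> v x) = (\<Sum>K\<in>elems M. set_lebesgue_integral lebesgue K (\<lambda>x. cell_val c K \<bullet> g K x))"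
    using g cell_val[OF c elems_cover] by (intro vol_int_cellwise(2)) (auto intro!: continuous_intros)
  also have "\<dots> = (\<Sum>K\<in>elems M. measure lebesgue K * (cell_val c K \<bullet> cell_val (PiQ M v) K))"
  proof (rule sum.cong[OF refl])
    fix K assume K: "K \<in> elems M"
    note Kc = elems_cover[OF K]
    have int: "set_integrable lebesgue K (g K)"
      by (rule set_integrable_continuous_compact[OF cover_compact[OF Kc] g(1)[OF K]])
    have "cell_val (PiQ M v) K = (1 / measure lebesgue K) *\<^sub>R set_lebesgue_integral lebesgue K (g K)"
      unfolding cell_val_def PiQ_eq[OF Kc some_interior[OF Kc]]
      using set_integral_interior(2)[OF Kc g(1)[OF K] g(2)[OF K]] by simp
    then have "set_lebesgue_integral lebesgue K (g K) = measure lebesgue K *\<^sub>R cell_val (PiQ M v) K"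
      using measure_cover_pos[OF Kc] by simp
    moreover have "set_lebesgue_integral lebesgue K (\<lambda>x. cell_val c K \<bullet> g K x) = cell_val c K \<bullet> set_lebesgue_integral lebesgue K (g K)"
      using int unfolding set_lebesgue_integral_def set_integrable_def
      by (subst integral_inner_right[symmetric]) (auto simp: inner_scaleR_right)
    ultimately show "set_lebesgue_integral lebesgue K (\<lambda>x. cell_val c K \<bullet> g K x)
        = measure lebesgue K * (cell_val c K \<bullet> cell_val (PiQ M v) K)"
      by (simp add: inner_scaleR_right)
  qed
  also have "\<dots> = vol_int M (\<lambda>x. c x \<bullet> PiQ M v x)"
    unfolding vol_int_cellwise_const[OF cellwise_const_comp2[OF c cellwise_const_PiQ, of inner v]]
    by (simp add: cell_val_def)
  finally show ?thesis .
qed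

end

section \<open>The discrete divergence theorem\<close>

context mesh_geometry
begin

text \<open>The normal is the height times \<open>grd v\<close>, which cancels the height in \<open>prism_integral_affine\<close>; only the side on
  which the cell lies is left as a sign.\<close>
lemma surf_int_affine:
  fixes f :: "real^'n \<Rightarrow> real^'n"
  assumes \<sigma>: "\<sigma> \<in> faces M" and K: "K \<in> cover M" "\<sigma> facet_of K"
    and C: "full_simplex C" "v \<in> C" "K = convex hull C" "\<sigma> = convex hull (C - {v})"
    and \<theta>: "lies_at \<theta> \<sigma> K" "\<theta> = 1 \<or> \<theta> = -1" and f: "linear f"
  shows "surf_integrable M \<sigma> (\<lambda>x. f x + c)"
    and "\<theta> * (surf_int M \<sigma> (\<lambda>x. f x + c) \<bullet> normal M \<sigma>)
       = measure lebesgue K * (\<Sum>w\<in>C - {v}. full_simplex.grd C v \<bullet> (f w + c))"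
proof -
  let ?n = "normal M \<sigma>"
  have fp: "facet_prism C v ?n"
  proof (rule facet_prism.intro[OF C(1)], rule facet_prism_axioms.intro)
    show "v \<in> C" by fact
    show "CARD('n) = 2 \<or> CARD('n) = 3" by (rule dim)
    show "norm (normal M \<sigma>) = 1" using norm_normal \<sigma> by simp
    show "normal M \<sigma> \<bullet> (w - w') = 0" if "w \<in> C - {v}" "w' \<in> C - {v}" for w w'
      using normal_perp[OF \<sigma>, of w' w] that hull_subset[of "C - {v}" convex] unfolding C(4)[symmetric] by blast
  qed
  interpret facet_prism C v ?n by (rule fp)
  have slab: "prism M \<sigma> = slab" unfolding prism_def slab_def base_def C(4)[symmetric] ..
  show "surf_integrable M \<sigma> (\<lambda>x. f x + c)"
    using prism_integral_affine(1)[OF f, of c]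
    unfolding surf_integrable_def slab base_def C(4)[symmetric] .
  have I: "surf_int M \<sigma> (\<lambda>x. f x + c) = (measure lebesgue K / \<bar>height\<bar>) *\<^sub>R (\<Sum>w\<in>C - {v}. f w + c)"
    using prism_integral_affine(2)[OF f, of c]
    unfolding surf_int_def slab base_def C(3,4)[symmetric] .
  have "\<theta> = sgn height"
  proof (rule ccontr)
    assume ne: "\<theta> \<noteq> sgn height"
    obtain x where x: "x \<in> rel_interior \<sigma>" using rel_interior_face[OF \<sigma>] by auto
    have "\<forall>\<^sub>F t in at_right 0. x + (t * \<theta>) *\<^sub>R ?n \<in> interior K \<and> 0 < t"
      using \<theta>(1) x by (auto simp: lies_at_def eventually_conj_iff eventually_at_right_less)
    then obtain t where t: "x + (t * \<theta>) *\<^sub>R ?n \<in> interior K" "0 < t"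
      using eventually_happens[of _ "at_right (0::real)"] by (auto simp: trivial_limit_at_right_real)
    have "0 \<le> (?n \<bullet> (x + (t * \<theta>) *\<^sub>R ?n - x)) * height"
      using hull_side[of x "x + (t * \<theta>) *\<^sub>R ?n"] x t rel_interior_subset interior_subset
      unfolding base_def C(3,4)[symmetric] by blast
    then have "0 \<le> t * (\<theta> * height)" by (simp add: nn mult.assoc)
    moreover have "\<theta> * height < 0" using ne \<theta>(2) height_nz by (auto simp: sgn_if split: if_splits)
    ultimately show False using mult_pos_neg[OF t(2)] by (meson not_le)
  qed
  moreover have "(\<Sum>w\<in>C - {v}. f w + c) \<bullet> ?n = height * ((\<Sum>w\<in>C - {v}. f w + c) \<bullet> grd v)"
    using arg_cong[OF n_eq, of "inner (\<Sum>w\<in>C - {v}. f w + c)"] by simp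
  ultimately have "\<theta> * (surf_int M \<sigma> (\<lambda>x. f x + c) \<bullet> ?n)
      = sgn height * (measure lebesgue K / \<bar>height\<bar>) * height * ((\<Sum>w\<in>C - {v}. f w + c) \<bullet> grd v)"
    unfolding I inner_scaleR_left by (simp only: mult.assoc)
  also have "sgn height * (measure lebesgue K / \<bar>height\<bar>) * height = measure lebesgue K"
    using height_nz by (auto simp: sgn_if abs_if)
  finally show "\<theta> * (surf_int M \<sigma> (\<lambda>x. f x + c) \<bullet> normal M \<sigma>)
       = measure lebesgue K * (\<Sum>w\<in>C - {v}. grd v \<bullet> (f w + c))"
    by (simp add: inner_sum_right inner_commute)
qed

text \<open>For a cell \<open>K\<close> with face \<open>\<sigma>\<close>, the flux out of \<open>K\<close> with the trace taken from within \<open>K\<close>.\<close>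
definition out_flux :: "(real^'n \<Rightarrow> real^'n) \<Rightarrow> (real^'n) set \<Rightarrow> (real^'n) set \<Rightarrow> real" where
  "out_flux u \<sigma> K = (if K = cell_in \<sigma> then surf_int M \<sigma> (tr_in M \<sigma> u) \<bullet> normal M \<sigma>
                      else - (surf_int M \<sigma> (tr_out M \<sigma> u) \<bullet> normal M \<sigma>))"

text \<open>A convex cell on both sides of the face would contain points of the face in its interior.\<close>
lemma cell_in_neq_out: "\<sigma> \<in> int_faces M \<Longrightarrow> cell_in \<sigma> \<noteq> cell_out \<sigma>"
proof
  assume \<sigma>: "\<sigma> \<in> int_faces M" and eq: "cell_in \<sigma> = cell_out \<sigma>"
  note \<sigma>f = int_faces_faces[OF \<sigma>]
  let ?n = "normal M \<sigma>"
  have K: "lies_at (-1) \<sigma> (cell_in \<sigma>)" "lies_at 1 \<sigma> (cell_in \<sigma>)"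
    using cell_in[OF \<sigma>f] cell_out[OF \<sigma>] eq by auto
  obtain x where x: "x \<in> rel_interior \<sigma>" using rel_interior_face[OF \<sigma>f] by auto
  have "\<forall>\<^sub>F t in at_right 0. (x + (t * (-1)) *\<^sub>R ?n \<in> interior (cell_in \<sigma>) \<and> x + (t * 1) *\<^sub>R ?n \<in> interior (cell_in \<sigma>))"
    using K x by (auto simp: lies_at_def eventually_conj_iff)
  then obtain t where t: "x + (t * (-1)) *\<^sub>R ?n \<in> interior (cell_in \<sigma>)" "x + (t * 1) *\<^sub>R ?n \<in> interior (cell_in \<sigma>)"
    using eventually_happens[of _ "at_right (0::real)"] by (auto simp: trivial_limit_at_right_real)
  have conv: "convex (interior (cell_in \<sigma>))"
    using cover_convex[OF cell_in_cover[OF \<sigma>f]] by (rule convex_interior)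
  have "(1/2) *\<^sub>R (x + (t * (-1)) *\<^sub>R ?n) + (1/2) *\<^sub>R (x + (t * 1) *\<^sub>R ?n) \<in> interior (cell_in \<sigma>)"
    by (rule convexD[OF conv t]) auto
  then have xi: "x \<in> interior (cell_in \<sigma>)"
    by (simp add: algebra_simps scaleR_add_left[symmetric])
  have f: "\<sigma> face_of cell_in \<sigma>" and ne: "\<sigma> \<noteq> cell_in \<sigma>"
    using K by (auto simp: lies_at_def facet_of_def)
  show False
    using face_of_disjoint_rel_interior[OF f ne] xi x rel_interior_subset
      cover_rel_interior[OF cell_in_cover[OF \<sigma>f]] by blast
qed

lemma out_flux_eq:
  assumes \<sigma>: "\<sigma> \<in> faces M" and K: "K \<in> cover M" "\<sigma> facet_of K"
    and C: "full_simplex C" "v \<in> C" "K = convex hull C" "\<sigma> = convex hull (C - {v})"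
    and f: "linear f" and u: "\<And>x. x \<in> interior K \<Longrightarrow> u x = f x + c"
  shows "out_flux u \<sigma> K = - measure lebesgue K * (\<Sum>w\<in>C - {v}. full_simplex.grd C v \<bullet> (f w + c))"
proof -
  have cont: "continuous_on UNIV (\<lambda>x. f x + c)"
    using f by (intro continuous_intros linear_continuous_on) (simp add: linear_conv_bounded_linear)
  show ?thesis
  proof (cases "lies_at (-1) \<sigma> K")
    case True
    then have Kin: "K = cell_in \<sigma>" using cell_in[OF \<sigma>] lies_at_unique[OF \<sigma>] by blast
    have int: "surf_integrable M \<sigma> (\<lambda>x. f x + c)" 
      by (rule surf_int_affine(1)[OF \<sigma> K C True _ f]) simp
    have "surf_int M \<sigma> (tr_in M \<sigma> u) = surf_int M \<sigma> (\<lambda>x. f x + c)"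
      by (rule surf_int_cong(2)[OF \<sigma> tr_in_eq[OF \<sigma> _ cont] int]) (use u Kin in auto)
    then show ?thesis using surf_int_affine(2)[OF \<sigma> K C True _ f, of c] Kin by (simp add: out_flux_def)
  next
    case False
    then have out: "lies_at 1 \<sigma> K" using lies_at_cases[OF \<sigma> K] by blast
    have \<sigma>i: "\<sigma> \<in> int_faces M" using out no_cell_outside \<sigma> by (auto simp: int_faces_def)
    have Kout: "K = cell_out \<sigma>" using cell_out[OF \<sigma>i] lies_at_unique[OF \<sigma>] out by blast
    have Kin: "K \<noteq> cell_in \<sigma>" using cell_in_neq_out[OF \<sigma>i] Kout by simp
    have int: "surf_integrable M \<sigma> (\<lambda>x. f x + c)" 
      by (rule surf_int_affine(1)[OF \<sigma> K C out _ f]) simp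
    have "surf_int M \<sigma> (tr_out M \<sigma> u) = surf_int M \<sigma> (\<lambda>x. f x + c)"
      by (rule surf_int_cong(2)[OF \<sigma> tr_out_eq[OF \<sigma>i _ cont] int]) (use u Kout in auto)
    then show ?thesis using surf_int_affine(2)[OF \<sigma> K C out _ f, of c] Kin by (simp add: out_flux_def)
  qed
qed

lemma face_cells_int: "\<sigma> \<in> int_faces M \<Longrightarrow> {K \<in> cover M. \<sigma> facet_of K} = {cell_in \<sigma>, cell_out \<sigma>}"
proof -
  assume \<sigma>: "\<sigma> \<in> int_faces M"
  note \<sigma>f = int_faces_faces[OF \<sigma>]
  have "K = cell_in \<sigma> \<or> K = cell_out \<sigma>" if "K \<in> cover M" "\<sigma> facet_of K" for K
    using lies_at_cases[OF \<sigma>f that] lies_at_unique[OF \<sigma>f] cell_in[OF \<sigma>f] cell_out[OF \<sigma>] by blast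
  then show ?thesis using cell_in[OF \<sigma>f] cell_out[OF \<sigma>] unfolding lies_at_def by blast
qed

lemma face_cells_bdry: "\<sigma> \<in> bdry_faces M \<Longrightarrow> {K \<in> cover M. \<sigma> facet_of K} = {cell_in \<sigma>}"
proof -
  assume \<sigma>: "\<sigma> \<in> bdry_faces M"
  then have \<sigma>f: "\<sigma> \<in> faces M" by (simp add: bdry_faces_def)
  have "K = cell_in \<sigma>" if "K \<in> cover M" "\<sigma> facet_of K" for K
    using lies_at_cases[OF \<sigma>f that] lies_at_unique[OF \<sigma>f] cell_in[OF \<sigma>f] no_cell_outside[OF \<sigma>] by blast
  then show ?thesis using cell_in[OF \<sigma>f] unfolding lies_at_def by blast
qed

definition verts :: "(real^'n) set \<Rightarrow> (real^'n) set" where "verts K = {x. x extreme_point_of K}"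

lemma verts_hull: "full_simplex C \<Longrightarrow> verts (convex hull C) = C"
  unfolding verts_def using extreme_point_of_convex_hull_affine_independent[OF full_simplex.indep] by blast

lemma verts_simplex: assumes "K \<in> cover M" shows "full_simplex (verts K)" "K = convex hull (verts K)"
proof -
  obtain C where "full_simplex C" "K = convex hull C" using cover_simplex[OF assms] by blast
  then show "full_simplex (verts K)" "K = convex hull (verts K)" using verts_hull by auto
qed

lemma facet_verts:
  assumes K: "K \<in> cover M" shows "F facet_of K \<longleftrightarrow> (\<exists>v\<in>verts K. F = convex hull (verts K - {v}))"
proof -
  have "F facet_of (convex hull (verts K)) \<longleftrightarrow> 2 \<le> card (verts K) \<and> (\<exists>v. v \<in> verts K \<and> F = convex hull (verts K - {v}))"
    by (rule facet_of_convex_hull_affine_independent_alt[OF full_simplex.indep[OF verts_simplex(1)[OF K]]])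
  moreover have "2 \<le> card (verts K)" using full_simplex.card_C[OF verts_simplex(1)[OF K]] dim by auto
  ultimately show ?thesis using verts_simplex(2)[OF K] by auto
qed

lemma facet_verts_inj:
  assumes K: "K \<in> cover M" and v: "v \<in> verts K" "v' \<in> verts K"
    and eq: "convex hull (verts K - {v}) = convex hull (verts K - {v'})"
  shows "v = v'"
proof -
  have "\<not> affine_dependent (verts K - {w})" for w
    using affine_independent_subset[OF full_simplex.indep[OF verts_simplex(1)[OF K]]] by auto
  then have "{x. x extreme_point_of (convex hull (verts K - {w}))} = verts K - {w}" for w
    using extreme_point_of_convex_hull_affine_independent by blast
  then have "verts K - {v} = verts K - {v'}" using eq by metis
  then show ?thesis using v by blast
qed

lemma grd_translate:
  fixes C :: "(real^'n) set"
  assumes "full_simplex C" "full_simplex ((+) l ` C)"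
  shows "full_simplex.grd ((+) l ` C) (l + v) = full_simplex.grd C v"
proof -
  have "(+) l ` C - {l + v} = (+) l ` (C - {v})" by auto
  then have "(\<forall>w\<in>(+) l ` C - {l + v}. q \<bullet> (w - (l + v)) = -1) \<longleftrightarrow> (\<forall>w\<in>C - {v}. q \<bullet> (w - v) = -1)" for q
    by (simp only: ball_simps(9) add_diff_cancel_left)
  then show ?thesis unfolding full_simplex.grd_def[OF assms(1)] full_simplex.grd_def[OF assms(2)] by simp
qed

lemma simplex_translate: "full_simplex C \<Longrightarrow> full_simplex ((+) l ` C)" for C :: "(real^'n) set"
  using affine_dependent_translation_eq[of C l] by (simp add: full_simplex_def card_image)

text \<open>A facet of an element, given by its opposite vertex, is a translate of a unique face in \<open>faces M\<close>; this is that face together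
  with the period of the translation.\<close>
definition attach :: "(real^'n) set \<times> (real^'n) \<Rightarrow> (real^'n) set \<times> (real^'n)" where
  "attach = (\<lambda>(K, v). SOME (\<sigma>, l). \<sigma> \<in> faces M \<and> l \<in> periods M \<and> convex hull (verts K - {v}) = (+) l ` \<sigma>)"

lemma face_compact: "\<sigma> \<in> faces M \<Longrightarrow> compact \<sigma> \<and> \<sigma> \<noteq> {}"
  using face_cell[of \<sigma>] rel_interior_face[of \<sigma>] rel_interior_subset[of \<sigma>]
  by (metis cover_compact cover_convex facet_of_imp_face_of face_of_imp_compact subset_empty)

lemma attach:
  assumes K: "K \<in> elems M" and v: "v \<in> verts K" and a: "attach (K, v) = (\<sigma>, l)"
  shows "\<sigma> \<in> faces M" "l \<in> periods M" "convex hull (verts K - {v}) = (+) l ` \<sigma>"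
proof -
  have "\<exists>\<sigma>. \<sigma> \<in> faces M \<and> (\<exists>l\<in>periods M. convex hull (verts K - {v}) = (+) l ` \<sigma>)"
  proof -
    have "convex hull (verts K - {v}) facet_of K" using facet_verts[OF elems_cover[OF K]] v by blast
    from facet_face[OF elems_cover[OF K] this] show ?thesis by (rule ex1_implies_ex)
  qed
  then have "\<exists>p. case p of (\<sigma>, l) \<Rightarrow> \<sigma> \<in> faces M \<and> l \<in> periods M \<and> convex hull (verts K - {v}) = (+) l ` \<sigma>"
    by auto
  from someI_ex[OF this] show "\<sigma> \<in> faces M" "l \<in> periods M" "convex hull (verts K - {v}) = (+) l ` \<sigma>"
    using a unfolding attach_def by auto
qed

lemma facet_translate: "F facet_of K \<Longrightarrow> K \<in> cover M \<Longrightarrow> (+) l ` F facet_of (+) l ` K"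
  by (simp add: facet_of_def face_of_translation_eq aff_dim_translation_eq)

text \<open>Moving each element so that a given facet falls on the representing face matches the pairs of an element and a facet with the
  pairs of a face and an adjacent cell of the cover.\<close>
lemma bij_attach:
  "bij_betw (\<lambda>(K, v). (fst (attach (K, v)), (+) (- snd (attach (K, v))) ` K))
     (SIGMA K:elems M. verts K) (SIGMA \<sigma>:faces M. {K \<in> cover M. \<sigma> facet_of K})"
  (is "bij_betw ?m ?T ?S")
proof (rule bij_betwI')
  fix p p' assume "p \<in> ?T" "p' \<in> ?T"
  then obtain K v K' v' where p: "p = (K, v)" "K \<in> elems M" "v \<in> verts K"
    and p': "p' = (K', v')" "K' \<in> elems M" "v' \<in> verts K'" by auto
  obtain \<sigma> l where a: "attach (K, v) = (\<sigma>, l)" by (cases "attach (K, v)")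
  obtain \<sigma>' l' where a': "attach (K', v') = (\<sigma>', l')" by (cases "attach (K', v')")
  note A = attach[OF p(2,3) a] and A' = attach[OF p'(2,3) a']
  show "?m p = ?m p' \<longleftrightarrow> p = p'"
  proof
    assume "?m p = ?m p'"
    then have \<sigma>: "\<sigma> = \<sigma>'" and K: "(+) (- l) ` K = (+) (- l') ` K'" using p p' a a' by auto
    have "(+) (l' - l) ` K = (+) l' ` (+) (- l) ` K" by (simp add: image_image algebra_simps)
    also have "\<dots> = K'" unfolding K by (simp add: image_image)
    finally have KK': "(+) (l' - l) ` K = K'" .
    then have "l' - l = 0" using elem_translate[OF p(2) period_diff[OF A'(2) A(2)]] p'(2) by simp
    then have ll: "l = l'" and KK: "K = K'" using KK' by simp_all
    have "v = v'"
      using facet_verts_inj[OF elems_cover[OF p(2)] p(3), of v'] p'(3) A(3) A'(3) unfolding ll \<sigma> KK by simp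
    then show "p = p'" using p p' KK by simp
  qed simp
next
  fix p assume "p \<in> ?T"
  then obtain K v where p: "p = (K, v)" "K \<in> elems M" "v \<in> verts K" by auto
  obtain \<sigma> l where a: "attach (K, v) = (\<sigma>, l)" by (cases "attach (K, v)")
  note A = attach[OF p(2,3) a]
  have "convex hull (verts K - {v}) facet_of K" using facet_verts[OF elems_cover[OF p(2)]] p(3) by blast
  then have "(+) (- l) ` (+) l ` \<sigma> facet_of (+) (- l) ` K"
    unfolding A(3)[symmetric] by (rule facet_translate[OF _ elems_cover[OF p(2)]])
  then have "\<sigma> facet_of (+) (- l) ` K" by (simp add: image_image)
  moreover have "(+) (- l) ` K \<in> cover M" using elems_cover[OF p(2)] period_uminus[OF A(2)] by (rule cover_translate)
  ultimately show "?m p \<in> ?S" using p a A by simp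
next
  fix q assume "q \<in> ?S"
  then obtain \<sigma> K where q: "q = (\<sigma>, K)" "\<sigma> \<in> faces M" "K \<in> cover M" "\<sigma> facet_of K" by auto
  obtain k K0 where k: "k \<in> periods M" "K0 \<in> elems M" "K = (+) k ` K0" using q(3) by (rule coverE)
  have "(+) (- k) ` \<sigma> facet_of (+) (- k) ` K" by (rule facet_translate[OF q(4,3)])
  then have F: "(+) (- k) ` \<sigma> facet_of K0" unfolding k(3) by (simp add: image_image)
  then obtain v where v: "v \<in> verts K0" "(+) (- k) ` \<sigma> = convex hull (verts K0 - {v})"
    using facet_verts[OF elems_cover[OF k(2)]] by blast
  obtain \<sigma>' l where a: "attach (K0, v) = (\<sigma>', l)" by (cases "attach (K0, v)")
  note A = attach[OF k(2) v(1) a]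
  have "\<sigma>' = \<sigma>"
    using facet_face[OF elems_cover[OF k(2)] F] q(2) A period_uminus[OF k(1)] v(2) by metis
  then have "- k = l"
    using translate_bounded_eq[of \<sigma> "- k" l] face_compact[OF q(2)] A(3) v(2) by simp
  then have "?m (K0, v) = q" using a q(1) k(3) \<open>\<sigma>' = \<sigma>\<close> by auto
  then show "\<exists>p\<in>?T. q = ?m p" using k(2) v(1) by force
qed

text \<open>The divergence theorem on each element, with the fluxes regrouped by faces.\<close>
lemma sum_div_fluxes:
  assumes u: "u \<in> Vh M" and p: "periodic M p" "cellwise_const p"
  shows "vol_int M (\<lambda>x. p x * divg u x)
    = (\<Sum>\<sigma>\<in>faces M. \<Sum>K\<in>{K \<in> cover M. \<sigma> facet_of K}. cell_val p K * out_flux u \<sigma> K)"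
proof -
  let ?S = "SIGMA \<sigma>:faces M. {K \<in> cover M. \<sigma> facet_of K}"
  let ?G = "\<lambda>(\<sigma>, K). cell_val p K * out_flux u \<sigma> K"
  let ?m = "\<lambda>(K, v). (fst (attach (K, v)), (+) (- snd (attach (K, v))) ` K)"
  obtain A b where Ab: "\<And>K. K \<in> elems M \<Longrightarrow> affine_repr u K (A K) (b K)"
    using Vh_affine[OF u elems_cover] by metis
  have per: "u (y + l) = u y" if "l \<in> periods M" for y l using u that by (auto simp: Vh_def L2_def periodic_def)
  have cc: "cellwise_const (\<lambda>x. p x * divg u x)"
    using cellwise_const_comp2[OF p(2) cellwise_const_divg[OF u], of "(*)"] .
  let ?\<Psi> = "\<lambda>K v. - (\<Sum>w\<in>verts K - {v}. full_simplex.grd (verts K) v \<bullet> (A K *v w + b K))"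
  have "vol_int M (\<lambda>x. p x * divg u x) = (\<Sum>K\<in>elems M. \<Sum>v\<in>verts K. measure lebesgue K * cell_val p K * ?\<Psi> K v)"
    unfolding vol_int_cellwise_const[OF cc]
  proof (rule sum.cong[OF refl])
    fix K assume K: "K \<in> elems M"
    note Kc = elems_cover[OF K]
    interpret full_simplex "verts K" by (rule verts_simplex(1)[OF Kc])
    have "cell_val (\<lambda>x. p x * divg u x) K = cell_val p K * divg u (SOME x. x \<in> interior K)"
      by (simp add: cell_val_def)
    also have "divg u (SOME x. x \<in> interior K) = (\<Sum>i\<in>UNIV. (A K *v axis i 1) $ i)"
      by (rule divg_eq[OF Ab[OF K] some_interior[OF Kc]])
    also have "\<dots> = (\<Sum>e\<in>Basis. (A K *v e) \<bullet> e)"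
      by (auto simp: Basis_vec_def UNION_singleton_eq_range inner_axis inj_on_def axis_eq_axis
        intro!: sum.reindex_cong[of "\<lambda>i. axis i 1", symmetric])
    also have "\<dots> = (\<Sum>v\<in>verts K. ?\<Psi> K v)"
      by (rule divergence_algebra[OF linear_matrix])
    finally show "measure lebesgue K *\<^sub>R cell_val (\<lambda>x. p x * divg u x) K
        = (\<Sum>v\<in>verts K. measure lebesgue K * cell_val p K * ?\<Psi> K v)"
      by (simp only: real_scaleR_def mult.assoc sum_distrib_left)
  qed
  also have "\<dots> = (\<Sum>(K, v)\<in>(SIGMA K:elems M. verts K). measure lebesgue K * cell_val p K * ?\<Psi> K v)"
    using finite_elems full_simplex.finite_C[OF verts_simplex(1)[OF elems_cover]]
    by (intro sum.Sigma) auto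
  also have "\<dots> = (\<Sum>q\<in>(SIGMA K:elems M. verts K). ?G (?m q))"
  proof (rule sum.cong[OF refl])
    fix q assume "q \<in> (SIGMA K:elems M. verts K)"
    then obtain K v where q: "q = (K, v)" and K: "K \<in> elems M" and v: "v \<in> verts K" by auto
    note Kc = elems_cover[OF K]
    obtain \<sigma> l where a: "attach (K, v) = (\<sigma>, l)" by (cases "attach (K, v)")
    note AA = attach[OF K v a]
    let ?K' = "(+) (- l) ` K" and ?C = "(+) (- l) ` verts K"
    have K': "?K' \<in> cover M" by (rule cover_translate[OF Kc period_uminus[OF AA(2)]])
    have C: "full_simplex ?C" by (rule simplex_translate[OF verts_simplex(1)[OF Kc]])
    have K'C: "?K' = convex hull ?C"
      unfolding convex_hull_translation verts_simplex(2)[OF Kc, symmetric] ..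
    have Cv: "?C - {- l + v} = (+) (- l) ` (verts K - {v})" by auto
    have \<sigma>C: "\<sigma> = convex hull (?C - {- l + v})"
      unfolding Cv convex_hull_translation AA(3) image_image by simp
    have facet: "\<sigma> facet_of ?K'"
      using facet_verts[OF K'] verts_hull[OF C] \<sigma>C v unfolding K'C[symmetric] by auto
    have rep: "u x = A K *v x + (A K *v l + b K)" if x: "x \<in> interior ?K'" for x
    proof -
      have "x + l \<in> interior K" using x unfolding interior_translate by auto
      then have "u (x + l) = A K *v (x + l) + b K" using Ab[OF K] by (simp add: affine_repr_def)
      then show ?thesis using per[OF AA(2)] by (simp add: matrix_vector_right_distrib add.assoc)
    qed
    have "out_flux u \<sigma> ?K' = - measure lebesgue ?K' *
        (\<Sum>w\<in>?C - {- l + v}. full_simplex.grd ?C (- l + v) \<bullet> (A K *v w + (A K *v l + b K)))"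
      by (rule out_flux_eq[OF AA(1) K' facet C _ K'C \<sigma>C linear_matrix rep]) (use v in auto)
    also have "(\<Sum>w\<in>?C - {- l + v}. full_simplex.grd ?C (- l + v) \<bullet> (A K *v w + (A K *v l + b K)))
        = (\<Sum>w\<in>verts K - {v}. full_simplex.grd (verts K) v \<bullet> (A K *v w + b K))"
      unfolding Cv grd_translate[OF verts_simplex(1)[OF Kc] C]
      by (subst sum.reindex) (auto simp: o_def matrix_vector_right_distrib matrix_vector_mult_diff_distrib algebra_simps)
    finally have flux: "out_flux u \<sigma> ?K' = measure lebesgue K * ?\<Psi> K v"
      unfolding measure_translation by (simp only: mult_minus_left mult_minus_right)
    have "(SOME x. x \<in> interior K) + (- l) \<in> interior ?K'"
      unfolding in_interior_translate by (rule some_interior[OF Kc])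
    then have "cell_val p ?K' = p ((SOME x. x \<in> interior K) + (- l))"
      using cell_val[OF p(2) K'] by metis
    also have "\<dots> = cell_val p K"
      using p(1) period_uminus[OF AA(2)] unfolding periodic_def cell_val_def by metis
    finally show "(case q of (K, v) \<Rightarrow> measure lebesgue K * cell_val p K * ?\<Psi> K v) = ?G (?m q)"
      using flux a by (simp add: q)
  qed
  also have "\<dots> = (\<Sum>q\<in>?S. ?G q)"
    by (rule sum.reindex_bij_betw[OF bij_attach])
  also have "\<dots> = (\<Sum>\<sigma>\<in>faces M. \<Sum>K\<in>{K \<in> cover M. \<sigma> facet_of K}. cell_val p K * out_flux u \<sigma> K)"
  proof (rule sum.Sigma[symmetric, OF finite_faces], rule ballI)
    fix \<sigma> assume "\<sigma> \<in> faces M"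
    then show "finite {K \<in> cover M. \<sigma> facet_of K}"
      using face_cells_int[of \<sigma>] face_cells_bdry[of \<sigma>] by (cases "\<sigma> \<in> int_faces M") (auto simp: int_faces_def)
  qed
  finally show ?thesis .
qed

text \<open>The two fluxes through an interior face cancel up to the jump of \<open>p\<close>, because the mean of the jump of \<open>u\<close> vanishes; the fluxes
  through boundary faces vanish by the boundary condition.\<close>
lemma vol_int_mult_divg:
  assumes u: "u \<in> V0h M" and p: "periodic M p" "cellwise_const p"
  shows "vol_int M (\<lambda>x. p x * divg u x)
    = (\<Sum>\<sigma>\<in>int_faces M. area M \<sigma> * (u_sig M u \<sigma> * (cell_val p (cell_in \<sigma>) - cell_val p (cell_out \<sigma>))))"
proof -
  have uV: "u \<in> Vh M" using u by (simp add: V0h_def)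
  have usig: "area M \<sigma> * u_sig M u \<sigma> = surf_int M \<sigma> (tr_in M \<sigma> u) \<bullet> normal M \<sigma>" if "\<sigma> \<in> faces M" for \<sigma>
    using area_pos[OF that] by (simp add: u_sig_def)
  have tr_int: "surf_int M \<sigma> (tr_out M \<sigma> u) = surf_int M \<sigma> (tr_in M \<sigma> u)" if \<sigma>: "\<sigma> \<in> int_faces M" for \<sigma>
  proof -
    note \<sigma>f = int_faces_faces[OF \<sigma>]
    have aff: "\<exists>g. continuous_on UNIV g \<and> surf_integrable M \<sigma> g \<and> (\<forall>x\<in>interior K. u x = g x)"
      if K: "K = cell_in \<sigma> \<or> K = cell_out \<sigma>" for K
    proof -
      have Kc: "K \<in> cover M" "\<sigma> facet_of K" using face_cells_int[OF \<sigma>] K by blast+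
      obtain v where v: "v \<in> verts K" "\<sigma> = convex hull (verts K - {v})" using facet_verts[OF Kc(1)] Kc(2) by blast
      obtain A b where A: "affine_repr u K A b" using Vh_affine[OF uV Kc(1)] by blast
      have "surf_integrable M \<sigma> (\<lambda>x. A *v x + b)"
        using lies_at_cases[OF \<sigma>f Kc]
        by (auto intro: surf_int_affine(1)[OF \<sigma>f Kc verts_simplex(1)[OF Kc(1)] v(1) verts_simplex(2)[OF Kc(1)] v(2) _ _ linear_matrix])
      then show ?thesis using A continuous_affine unfolding affine_repr_def by blast
    qed
    obtain g where g: "continuous_on UNIV g" "surf_integrable M \<sigma> g" "\<And>x. x \<in> interior (cell_in \<sigma>) \<Longrightarrow> u x = g x"
      using aff[of "cell_in \<sigma>"] by blast
    obtain h where h: "continuous_on UNIV h" "surf_integrable M \<sigma> h" "\<And>x. x \<in> interior (cell_out \<sigma>) \<Longrightarrow> u x = h x"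
      using aff[of "cell_out \<sigma>"] by blast
    have "surf_integrable M \<sigma> (tr_in M \<sigma> u)"
      by (rule surf_int_cong(1)[OF \<sigma>f tr_in_eq[OF \<sigma>f _ g(1)] g(2)]) (use g(3) in auto)
    moreover have "surf_integrable M \<sigma> (tr_out M \<sigma> u)"
      by (rule surf_int_cong(1)[OF \<sigma>f tr_out_eq[OF \<sigma> _ h(1)] h(2)]) (use h(3) in auto)
    ultimately have "surf_int M \<sigma> (jump M \<sigma> u) = surf_int M \<sigma> (tr_out M \<sigma> u) - surf_int M \<sigma> (tr_in M \<sigma> u)"
      unfolding surf_int_def surf_integrable_def jump_def by (simp add: set_integral_diff)
    moreover have "surf_int M \<sigma> (jump M \<sigma> u) = 0" using uV \<sigma> by (simp add: Vh_def)
    ultimately show ?thesis by simp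
  qed
  have sub: "int_faces M \<subseteq> faces M" using int_faces_faces by blast
  have bd: "bdry_faces M = faces M - int_faces M" by (auto simp: int_faces_def bdry_faces_def)
  have "(\<Sum>\<sigma>\<in>faces M. \<Sum>K\<in>{K \<in> cover M. \<sigma> facet_of K}. cell_val p K * out_flux u \<sigma> K)
      = (\<Sum>\<sigma>\<in>int_faces M. \<Sum>K\<in>{K \<in> cover M. \<sigma> facet_of K}. cell_val p K * out_flux u \<sigma> K)"
  proof (rule sum.mono_neutral_right[OF finite_faces sub], rule ballI)
    fix \<sigma> assume "\<sigma> \<in> faces M - int_faces M"
    then have \<sigma>: "\<sigma> \<in> bdry_faces M" by (simp add: bd)
    then have "surf_int M \<sigma> (tr_in M \<sigma> u) = 0" using u by (simp add: V0h_def)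
    then show "(\<Sum>K\<in>{K \<in> cover M. \<sigma> facet_of K}. cell_val p K * out_flux u \<sigma> K) = 0"
      unfolding face_cells_bdry[OF \<sigma>] by (simp add: out_flux_def)
  qed
  also have "\<dots> = (\<Sum>\<sigma>\<in>int_faces M. area M \<sigma> * (u_sig M u \<sigma> * (cell_val p (cell_in \<sigma>) - cell_val p (cell_out \<sigma>))))"
  proof (rule sum.cong[OF refl])
    fix \<sigma> assume \<sigma>: "\<sigma> \<in> int_faces M"
    have "(\<Sum>K\<in>{cell_in \<sigma>, cell_out \<sigma>}. cell_val p K * out_flux u \<sigma> K)
        = (cell_val p (cell_in \<sigma>) - cell_val p (cell_out \<sigma>)) * (area M \<sigma> * u_sig M u \<sigma>)"
      using cell_in_neq_out[OF \<sigma>] tr_int[OF \<sigma>] usig[OF int_faces_faces[OF \<sigma>]]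
      by (simp add: out_flux_def algebra_simps)
    then show "(\<Sum>K\<in>{K \<in> cover M. \<sigma> facet_of K}. cell_val p K * out_flux u \<sigma> K)
        = area M \<sigma> * (u_sig M u \<sigma> * (cell_val p (cell_in \<sigma>) - cell_val p (cell_out \<sigma>)))"
      unfolding face_cells_int[OF \<sigma>] by (simp add: algebra_simps)
  qed
  finally show ?thesis unfolding sum_div_fluxes[OF uV p] .
qed

end

section \<open>The pressure potential\<close>

text \<open>The derivative of \<open>Hpot\<close> at positive arguments.\<close>
definition Hpot' :: "real \<Rightarrow> real \<Rightarrow> real \<Rightarrow> real" where
  "Hpot' a \<gamma> r = a / (\<gamma> - 1) * (\<gamma> * r powr (\<gamma> - 1))"

lemma Hpot_has_deriv: "r > 0 \<Longrightarrow> (Hpot a \<gamma> has_real_derivative Hpot' a \<gamma> r) (at r)"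
  unfolding Hpot_def[abs_def] Hpot'_def by (intro DERIV_cmult has_real_derivative_powr)

lemma Hpot'_has_deriv:
  assumes "r > 0" "\<gamma> > 1"
  shows "(Hpot' a \<gamma> has_real_derivative a * \<gamma> * r powr (\<gamma> - 2)) (at r)"
proof -
  have "(Hpot' a \<gamma> has_real_derivative a / (\<gamma> - 1) * (\<gamma> * ((\<gamma> - 1) * r powr (\<gamma> - 1 - 1)))) (at r)"
    unfolding Hpot'_def[abs_def] by (intro DERIV_cmult has_real_derivative_powr assms)
  moreover have "a / (\<gamma> - 1) * (\<gamma> * ((\<gamma> - 1) * r powr (\<gamma> - 1 - 1))) = a * \<gamma> * r powr (\<gamma> - 2)"
    using assms(2) by simp
  ultimately show ?thesis by (simp only:)
qed

lemma Hpot''_eq: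
  assumes "r > 0" "\<gamma> > 1" shows "Hpot'' a \<gamma> r = a * \<gamma> * r powr (\<gamma> - 2)"
proof -
  have "\<forall>\<^sub>F x in nhds r. deriv (Hpot a \<gamma>) x = Hpot' a \<gamma> x"
    using eventually_nhds_in_open[OF open_greaterThan, of r 0] assms(1)
    by (auto elim!: eventually_mono intro!: DERIV_imp_deriv Hpot_has_deriv)
  then have "Hpot'' a \<gamma> r = deriv (Hpot' a \<gamma>) r"
    unfolding Hpot''_def by (rule deriv_cong_ev) simp
  also have "\<dots> = a * \<gamma> * r powr (\<gamma> - 2)"
    by (rule DERIV_imp_deriv[OF Hpot'_has_deriv[OF assms]])
  finally show ?thesis .
qed

lemma Hpot'_has_deriv'': "r > 0 \<Longrightarrow> \<gamma> > 1 \<Longrightarrow> (Hpot' a \<gamma> has_real_derivative Hpot'' a \<gamma> r) (at r)"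
  using Hpot'_has_deriv by (simp add: Hpot''_eq)

lemma Hpot''_nonneg: "r > 0 \<Longrightarrow> \<gamma> > 1 \<Longrightarrow> a > 0 \<Longrightarrow> 0 \<le> Hpot'' a \<gamma> r"
  by (simp add: Hpot''_eq)

lemma pressure_eq: "r > 0 \<Longrightarrow> \<gamma> > 1 \<Longrightarrow> pressure a \<gamma> r = r * Hpot' a \<gamma> r - Hpot a \<gamma> r"
proof -
  assume r: "r > 0" and \<gamma>: "\<gamma> > 1"
  have "r * r powr (\<gamma> - 1) = r powr \<gamma>" using r by (simp add: powr_diff)
  then have "r * Hpot' a \<gamma> r = a / (\<gamma> - 1) * (\<gamma> * r powr \<gamma>)"
    unfolding Hpot'_def by (metis mult.left_commute)
  then have "r * Hpot' a \<gamma> r - Hpot a \<gamma> r = a / (\<gamma> - 1) * ((\<gamma> - 1) * r powr \<gamma>)"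
    by (simp only: Hpot_def right_diff_distrib[symmetric] left_diff_distrib mult_1_left)
  then show ?thesis using \<gamma> by (simp add: pressure_def)
qed

lemma co_pos: "s > 0 \<Longrightarrow> r > 0 \<Longrightarrow> x \<in> co s r \<Longrightarrow> x > 0"
  by (auto simp: co_def)

lemma co_commute: "co s r = co r s"
  by (auto simp: co_def min_def max_def)

definition taylor_at :: "real \<Rightarrow> real \<Rightarrow> real \<Rightarrow> real \<Rightarrow> real \<Rightarrow> bool" where
  "taylor_at a \<gamma> s r \<xi> \<longleftrightarrow> \<xi> \<in> co s r \<and>
     Hpot a \<gamma> s = Hpot a \<gamma> r + Hpot' a \<gamma> r * (s - r) + Hpot'' a \<gamma> \<xi> / 2 * (s - r)\<^sup>2"

lemma ex_taylor_at:
  assumes "s > 0" "r > 0" "\<gamma> > 1"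
  shows "\<exists>\<xi>. taylor_at a \<gamma> s r \<xi>"
proof (cases "s = r")
  case False
  let ?d = "\<lambda>m::nat. if m = 0 then Hpot a \<gamma> else if m = 1 then Hpot' a \<gamma> else Hpot'' a \<gamma>"
  have "\<exists>t. (if s < r then s < t \<and> t < r else r < t \<and> t < s) \<and>
      Hpot a \<gamma> s = (\<Sum>m<2. ?d m r / fact m * (s - r) ^ m) + ?d 2 t / fact 2 * (s - r) ^ 2"
  proof (rule Taylor[where a = "min s r" and b = "max s r"])
    show "\<forall>m t. m < 2 \<and> min s r \<le> t \<and> t \<le> max s r \<longrightarrow> DERIV (?d m) t :> ?d (Suc m) t"
    proof (intro allI impI, elim conjE)
      fix m :: nat and t assume m: "m < 2" and "min s r \<le> t"
      then have "t > 0" using assms by (auto simp: min_def split: if_splits)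
      moreover have "m = 0 \<or> m = 1" using m by auto
      ultimately show "DERIV (?d m) t :> ?d (Suc m) t"
        using Hpot_has_deriv Hpot'_has_deriv'' assms(3) by auto
    qed
  qed (use False in auto)
  then obtain t where t: "if s < r then s < t \<and> t < r else r < t \<and> t < s"
    "Hpot a \<gamma> s = (\<Sum>m<2. ?d m r / fact m * (s - r) ^ m) + ?d 2 t / fact 2 * (s - r) ^ 2" by blast
  have "t \<in> co s r" using t(1) by (auto simp: co_def split: if_splits)
  then show ?thesis using t(2) by (intro exI[of _ t]) (auto simp: numeral_2_eq_2 taylor_at_def)
qed (auto simp: co_def taylor_at_def)

lemma Hpot'_mvt:
  assumes "s > 0" "r > 0" "\<gamma> > 1"
  shows "\<exists>\<xi>\<in>co s r. Hpot' a \<gamma> s - Hpot' a \<gamma> r = Hpot'' a \<gamma> \<xi> * (s - r)"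
proof -
  have *: "\<exists>\<xi>\<in>co s r. Hpot' a \<gamma> s - Hpot' a \<gamma> r = Hpot'' a \<gamma> \<xi> * (s - r)" if "s > 0" "s < r" for s r
  proof -
    have "\<exists>z. s < z \<and> z < r \<and> Hpot' a \<gamma> r - Hpot' a \<gamma> s = (r - s) * Hpot'' a \<gamma> z"
      using that assms(3) by (intro MVT2 Hpot'_has_deriv'') auto
    then obtain z where "s < z" "z < r" "Hpot' a \<gamma> r - Hpot' a \<gamma> s = (r - s) * Hpot'' a \<gamma> z" by blast
    then show ?thesis by (intro bexI[of _ z]) (auto simp: co_def algebra_simps)
  qed
  consider "s < r" | "s = r" | "r < s" by linarith
  then show ?thesis
  proof cases
    case 3
    then obtain \<xi> where "\<xi> \<in> co r s" "Hpot' a \<gamma> r - Hpot' a \<gamma> s = Hpot'' a \<gamma> \<xi> * (r - s)" using *[of r s] assms by blast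
    then show ?thesis by (intro bexI[of _ \<xi>]) (auto simp: co_commute algebra_simps)
  qed (use * assms in \<open>auto simp: co_def\<close>)
qed

text \<open>By continuity, the values of \<open>Hpot''\<close> on an interval form an interval.\<close>
lemma Hpot''_average:
  assumes "s > 0" "r > 0" "\<gamma> > 1" "x \<in> co s r" "y \<in> co s r" "k \<ge> 0" "l > 0"
  shows "\<exists>\<xi>\<in>co s r. k * Hpot'' a \<gamma> x + l * Hpot'' a \<gamma> y = Hpot'' a \<gamma> \<xi> * (k + l)"
proof -
  have pos: "z > 0" if "z \<in> co s r" for z using co_pos assms that by blast
  have "continuous_on (co s r) (\<lambda>z. a * \<gamma> * z powr (\<gamma> - 2))"
    using pos by (intro continuous_intros) force+
  then have "continuous_on (co s r) (Hpot'' a \<gamma>)"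
    using pos Hpot''_eq assms(3) by (subst continuous_on_cong[OF refl]) auto
  then have "convex (Hpot'' a \<gamma> ` co s r)"
    unfolding connected_convex_1[symmetric] by (intro connected_continuous_image) (auto simp: co_def)
  then have "(k / (k + l)) *\<^sub>R Hpot'' a \<gamma> x + (l / (k + l)) *\<^sub>R Hpot'' a \<gamma> y \<in> Hpot'' a \<gamma> ` co s r"
    using assms by (intro convexD) (auto simp: add_divide_distrib[symmetric])
  then obtain \<xi> where "\<xi> \<in> co s r" "(k / (k + l)) * Hpot'' a \<gamma> x + (l / (k + l)) * Hpot'' a \<gamma> y = Hpot'' a \<gamma> \<xi>" by auto
  moreover have "((k / (k + l)) * Hpot'' a \<gamma> x + (l / (k + l)) * Hpot'' a \<gamma> y) * (k + l)
      = k * Hpot'' a \<gamma> x + l * Hpot'' a \<gamma> y"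
    using assms(6,7) by (simp add: distrib_right)
  ultimately show ?thesis by metis
qed

text \<open>The pressure work at a face with normal velocity \<open>w\<close> and densities \<open>ri\<close>, \<open>ro\<close> on its sides, less the mass flux times the jump
  of \<open>Hpot'\<close>, is the dissipation by the jump of the density.\<close>
definition face_dissipation_at :: "real \<Rightarrow> real \<Rightarrow> real \<Rightarrow> real \<Rightarrow> real \<Rightarrow> real \<Rightarrow> real \<Rightarrow> bool" where
  "face_dissipation_at a \<gamma> \<eta> w ri ro \<zeta> \<longleftrightarrow> \<zeta> \<in> co ri ro \<and>
     w * (pressure a \<gamma> ro - pressure a \<gamma> ri)
      - (w * (if w \<ge> 0 then ri else ro) - \<eta> * (ro - ri)) * (Hpot' a \<gamma> ro - Hpot' a \<gamma> ri)
    = Hpot'' a \<gamma> \<zeta> * (ro - ri)\<^sup>2 * (\<eta> + \<bar>w\<bar> / 2)"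

text \<open>The upwind flux times the jump of \<open>Hpot'\<close> falls short of the pressure work by a second-order Taylor remainder, since
  \<open>pressure r = r * Hpot' r - Hpot r\<close>; the diffusive flux gives another value of \<open>Hpot''\<close> by the mean value theorem.
  A single intermediate point serves both, being that of their weighted average.\<close>
lemma ex_face_dissipation_at:
  assumes ri: "ri > 0" and ro: "ro > 0" and \<gamma>: "\<gamma> > 1" and \<eta>: "\<eta> > 0"
  shows "\<exists>\<zeta>. face_dissipation_at a \<gamma> \<eta> w ri ro \<zeta>"
proof -
  obtain y where y: "y \<in> co ri ro" "Hpot' a \<gamma> ro - Hpot' a \<gamma> ri = Hpot'' a \<gamma> y * (ro - ri)"
    using Hpot'_mvt[OF ro ri \<gamma>] co_commute by metis
  have "\<exists>x\<in>co ri ro. w * (pressure a \<gamma> ro - pressure a \<gamma> ri)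
      - w * (if w \<ge> 0 then ri else ro) * (Hpot' a \<gamma> ro - Hpot' a \<gamma> ri) = \<bar>w\<bar> / 2 * Hpot'' a \<gamma> x * (ro - ri)\<^sup>2"
  proof (cases "w \<ge> 0")
    case True
    obtain x where x: "x \<in> co ri ro" "Hpot a \<gamma> ri = Hpot a \<gamma> ro + Hpot' a \<gamma> ro * (ri - ro) + Hpot'' a \<gamma> x / 2 * (ri - ro)\<^sup>2"
      using ex_taylor_at[OF ri ro \<gamma>] unfolding taylor_at_def by blast
    have "pressure a \<gamma> ro - pressure a \<gamma> ri - ri * (Hpot' a \<gamma> ro - Hpot' a \<gamma> ri) = Hpot'' a \<gamma> x / 2 * (ro - ri)\<^sup>2"
      unfolding pressure_eq[OF ri \<gamma>] pressure_eq[OF ro \<gamma>] using x(2) by (simp add: algebra_simps power2_commute)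
    then have "w * (pressure a \<gamma> ro - pressure a \<gamma> ri - ri * (Hpot' a \<gamma> ro - Hpot' a \<gamma> ri)) = w * (Hpot'' a \<gamma> x / 2 * (ro - ri)\<^sup>2)"
      by simp
    then show ?thesis using True x(1) by (intro bexI[of _ x]) (auto simp: algebra_simps)
  next
    case False
    obtain x where x: "x \<in> co ro ri" "Hpot a \<gamma> ro = Hpot a \<gamma> ri + Hpot' a \<gamma> ri * (ro - ri) + Hpot'' a \<gamma> x / 2 * (ro - ri)\<^sup>2"
      using ex_taylor_at[OF ro ri \<gamma>] unfolding taylor_at_def by blast
    have "pressure a \<gamma> ro - pressure a \<gamma> ri - ro * (Hpot' a \<gamma> ro - Hpot' a \<gamma> ri) = - (Hpot'' a \<gamma> x / 2 * (ro - ri)\<^sup>2)"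
      unfolding pressure_eq[OF ri \<gamma>] pressure_eq[OF ro \<gamma>] using x(2) by (simp add: algebra_simps)
    then have "w * (pressure a \<gamma> ro - pressure a \<gamma> ri - ro * (Hpot' a \<gamma> ro - Hpot' a \<gamma> ri)) = w * (- (Hpot'' a \<gamma> x / 2 * (ro - ri)\<^sup>2))"
      by simp
    then show ?thesis using False x(1) by (intro bexI[of _ x]) (auto simp: algebra_simps co_commute)
  qed
  then obtain x where x: "x \<in> co ri ro" "w * (pressure a \<gamma> ro - pressure a \<gamma> ri)
      - w * (if w \<ge> 0 then ri else ro) * (Hpot' a \<gamma> ro - Hpot' a \<gamma> ri) = \<bar>w\<bar> / 2 * Hpot'' a \<gamma> x * (ro - ri)\<^sup>2" by blast
  obtain \<zeta> where \<zeta>: "\<zeta> \<in> co ri ro" "\<bar>w\<bar> / 2 * Hpot'' a \<gamma> x + \<eta> * Hpot'' a \<gamma> y = Hpot'' a \<gamma> \<zeta> * (\<bar>w\<bar> / 2 + \<eta>)"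
    using Hpot''_average[OF ri ro \<gamma> x(1) y(1), of "\<bar>w\<bar> / 2" \<eta>] \<eta> by auto
  have "w * (pressure a \<gamma> ro - pressure a \<gamma> ri)
      - (w * (if w \<ge> 0 then ri else ro) - \<eta> * (ro - ri)) * (Hpot' a \<gamma> ro - Hpot' a \<gamma> ri)
      = \<bar>w\<bar> / 2 * Hpot'' a \<gamma> x * (ro - ri)\<^sup>2 + \<eta> * (ro - ri) * (Hpot'' a \<gamma> y * (ro - ri))"
    unfolding x(2)[symmetric] y(2)[symmetric] by (simp add: algebra_simps)
  also have "\<dots> = (\<bar>w\<bar> / 2 * Hpot'' a \<gamma> x + \<eta> * Hpot'' a \<gamma> y) * (ro - ri)\<^sup>2"
    by (simp add: algebra_simps power2_eq_square)
  also have "\<dots> = Hpot'' a \<gamma> \<zeta> * (ro - ri)\<^sup>2 * (\<eta> + \<bar>w\<bar> / 2)"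
    unfolding \<zeta>(2) by (simp add: algebra_simps)
  finally show ?thesis using \<zeta>(1) unfolding face_dissipation_at_def by blast
qed

section \<open>Positivity of the density\<close>

context mesh_geometry
begin

definition positive_on_cells :: "(real^'n \<Rightarrow> real) \<Rightarrow> bool" where
  "positive_on_cells f \<longleftrightarrow> (\<forall>K\<in>cover M. \<forall>x\<in>interior K. 0 < f x)"

lemma positive_on_cellsI:
  assumes per: "periodic M f" and el: "\<And>K x. K \<in> elems M \<Longrightarrow> x \<in> interior K \<Longrightarrow> 0 < f x"
  shows "positive_on_cells f"
  unfolding positive_on_cells_def
proof (intro ballI)
  fix K x assume "K \<in> cover M" and x: "x \<in> interior K"
  then obtain l K0 where l: "l \<in> periods M" "K0 \<in> elems M" "K = (+) l ` K0" by (auto elim: coverE)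
  then obtain y where y: "y \<in> interior K0" "x = l + y" using x by (auto simp: interior_translate)
  have "f x = f y" using per l(1) unfolding y(2) periodic_def by (simp add: add.commute)
  then show "0 < f x" using el[OF l(2) y(1)] by simp
qed

lemma cell_val_pos: "positive_on_cells f \<Longrightarrow> K \<in> cover M \<Longrightarrow> 0 < cell_val f K"
  unfolding positive_on_cells_def cell_val_def using some_interior by blast

lemma flux_const:
  fixes f :: "real^'n \<Rightarrow> 'b::euclidean_space"
  assumes f: "cellwise_const f" and \<sigma>: "\<sigma> \<in> int_faces M" and x: "x \<in> rel_interior \<sigma>"
  shows "flux M \<epsilon> \<sigma> f u x = u_sig M u \<sigma> *\<^sub>R (if u_sig M u \<sigma> \<ge> 0 then cell_val f (cell_in \<sigma>) else cell_val f (cell_out \<sigma>))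
      - (msize M powr \<epsilon>) *\<^sub>R (cell_val f (cell_out \<sigma>) - cell_val f (cell_in \<sigma>))"
  by (simp add: flux_def upw_def jump_def tr_in_const[OF f int_faces_faces[OF \<sigma>] x] tr_out_const[OF f \<sigma> x])

lemma jump_const:
  fixes f :: "real^'n \<Rightarrow> 'b::euclidean_space"
  assumes f: "cellwise_const f" and \<sigma>: "\<sigma> \<in> int_faces M" and x: "x \<in> rel_interior \<sigma>"
  shows "jump M \<sigma> f x = cell_val f (cell_out \<sigma>) - cell_val f (cell_in \<sigma>)"
  by (simp add: jump_def tr_in_const[OF f int_faces_faces[OF \<sigma>] x] tr_out_const[OF f \<sigma> x])

lemma powr_msize_pos: "0 < msize M powr \<epsilon>"
  using msize_pos by simp

lemma cellwise_const_Dtx: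
  assumes "cellwise_const (v t)" "cellwise_const (v (t - \<tau>))"
  shows "cellwise_const (Dtx \<tau> v t)"
  unfolding Dtx_def Dt_def using cellwise_const_comp2[OF assms, of "\<lambda>x y. (x - y) /\<^sub>R \<tau>"] .

text \<open>Test with the indicator of the cells where the density is not positive.  Through a face between such
  a cell and one with positive density, neither the upwind nor the diffusive flux leads out of the former, so the mass in
  these cells has not decreased and would still be positive.\<close>
lemma density_positive_step:
  assumes eq: "continuity_eq M \<epsilon> \<tau> \<rho> u t" and \<tau>: "\<tau> > 0"
    and Q: "\<rho> t \<in> Qh M" "\<rho> (t - \<tau>) \<in> Qh M" and pos: "positive_on_cells (\<rho> (t - \<tau>))"
  shows "positive_on_cells (\<rho> t)"
proof (rule ccontr)
  assume "\<not> positive_on_cells (\<rho> t)"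
  then obtain K0 x0 where K0: "K0 \<in> elems M" "x0 \<in> interior K0" "\<rho> t x0 \<le> 0"
    using positive_on_cellsI[OF Qh_periodic[OF Q(1)]] by force
  define \<phi> where "\<phi> = (\<lambda>x. if \<rho> t x \<le> 0 then 1 else 0 :: real)"
  note c = Qh_cellwise_const[OF Q(1)] and c' = Qh_cellwise_const[OF Q(2)]
  have c\<phi>: "cellwise_const \<phi>" unfolding \<phi>_def by (rule cellwise_const_comp[OF c])
  have \<phi>Q: "\<phi> \<in> Qh M"
    using Qh_periodic[OF Q(1)] c\<phi> by (intro cellwise_const_Qh) (auto simp: periodic_def \<phi>_def)
  have cD: "cellwise_const (\<lambda>x. Dtx \<tau> \<rho> t x * \<phi> x)"
    by (rule cellwise_const_comp2[OF cellwise_const_Dtx[OF c c'] c\<phi>])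
  have val\<phi>: "cell_val \<phi> K = (if cell_val (\<rho> t) K \<le> 0 then 1 else 0)" for K
    by (simp add: cell_val_def \<phi>_def)
  have "vol_int M (\<lambda>x. Dtx \<tau> \<rho> t x * \<phi> x) < 0"
    unfolding vol_int_cellwise_const[OF cD]
  proof (rule order_le_less_trans)
    let ?g = "\<lambda>K. measure lebesgue K *\<^sub>R cell_val (\<lambda>x. Dtx \<tau> \<rho> t x * \<phi> x) K"
    have val: "cell_val (\<lambda>x. Dtx \<tau> \<rho> t x * \<phi> x) K = (if cell_val (\<rho> t) K \<le> 0 then (cell_val (\<rho> t) K - cell_val (\<rho> (t - \<tau>)) K) / \<tau> else 0)" for K
      by (simp add: cell_val_def \<phi>_def Dtx_def Dt_def divide_inverse)
    have neg: "cell_val (\<rho> t) K - cell_val (\<rho> (t - \<tau>)) K < 0" if "K \<in> elems M" "cell_val (\<rho> t) K \<le> 0" for K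
      using cell_val_pos[OF pos elems_cover[OF that(1)]] that by simp
    have le: "?g K \<le> 0" if "K \<in> elems M" for K
      using neg[OF that] \<tau> unfolding val by (auto simp: divide_le_0_iff mult_le_0_iff less_imp_le)
    show "(\<Sum>K\<in>elems M. ?g K) \<le> ?g K0"
    proof -
      have "(\<Sum>K\<in>elems M - {K0}. ?g K) \<le> 0" by (rule sum_nonpos) (use le in blast)
      then show ?thesis unfolding sum.remove[OF finite_elems K0(1)] by linarith
    qed
    have "cell_val (\<rho> t) K0 \<le> 0" using cell_val[OF c elems_cover[OF K0(1)] K0(2)] K0(3) by simp
    then show "?g K0 < 0"
      using neg[OF K0(1)] \<tau> measure_cover_pos[OF elems_cover[OF K0(1)]] unfolding val
      by (auto simp: divide_less_0_iff mult_less_0_iff)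
  qed
  moreover have "0 \<le> (\<Sum>\<sigma>\<in>int_faces M. surf_int M \<sigma> (\<lambda>x. flux M \<epsilon> \<sigma> (\<rho> t) (u t) x * jump M \<sigma> \<phi> x))"
  proof (rule sum_nonneg)
    fix \<sigma> assume \<sigma>: "\<sigma> \<in> int_faces M"
    let ?ri = "cell_val (\<rho> t) (cell_in \<sigma>)" and ?ro = "cell_val (\<rho> t) (cell_out \<sigma>)" and ?w = "u_sig M (u t) \<sigma>"
    let ?F = "?w * (if ?w \<ge> 0 then ?ri else ?ro) - msize M powr \<epsilon> * (?ro - ?ri)"
    let ?J = "cell_val \<phi> (cell_out \<sigma>) - cell_val \<phi> (cell_in \<sigma>)"
    have "surf_int M \<sigma> (\<lambda>x. flux M \<epsilon> \<sigma> (\<rho> t) (u t) x * jump M \<sigma> \<phi> x) = area M \<sigma> *\<^sub>R (?F * ?J)"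
      by (rule surf_int_const_on[OF int_faces_faces[OF \<sigma>]]) (simp add: flux_const[OF c \<sigma>] jump_const[OF c\<phi> \<sigma>])
    moreover have "0 \<le> ?F * ?J"
    proof -
      have \<eta>: "0 < msize M powr \<epsilon>" by (rule powr_msize_pos)
      consider "?ri \<le> 0 \<and> ?ro \<le> 0" | "?ri > 0 \<and> ?ro > 0" | "?ri \<le> 0 \<and> ?ro > 0" | "?ri > 0 \<and> ?ro \<le> 0" by linarith
      then show ?thesis
      proof cases
        case 3
        then have "?w * (if ?w \<ge> 0 then ?ri else ?ro) \<le> 0" by (auto simp: mult_le_0_iff)
        moreover have "0 \<le> msize M powr \<epsilon> * (?ro - ?ri)" using 3 \<eta> by simp
        ultimately have "?F \<le> 0" by linarith
        then show ?thesis using 3 by (simp add: val\<phi>)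
      next
        case 4
        then have "0 \<le> ?w * (if ?w \<ge> 0 then ?ri else ?ro)" by (auto simp: zero_le_mult_iff)
        moreover have "msize M powr \<epsilon> * (?ro - ?ri) \<le> 0" using 4 \<eta> by (simp add: mult_le_0_iff)
        ultimately have "0 \<le> ?F" by linarith
        then show ?thesis using 4 by (simp add: val\<phi>)
      qed (simp_all add: val\<phi>)
    qed
    ultimately show "0 \<le> surf_int M \<sigma> (\<lambda>x. flux M \<epsilon> \<sigma> (\<rho> t) (u t) x * jump M \<sigma> \<phi> x)"
      using area_pos[OF int_faces_faces[OF \<sigma>]] by simp
  qed
  moreover have "vol_int M (\<lambda>x. Dtx \<tau> \<rho> t x * \<phi> x)
      = (\<Sum>\<sigma>\<in>int_faces M. surf_int M \<sigma> (\<lambda>x. flux M \<epsilon> \<sigma> (\<rho> t) (u t) x * jump M \<sigma> \<phi> x))"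
    using eq \<phi>Q unfolding continuity_eq_def by force
  ultimately show False by linarith
qed

lemma positive_initial:
  assumes w: "is_PiQ M f w" and int: "set_integrable lebesgue (body M) f" and pos: "\<forall>x\<in>region M. 0 < f x"
  shows "positive_on_cells w"
proof (rule positive_on_cellsI)
  show "periodic M w" using w Qh_periodic by (simp add: is_PiQ_def)
  fix K x assume K: "K \<in> elems M" and x: "x \<in> interior K"
  note Kc = elems_cover[OF K]
  let ?f = "\<lambda>x. indicator K x *\<^sub>R f x"
  have "set_integrable lebesgue K f"
    by (rule set_integrable_subset[OF int fmeasurableD[OF cover_lmeasurable[OF Kc]]]) (use K in \<open>auto simp: body_def\<close>)
  then have intK: "integrable lebesgue ?f" by (simp add: set_integrable_def)
  have sub: "interior K \<subseteq> region M" unfolding region_eq using Kc by (intro interior_mono) auto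
  have nonneg: "AE x in lebesgue. 0 \<le> ?f x"
    using AE_interiors
  proof eventually_elim
    case (elim y)
    show ?case
    proof (cases "y \<in> K")
      case True
      then have "y \<in> region M" using elim K sub by blast
      then show ?thesis using pos True by (simp add: less_imp_le)
    qed simp
  qed
  have "integral\<^sup>L lebesgue ?f \<noteq> 0"
  proof
    assume "integral\<^sup>L lebesgue ?f = 0"
    then have "AE x in lebesgue. ?f x = 0"
      using integral_nonneg_eq_0_iff_AE[OF intK nonneg] by simp
    then have "AE x in lebesgue. x \<notin> interior K"
    proof eventually_elim
      case (elim y)
      show ?case
      proof
        assume y: "y \<in> interior K"
        then have "0 < f y" "y \<in> K" using pos sub interior_subset by blast+
        then show False using elim by simp
      qed
    qed
    then have "negligible (interior K)"
      unfolding negligible_iff_null_sets by (subst AE_iff_null_sets) auto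
    then show False using x open_not_negligible[OF open_interior] by blast
  qed
  moreover have "0 \<le> integral\<^sup>L lebesgue ?f" using nonneg by (rule integral_nonneg_AE)
  ultimately have "0 < set_lebesgue_integral lebesgue K f" by (simp add: set_lebesgue_integral_def)
  moreover have "w x = PiQ M f x" using w Kc x by (simp add: is_PiQ_def)
  ultimately show "0 < w x" using measure_cover_pos[OF Kc] by (simp add: PiQ_eq[OF Kc x])
qed

end

section \<open>The energy balance\<close>

text \<open>Testing with \<open>w\<close> and, in the continuity equation, with minus half its square turns the momentum flux through a face into
  squares of the jump.  Here \<open>s\<close> is the normal velocity, and \<open>i\<close> and \<open>o\<close> stand for the two sides.\<close>
lemma kinetic_face_identity:
  fixes wi wo :: "'b::real_inner"
  shows "(s *\<^sub>R (if s \<ge> 0 then ri *\<^sub>R wi else ro *\<^sub>R wo) - \<eta> *\<^sub>R (ro *\<^sub>R wo - ri *\<^sub>R wi)) \<bullet> (wo - wi)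
      - (s * (if s \<ge> 0 then ri else ro) - \<eta> * (ro - ri)) * ((norm wo)\<^sup>2 / 2 - (norm wi)\<^sup>2 / 2)
    = - (((if s \<ge> 0 then ri else ro) * (\<bar>s\<bar> / 2) + \<eta> * (1/2 * (ro + ri))) * (norm (wo - wi))\<^sup>2)"
proof (cases "s \<ge> 0")
  case True
  then show ?thesis
    by (simp add: power2_norm_eq_inner inner_diff_left inner_diff_right inner_commute[of wi wo]) (simp add: field_simps)
next
  case False
  then show ?thesis
    by (simp add: power2_norm_eq_inner inner_diff_left inner_diff_right inner_commute[of wi wo]) (simp add: field_simps)
qed

lemma half_norm_quotient_sq:
  fixes x :: "'b::real_normed_vector"
  assumes "\<tau> > 0" shows "\<tau> / 2 * (c * (norm (x /\<^sub>R \<tau>))\<^sup>2) = 1 / \<tau> * (1/2 * (c * (norm x)\<^sup>2))"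
  using assms by (simp only: norm_scaleR power_mult_distrib) (simp add: field_simps power2_eq_square)

text \<open>The backward difference quotient, tested at the new time, is the one of the energy plus a remainder of second
  order; \<open>h\<close> and \<open>k\<close> are the first two derivatives of the potential in its Taylor expansion.\<close>
lemma cell_energy_identity:
  fixes w w' :: "'b::real_inner"
  assumes \<tau>: "\<tau> > 0" and taylor: "H' = H + h * (r' - r) + k / 2 * (r' - r)\<^sup>2"
  shows "((r *\<^sub>R w - r' *\<^sub>R w') /\<^sub>R \<tau>) \<bullet> w + ((r - r') /\<^sub>R \<tau>) * (h - (norm w)\<^sup>2 / 2)
    = 1 / \<tau> * ((1/2 * r * (norm w)\<^sup>2 + H) - (1/2 * r' * (norm w')\<^sup>2 + H'))
      + \<tau> / 2 * (r' * (norm ((w - w') /\<^sub>R \<tau>))\<^sup>2) + \<tau> / 2 * (k * \<bar>(r - r') /\<^sub>R \<tau>\<bar>\<^sup>2)"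
proof -
  have "(r *\<^sub>R w - r' *\<^sub>R w') \<bullet> w + (r - r') * (h - (norm w)\<^sup>2 / 2)
    = (1/2 * r * (norm w)\<^sup>2 + H) - (1/2 * r' * (norm w')\<^sup>2 + H') + 1/2 * (r' * (norm (w - w'))\<^sup>2) + 1/2 * (k * (r - r')\<^sup>2)"
    unfolding taylor power2_norm_eq_inner
    by (simp add: inner_diff_left inner_diff_right inner_commute[of w' w] field_simps power2_eq_square)
  then have "1 / \<tau> * ((r *\<^sub>R w - r' *\<^sub>R w') \<bullet> w + (r - r') * (h - (norm w)\<^sup>2 / 2))
    = 1 / \<tau> * ((1/2 * r * (norm w)\<^sup>2 + H) - (1/2 * r' * (norm w')\<^sup>2 + H') + 1/2 * (r' * (norm (w - w'))\<^sup>2) + 1/2 * (k * (r - r')\<^sup>2))"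
    by simp
  moreover have "\<tau> / 2 * (r' * (norm ((w - w') /\<^sub>R \<tau>))\<^sup>2) = 1 / \<tau> * (1/2 * (r' * (norm (w - w'))\<^sup>2))"
    by (rule half_norm_quotient_sq[OF \<tau>])
  moreover have "\<tau> / 2 * (k * \<bar>(r - r') /\<^sub>R \<tau>\<bar>\<^sup>2) = 1 / \<tau> * (1/2 * (k * (r - r')\<^sup>2))"
    using half_norm_quotient_sq[OF \<tau>, of k "r - r'"] by (simp only: real_norm_def power2_abs)
  moreover have "((r *\<^sub>R w - r' *\<^sub>R w') /\<^sub>R \<tau>) \<bullet> w + ((r - r') /\<^sub>R \<tau>) * (h - (norm w)\<^sup>2 / 2)
      = 1 / \<tau> * ((r *\<^sub>R w - r' *\<^sub>R w') \<bullet> w + (r - r') * (h - (norm w)\<^sup>2 / 2))"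
    by (simp only: inner_scaleR_left real_scaleR_def divide_inverse mult_1_left mult.assoc distrib_left)
  ultimately show ?thesis by (simp only: distrib_left)
qed

lemma magnetic_identity:
  fixes b b' :: "'b::real_inner"
  assumes \<tau>: "\<tau> > 0"
  shows "((b - b') /\<^sub>R \<tau>) \<bullet> b = 1 / \<tau> * (1/2 * (norm b)\<^sup>2 - 1/2 * (norm b')\<^sup>2) + \<tau> / 2 * (norm ((b - b') /\<^sub>R \<tau>))\<^sup>2"
proof -
  have "(b - b') \<bullet> b = (1/2 * (norm b)\<^sup>2 - 1/2 * (norm b')\<^sup>2) + 1/2 * (norm (b - b'))\<^sup>2"
    unfolding power2_norm_eq_inner by (simp add: inner_diff_left inner_diff_right inner_commute[of b' b] field_simps)
  then have "((b - b') /\<^sub>R \<tau>) \<bullet> b = 1 / \<tau> * ((1/2 * (norm b)\<^sup>2 - 1/2 * (norm b')\<^sup>2) + 1/2 * (norm (b - b'))\<^sup>2)"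
    by (simp only: inner_scaleR_left divide_inverse mult_1_left)
  moreover have "\<tau> / 2 * (norm ((b - b') /\<^sub>R \<tau>))\<^sup>2 = 1 / \<tau> * (1/2 * (norm (b - b'))\<^sup>2)"
    using half_norm_quotient_sq[OF \<tau>, of 1 "b - b'"] by (simp only: mult_1_left)
  ultimately show ?thesis by (simp only: distrib_left)
qed

text \<open>The Lorentz force and the electromotive field \<open>cross3 u b\<close> do opposite work.  This exchanges the work of the force in the
  momentum equation for the resistive loss \<open>(norm j)\<^sup>2\<close>.\<close>
lemma lorentz_work:
  fixes j e u b :: "real^3"
  assumes "j = e + cross3 u b"
  shows "j \<bullet> e = (norm j)\<^sup>2 + cross3 j b \<bullet> u"
proof -
  have "j \<bullet> cross3 u b = - (cross3 j b \<bullet> u)"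
    by (simp add: cross3_simps)
  moreover have "j \<bullet> e = j \<bullet> j - j \<bullet> cross3 u b" using assms by (simp add: inner_diff_right[symmetric])
  ultimately show ?thesis by (simp add: power2_norm_eq_inner)
qed

context mesh_geometry
begin

lemma PiQ_scaled_const:
  assumes "r \<in> Qh M"
  shows "cellwise_const (\<lambda>y. r y *\<^sub>R PiQ M v y)"
  by (rule cellwise_const_comp2[OF Qh_cellwise_const[OF assms] cellwise_const_PiQ])

lemma pwc_Dtx: "pwc (v t) \<Longrightarrow> pwc (v (t - \<tau>)) \<Longrightarrow> pwc (Dtx \<tau> v t)"
  unfolding Dtx_def Dt_def by (erule (1) pwc_comp2) (intro continuous_intros)

lemma velocity_face_term:
  fixes \<eta> :: real and w :: "real^'n \<Rightarrow> real^'n"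
  assumes r: "cellwise_const r" and w: "cellwise_const w" and \<sigma>: "\<sigma> \<in> int_faces M"
  shows "surf_int M \<sigma> (\<lambda>x. (upw M v \<sigma> r x * (\<bar>u_sig M v \<sigma>\<bar> / 2) + \<eta> * avg M \<sigma> r x) * (norm (jump M \<sigma> w x))\<^sup>2)
    = area M \<sigma> * (((if u_sig M v \<sigma> \<ge> 0 then cell_val r (cell_in \<sigma>) else cell_val r (cell_out \<sigma>)) * (\<bar>u_sig M v \<sigma>\<bar> / 2)
        + \<eta> * (1/2 * (cell_val r (cell_out \<sigma>) + cell_val r (cell_in \<sigma>))))
      * (norm (cell_val w (cell_out \<sigma>) - cell_val w (cell_in \<sigma>)))\<^sup>2)"
  unfolding real_scaleR_def[symmetric, of "area M \<sigma>"]
  by (rule surf_int_const_on[OF int_faces_faces[OF \<sigma>]])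
     (simp only: upw_def avg_def tr_in_const[OF r int_faces_faces[OF \<sigma>]] tr_out_const[OF r \<sigma>]
        jump_const[OF w \<sigma>] real_scaleR_def)

text \<open>Up to null sets all integrands are determined cell by cell, and all face integrands are constant on their face.  So the
  four tested equations can be rewritten by the algebraic identities above, and the balance is a linear combination of the
  results.\<close>
lemma energy_identity:
  fixes \<mu> \<nu> a \<gamma> \<epsilon> \<tau> t :: real
    and \<rho> :: "real \<Rightarrow> real^'n \<Rightarrow> real" and u B E :: "real \<Rightarrow> real^'n \<Rightarrow> real^'n"
    and \<xi> :: "real^'n \<Rightarrow> real" and \<zeta> :: "(real^'n) set \<Rightarrow> real"
  assumes \<gamma>: "\<gamma> > 1" and \<tau>: "\<tau> > 0"
    and Q: "\<rho> t \<in> Qh M" "\<rho> (t - \<tau>) \<in> Qh M"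
    and u: "u t \<in> V0h M"
    and B: "B t \<in> Rh M" "B (t - \<tau>) \<in> Rh M" and E: "E t \<in> Nh M"
    and ce: "continuity_eq M \<epsilon> \<tau> \<rho> u t" and me: "momentum_eq M \<mu> \<nu> a \<gamma> \<epsilon> \<tau> \<rho> u B E t"
    and ie: "induction_eq M \<tau> B E t" and ae: "ampere_eq M \<tau> u B E t"
    and \<xi>: "cellwise_const \<xi>"
      "\<And>K x. K \<in> elems M \<Longrightarrow> x \<in> interior K \<Longrightarrow> taylor_at a \<gamma> (\<rho> (t - \<tau>) x) (\<rho> t x) (\<xi> x)"
    and \<zeta>: "\<And>\<sigma>. \<sigma> \<in> int_faces M \<Longrightarrow> face_dissipation_at a \<gamma> (msize M powr \<epsilon>) (u_sig M (u t) \<sigma>)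
        (cell_val (\<rho> t) (cell_in \<sigma>)) (cell_val (\<rho> t) (cell_out \<sigma>)) (\<zeta> \<sigma>)"
  shows "Dt \<tau> (\<lambda>s. total_energy M a \<gamma> (\<rho> s) (u s) (B s)) t
     + \<mu> * (L2_norm M (grad (u t)))\<^sup>2 + \<nu> * (L2_norm M (divg (u t)))\<^sup>2
     + (L2_norm M (current M \<tau> u B E t))\<^sup>2
   = dissipation M a \<gamma> \<epsilon> \<tau> \<rho> u B \<xi> \<zeta> t"
proof -
  define w where "w = PiQ M (u t)"
  define w' where "w' = PiQ M (u (t - \<tau>))"
  let ?\<eta> = "msize M powr \<epsilon>"
  let ?r = "\<rho> t" and ?r' = "\<rho> (t - \<tau>)" and ?b = "B t" and ?b' = "B (t - \<tau>)" and ?j = "current M \<tau> u B E t"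
  note cr = Qh_cellwise_const[OF Q(1)] and cr' = Qh_cellwise_const[OF Q(2)]
  have cw: "cellwise_const w" and cw': "cellwise_const w'"
    unfolding w_def w'_def by (rule cellwise_const_PiQ)+
  have uV: "u t \<in> Vh M" using u by (simp add: V0h_def)
  have pu: "pwc (u t)" by (rule pwc_Vh[OF uV])
  have pB: "pwc ?b" "pwc ?b'" using B Rh_homothetic pwc_homothetic by blast+
  have pE: "pwc (E t)" using E Nh_homothetic pwc_homothetic by blast
  have pj: "pwc ?j"
    unfolding current_def by (intro pwc_add pwc_cross pwc_emb pu pB pE)
  define D where "D = Dtx \<tau> (\<lambda>s y. \<rho> s y *\<^sub>R PiQ M (u s) y) t"
  \<comment> \<open>the test function of the continuity equation, derivative of the energy density with respect to \<open>\<rho>\<close>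
    at fixed momentum\<close>
  define \<phi> where "\<phi> x = Hpot' a \<gamma> (?r x) - (norm (w x))\<^sup>2 / 2" for x
  define en where "en x = 1/2 * ?r x * (norm (w x))\<^sup>2 + Hpot a \<gamma> (?r x)" for x
  define en' where "en' x = 1/2 * ?r' x * (norm (w' x))\<^sup>2 + Hpot a \<gamma> (?r' x)" for x
  have crw: "cellwise_const (\<lambda>y. ?r y *\<^sub>R w y)"
    by (rule cellwise_const_comp2[OF cr cw])
  have cD: "cellwise_const D" unfolding D_def
    by (rule cellwise_const_Dtx) (intro PiQ_scaled_const Q)+
  have cDr: "cellwise_const (Dtx \<tau> \<rho> t)" by (rule cellwise_const_Dtx[OF cr cr'])
  have cDw: "cellwise_const (Dtx \<tau> (\<lambda>s. PiQ M (u s)) t)"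
    by (rule cellwise_const_Dtx) (rule cellwise_const_PiQ)+
  have c\<phi>: "cellwise_const \<phi>" unfolding \<phi>_def
    by (rule cellwise_const_comp2[OF cr cw, of "\<lambda>r w. Hpot' a \<gamma> r - (norm w)\<^sup>2 / 2"])
  have cen: "cellwise_const en" "cellwise_const en'" unfolding en_def en'_def
    by (rule cellwise_const_comp2[OF cr cw, of "\<lambda>r w. 1/2 * r * (norm w)\<^sup>2 + Hpot a \<gamma> r"],
        rule cellwise_const_comp2[OF cr' cw', of "\<lambda>r w. 1/2 * r * (norm w)\<^sup>2 + Hpot a \<gamma> r"])
  have \<phi>Q: "\<phi> \<in> Qh M"
  proof (rule cellwise_const_Qh[OF _ c\<phi>])
    show "periodic M \<phi>"
      using Qh_periodic[OF Q(1)] PiQ_periodic[OF uV] unfolding periodic_def \<phi>_def w_def by simp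
  qed

  let ?f1 = "\<lambda>\<sigma>. surf_int M \<sigma> (\<lambda>x. flux M \<epsilon> \<sigma> (\<lambda>y. ?r y *\<^sub>R w y) (u t) x \<bullet> jump M \<sigma> w x)"
  let ?f2 = "\<lambda>\<sigma>. surf_int M \<sigma> (\<lambda>x. flux M \<epsilon> \<sigma> ?r (u t) x * jump M \<sigma> \<phi> x)"
  let ?d1 = "\<lambda>\<sigma>. surf_int M \<sigma> (\<lambda>x. (upw M (u t) \<sigma> ?r x * (\<bar>u_sig M (u t) \<sigma>\<bar> / 2) + ?\<eta> * avg M \<sigma> ?r x) * (norm (jump M \<sigma> w x))\<^sup>2)"
  let ?d2 = "\<lambda>\<sigma>. surf_int M \<sigma> (\<lambda>x. Hpot'' a \<gamma> (\<zeta> \<sigma>) * (jump M \<sigma> ?r x)\<^sup>2 * (?\<eta> + \<bar>u_sig M (u t) \<sigma>\<bar> / 2))"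
  define S1 where "S1 = (\<Sum>\<sigma>\<in>int_faces M. ?f1 \<sigma>)"
  define S2 where "S2 = (\<Sum>\<sigma>\<in>int_faces M. ?f2 \<sigma>)"
  define G where "G = vol_int M (\<lambda>x. grad (u t) x \<bullet> grad (u t) x)"
  define V where "V = vol_int M (\<lambda>x. (divg (u t) x)\<^sup>2)"
  define Pd where "Pd = vol_int M (\<lambda>x. pressure a \<gamma> (?r x) * divg (u t) x)"
  define L where "L = vol_int M (\<lambda>x. cross3 (?j x) (emb M (?b' x)) \<bullet> emb M (u t x))"
  define T1 where "T1 = vol_int M (\<lambda>x. ?r' x * (norm (Dtx \<tau> (\<lambda>s. PiQ M (u s)) t x))\<^sup>2)"
  define T2 where "T2 = vol_int M (\<lambda>x. (norm (Dtx \<tau> B t x))\<^sup>2)"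
  define T3 where "T3 = vol_int M (\<lambda>x. Hpot'' a \<gamma> (\<xi> x) * \<bar>Dtx \<tau> \<rho> t x\<bar>\<^sup>2)"
  define F1 where "F1 = (\<Sum>\<sigma>\<in>int_faces M. ?d1 \<sigma>)"
  define F2 where "F2 = (\<Sum>\<sigma>\<in>int_faces M. ?d2 \<sigma>)"
  define X where "X = vol_int M en" define X' where "X' = vol_int M en'"
  define Y where "Y = vol_int M (\<lambda>x. 1/2 * (norm (?b x))\<^sup>2)"
  define Y' where "Y' = vol_int M (\<lambda>x. 1/2 * (norm (?b' x))\<^sup>2)"

  have momentum: "vol_int M (\<lambda>x. D x \<bullet> w x) - S1 + \<mu> * G + (\<nu> * V - Pd) - L = 0"
  proof -
    have cdiv: "cellwise_const (divg (u t))" by (rule cellwise_const_divg[OF uV])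
    have "vol_int M (\<lambda>x. D x \<bullet> w x) = vol_int M (\<lambda>x. D x \<bullet> u t x)"
      unfolding w_def by (rule vol_int_PiQ[OF pu cD, symmetric])
    moreover have "vol_int M (\<lambda>x. (\<nu> * divg (u t) x - pressure a \<gamma> (?r x)) * divg (u t) x)
        = vol_int M (\<lambda>x. \<nu> * (divg (u t) x)\<^sup>2 - pressure a \<gamma> (?r x) * divg (u t) x)"
      by (simp add: power2_eq_square algebra_simps)
    moreover have "\<dots> = \<nu> * V - Pd"
      unfolding V_def Pd_def vol_int_cmult[symmetric]
      by (intro vol_int_diff cellwise_const_pwc cellwise_const_comp[OF cdiv, of "\<lambda>z. \<nu> * z\<^sup>2"]
          cellwise_const_comp2[OF cr cdiv, of "\<lambda>r z. pressure a \<gamma> r * z"])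
    ultimately show ?thesis
      using me uV unfolding momentum_eq_def D_def S1_def G_def L_def w_def by force
  qed

  have continuity: "vol_int M (\<lambda>x. Dtx \<tau> \<rho> t x * \<phi> x) - S2 = 0"
    using ce \<phi>Q unfolding continuity_eq_def S2_def by blast

  have time: "vol_int M (\<lambda>x. D x \<bullet> w x) + vol_int M (\<lambda>x. Dtx \<tau> \<rho> t x * \<phi> x)
      = 1 / \<tau> * (X - X') + \<tau> / 2 * T1 + \<tau> / 2 * T3"
  proof -
    let ?t1 = "\<lambda>x. ?r' x * (norm (Dtx \<tau> (\<lambda>s. PiQ M (u s)) t x))\<^sup>2"
    let ?t3 = "\<lambda>x. Hpot'' a \<gamma> (\<xi> x) * \<bar>Dtx \<tau> \<rho> t x\<bar>\<^sup>2"
    have ct1: "cellwise_const ?t1"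
      by (rule cellwise_const_comp2[OF cr' cDw, of "\<lambda>r d. r * (norm d)\<^sup>2"])
    have ct3: "cellwise_const ?t3"
      by (rule cellwise_const_comp2[OF \<xi>(1) cDr, of "\<lambda>x d. Hpot'' a \<gamma> x * \<bar>d\<bar>\<^sup>2"])
    have p1: "pwc (\<lambda>x. D x \<bullet> w x)" by (intro pwc_inner cellwise_const_pwc cD cw)
    have p2: "pwc (\<lambda>x. Dtx \<tau> \<rho> t x * \<phi> x)" by (intro pwc_mult cellwise_const_pwc cDr c\<phi>)
    have p3: "pwc (\<lambda>x. 1 / \<tau> * (en x - en' x))"
      by (intro pwc_mult pwc_diff pwc_const cellwise_const_pwc cen)
    have p4: "pwc (\<lambda>x. \<tau> / 2 * ?t1 x)" by (intro pwc_mult[OF pwc_const] cellwise_const_pwc ct1)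
    have p5: "pwc (\<lambda>x. \<tau> / 2 * ?t3 x)" by (intro pwc_mult[OF pwc_const] cellwise_const_pwc ct3)
    have "vol_int M (\<lambda>x. D x \<bullet> w x) + vol_int M (\<lambda>x. Dtx \<tau> \<rho> t x * \<phi> x)
        = vol_int M (\<lambda>x. D x \<bullet> w x + Dtx \<tau> \<rho> t x * \<phi> x)"
      by (rule vol_int_add[OF p1 p2, symmetric])
    also have "\<dots> = vol_int M (\<lambda>x. 1 / \<tau> * (en x - en' x) + \<tau> / 2 * ?t1 x + \<tau> / 2 * ?t3 x)"
    proof (rule vol_int_cong)
      fix K x assume K: "K \<in> elems M" "x \<in> interior K"
      show "D x \<bullet> w x + Dtx \<tau> \<rho> t x * \<phi> x = 1 / \<tau> * (en x - en' x) + \<tau> / 2 * ?t1 x + \<tau> / 2 * ?t3 x"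
        using cell_energy_identity[OF \<tau> conjunct2[OF \<xi>(2)[OF K, unfolded taylor_at_def]], of "w x" "w' x"]
        unfolding D_def Dtx_def Dt_def \<phi>_def en_def en'_def w_def w'_def .
    qed (intro pwc_add p3 p4 p5)
    also have "\<dots> = vol_int M (\<lambda>x. 1 / \<tau> * (en x - en' x)) + vol_int M (\<lambda>x. \<tau> / 2 * ?t1 x) + vol_int M (\<lambda>x. \<tau> / 2 * ?t3 x)"
      by (simp only: vol_int_add[OF pwc_add[OF p3 p4] p5] vol_int_add[OF p3 p4])
    also have "\<dots> = 1 / \<tau> * (X - X') + \<tau> / 2 * T1 + \<tau> / 2 * T3"
      unfolding vol_int_cmult T1_def T3_def X_def X'_def
      by (simp only: vol_int_diff[OF cen[THEN cellwise_const_pwc]])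
    finally show ?thesis .
  qed

  have faces: "S1 + S2 + Pd = - F1 - F2"
  proof -
    let ?p = "\<lambda>x. pressure a \<gamma> (?r x)"
    have "Pd = (\<Sum>\<sigma>\<in>int_faces M. area M \<sigma> * (u_sig M (u t) \<sigma> * (cell_val ?p (cell_in \<sigma>) - cell_val ?p (cell_out \<sigma>))))"
      unfolding Pd_def
      by (rule vol_int_mult_divg[OF u])
         (use Qh_periodic[OF Q(1)] in \<open>auto simp: periodic_def intro: cellwise_const_comp[OF cr]\<close>)
    then have "S1 + S2 + Pd = (\<Sum>\<sigma>\<in>int_faces M.
          ?f1 \<sigma>
        + ?f2 \<sigma>
        + area M \<sigma> * (u_sig M (u t) \<sigma> * (cell_val ?p (cell_in \<sigma>) - cell_val ?p (cell_out \<sigma>))))"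
      unfolding S1_def S2_def by (simp only: sum.distrib)
    also have "\<dots> = (\<Sum>\<sigma>\<in>int_faces M.
        - ?d1 \<sigma>
        - ?d2 \<sigma>)"
    proof (rule sum.cong[OF refl])
      fix \<sigma> assume \<sigma>: "\<sigma> \<in> int_faces M"
      note \<sigma>f = int_faces_faces[OF \<sigma>]
      define s where "s = u_sig M (u t) \<sigma>"
      define ri where "ri = cell_val ?r (cell_in \<sigma>)" define ro where "ro = cell_val ?r (cell_out \<sigma>)"
      define wi where "wi = cell_val w (cell_in \<sigma>)" define wo where "wo = cell_val w (cell_out \<sigma>)"
      let ?up = "if s \<ge> 0 then ri else ro"
      let ?f = "s * ?up - ?\<eta> * (ro - ri)"
      have \<phi>v: "cell_val \<phi> (cell_out \<sigma>) - cell_val \<phi> (cell_in \<sigma>)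
          = (Hpot' a \<gamma> ro - Hpot' a \<gamma> ri) - ((norm wo)\<^sup>2 / 2 - (norm wi)\<^sup>2 / 2)"
        by (simp add: cell_val_def \<phi>_def ri_def ro_def wi_def wo_def)
      have rwv: "cell_val (\<lambda>y. ?r y *\<^sub>R w y) (cell_in \<sigma>) = ri *\<^sub>R wi" "cell_val (\<lambda>y. ?r y *\<^sub>R w y) (cell_out \<sigma>) = ro *\<^sub>R wo"
        by (simp_all add: cell_val_def ri_def ro_def wi_def wo_def)
      have 1: "?f1 \<sigma>
          = area M \<sigma> *\<^sub>R ((s *\<^sub>R (if s \<ge> 0 then ri *\<^sub>R wi else ro *\<^sub>R wo) - ?\<eta> *\<^sub>R (ro *\<^sub>R wo - ri *\<^sub>R wi)) \<bullet> (wo - wi))"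
        by (rule surf_int_const_on[OF \<sigma>f])
           (simp only: flux_const[OF crw \<sigma>] jump_const[OF cw \<sigma>] rwv s_def[symmetric] wi_def[symmetric] wo_def[symmetric])
      have 2: "?f2 \<sigma>
          = area M \<sigma> *\<^sub>R (?f * ((Hpot' a \<gamma> ro - Hpot' a \<gamma> ri) - ((norm wo)\<^sup>2 / 2 - (norm wi)\<^sup>2 / 2)))"
        by (rule surf_int_const_on[OF \<sigma>f])
           (simp only: flux_const[OF cr \<sigma>] jump_const[OF c\<phi> \<sigma>] \<phi>v s_def[symmetric] ri_def[symmetric] ro_def[symmetric] real_scaleR_def)
      have 3: "?d1 \<sigma> = area M \<sigma> *\<^sub>R ((?up * (\<bar>s\<bar> / 2) + ?\<eta> * (1/2 * (ro + ri))) * (norm (wo - wi))\<^sup>2)"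
        using velocity_face_term[OF cr cw \<sigma>, of "u t" ?\<eta>]
        by (simp only: s_def ri_def ro_def wi_def wo_def real_scaleR_def)
      have 4: "?d2 \<sigma>
          = area M \<sigma> *\<^sub>R (Hpot'' a \<gamma> (\<zeta> \<sigma>) * (ro - ri)\<^sup>2 * (?\<eta> + \<bar>s\<bar> / 2))"
        by (rule surf_int_const_on[OF \<sigma>f])
           (simp only: jump_const[OF cr \<sigma>] s_def[symmetric] ri_def[symmetric] ro_def[symmetric])
      have 5: "cell_val ?p (cell_in \<sigma>) = pressure a \<gamma> ri" "cell_val ?p (cell_out \<sigma>) = pressure a \<gamma> ro"
        by (simp_all add: cell_val_def ri_def ro_def)
      have "((s *\<^sub>R (if s \<ge> 0 then ri *\<^sub>R wi else ro *\<^sub>R wo) - ?\<eta> *\<^sub>R (ro *\<^sub>R wo - ri *\<^sub>R wi)) \<bullet> (wo - wi))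
          + ?f * ((Hpot' a \<gamma> ro - Hpot' a \<gamma> ri) - ((norm wo)\<^sup>2 / 2 - (norm wi)\<^sup>2 / 2))
          + s * (pressure a \<gamma> ri - pressure a \<gamma> ro)
          = - ((?up * (\<bar>s\<bar> / 2) + ?\<eta> * (1/2 * (ro + ri))) * (norm (wo - wi))\<^sup>2)
            - Hpot'' a \<gamma> (\<zeta> \<sigma>) * (ro - ri)\<^sup>2 * (?\<eta> + \<bar>s\<bar> / 2)"
        using kinetic_face_identity[of s ri wi ro wo ?\<eta>] conjunct2[OF \<zeta>[OF \<sigma>, folded s_def ri_def ro_def, unfolded face_dissipation_at_def]]
        unfolding right_diff_distrib[of ?f] right_diff_distrib[of s] by linarith
      from arg_cong[OF this, of "(*) (area M \<sigma>)"]
      show "?f1 \<sigma>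
        + ?f2 \<sigma>
        + area M \<sigma> * (u_sig M (u t) \<sigma> * (cell_val ?p (cell_in \<sigma>) - cell_val ?p (cell_out \<sigma>)))
        = - ?d1 \<sigma>
        - ?d2 \<sigma>"
        unfolding 1 2 3 4 unfolding 5 s_def[symmetric] real_scaleR_def
        by (simp only: distrib_left[of "area M \<sigma>"] right_diff_distrib[of "area M \<sigma>"] mult_minus_right)
    qed
    also have "\<dots> = - F1 - F2"
      unfolding F1_def F2_def by (simp only: sum_subtractf sum_negf)
    finally show ?thesis .
  qed

  have magnetic: "1 / \<tau> * (Y - Y') + \<tau> / 2 * T2 = 0"
  proof -
    have pD: "pwc (Dtx \<tau> B t)" by (rule pwc_Dtx[OF pB])
    have py: "pwc (\<lambda>x. 1/2 * (norm (?b x))\<^sup>2)" "pwc (\<lambda>x. 1/2 * (norm (?b' x))\<^sup>2)"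
      by (intro pwc_mult[OF pwc_const] pwc_norm2 pB)+
    have p1: "pwc (\<lambda>x. 1 / \<tau> * (1/2 * (norm (?b x))\<^sup>2 - 1/2 * (norm (?b' x))\<^sup>2))"
      by (intro pwc_mult[OF pwc_const] pwc_diff py)
    have p2: "pwc (\<lambda>x. \<tau> / 2 * (norm (Dtx \<tau> B t x))\<^sup>2)"
      by (intro pwc_mult[OF pwc_const] pwc_norm2 pD)
    have "0 = vol_int M (\<lambda>x. Dtx \<tau> B t x \<bullet> ?b x + emb M (E t x) \<bullet> curl M ?b x)"
      using ie B(1) unfolding induction_eq_def by force
    also have "\<dots> = vol_int M (\<lambda>x. 1 / \<tau> * (1/2 * (norm (?b x))\<^sup>2 - 1/2 * (norm (?b' x))\<^sup>2) + \<tau> / 2 * (norm (Dtx \<tau> B t x))\<^sup>2)"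
    proof (rule vol_int_cong)
      fix K x assume K: "K \<in> elems M" "x \<in> interior K"
      have "curl M ?b x = 0" by (rule curl_homothetic[OF Rh_homothetic[OF B(1)] K])
      then show "Dtx \<tau> B t x \<bullet> ?b x + emb M (E t x) \<bullet> curl M ?b x
          = 1 / \<tau> * (1/2 * (norm (?b x))\<^sup>2 - 1/2 * (norm (?b' x))\<^sup>2) + \<tau> / 2 * (norm (Dtx \<tau> B t x))\<^sup>2"
        using magnetic_identity[OF \<tau>, of "?b x" "?b' x"] by (simp add: Dtx_def Dt_def)
    qed (intro pwc_add p1 p2)
    also have "\<dots> = 1 / \<tau> * (Y - Y') + \<tau> / 2 * T2"
      unfolding vol_int_add[OF p1 p2] vol_int_cmult vol_int_diff[OF py] Y_def Y'_def T2_def ..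
    finally show ?thesis ..
  qed

  have ampere: "vol_int M (\<lambda>x. (norm (?j x))\<^sup>2) = - L"
  proof -
    have p1: "pwc (\<lambda>x. (norm (?j x))\<^sup>2)" by (rule pwc_norm2[OF pj])
    have p2: "pwc (\<lambda>x. cross3 (?j x) (emb M (?b' x)) \<bullet> emb M (u t x))"
      by (intro pwc_inner pwc_cross pwc_emb pj pB pu)
    have "0 = vol_int M (\<lambda>x. ?j x \<bullet> emb M (E t x) - emb M (?b x) \<bullet> curl M (E t) x)"
      using ae E unfolding ampere_eq_def by force
    also have "\<dots> = vol_int M (\<lambda>x. (norm (?j x))\<^sup>2 + cross3 (?j x) (emb M (?b' x)) \<bullet> emb M (u t x))"
    proof (rule vol_int_cong)
      fix K x assume K: "K \<in> elems M" "x \<in> interior K"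
      have "curl M (E t) x = 0" by (rule curl_homothetic[OF Nh_homothetic[OF E] K])
      then show "?j x \<bullet> emb M (E t x) - emb M (?b x) \<bullet> curl M (E t) x
          = (norm (?j x))\<^sup>2 + cross3 (?j x) (emb M (?b' x)) \<bullet> emb M (u t x)"
        using lorentz_work[of "?j x" "emb M (E t x)" "emb M (u t x)" "emb M (?b' x)"]
        by (simp add: current_def)
    qed (intro pwc_add p1 p2)
    also have "\<dots> = vol_int M (\<lambda>x. (norm (?j x))\<^sup>2) + L"
      unfolding L_def by (rule vol_int_add[OF p1 p2])
    finally show ?thesis by linarith
  qed

  have energy: "total_energy M a \<gamma> ?r (u t) ?b = X + Y" "total_energy M a \<gamma> ?r' (u (t - \<tau>)) ?b' = X' + Y'"
  proof -
    have py: "pwc (\<lambda>x. 1/2 * (norm (?b x))\<^sup>2)" "pwc (\<lambda>x. 1/2 * (norm (?b' x))\<^sup>2)"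
      by (intro pwc_mult[OF pwc_const] pwc_norm2 pB)+
    show "total_energy M a \<gamma> ?r (u t) ?b = X + Y" "total_energy M a \<gamma> ?r' (u (t - \<tau>)) ?b' = X' + Y'"
      unfolding X_def X'_def Y_def Y'_def vol_int_add[OF cen(1)[THEN cellwise_const_pwc] py(1), symmetric]
        vol_int_add[OF cen(2)[THEN cellwise_const_pwc] py(2), symmetric]
      unfolding total_energy_def en_def en'_def w_def w'_def by (rule refl)+
  qed
  have norms: "(L2_norm M (grad (u t)))\<^sup>2 = G" "(L2_norm M (divg (u t)))\<^sup>2 = V"
    "(L2_norm M ?j)\<^sup>2 = vol_int M (\<lambda>x. (norm (?j x))\<^sup>2)"
    unfolding L2_norm_sq G_def V_def
    by (simp only: power2_norm_eq_inner, simp only: real_norm_def power2_abs, rule refl)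
  have "dissipation M a \<gamma> \<epsilon> \<tau> \<rho> u B \<xi> \<zeta> t = - \<tau> / 2 * T1 - \<tau> / 2 * T2 - \<tau> / 2 * T3 - F1 - F2"
    unfolding dissipation_def T1_def T2_def T3_def F1_def F2_def w_def ..
  moreover have "Dt \<tau> (\<lambda>s. total_energy M a \<gamma> (\<rho> s) (u s) (B s)) t = 1 / \<tau> * (X - X') + 1 / \<tau> * (Y - Y')"
    unfolding Dt_def energy using \<tau> by (simp add: field_simps)
  ultimately show ?thesis
    using momentum continuity time faces magnetic ampere unfolding norms by linarith
qed

lemma dissipation_nonpos:
  assumes a: "a > 0" and \<gamma>: "\<gamma> > 1" and \<tau>: "\<tau> > 0"
    and Q: "\<rho> t \<in> Qh M"
    and pos: "positive_on_cells (\<rho> t)" "positive_on_cells (\<rho> (t - \<tau>))"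
    and \<xi>: "positive_on_cells \<xi>" and \<zeta>: "\<And>\<sigma>. \<sigma> \<in> int_faces M \<Longrightarrow> 0 < \<zeta> \<sigma>"
  shows "dissipation M a \<gamma> \<epsilon> \<tau> \<rho> u B \<xi> \<zeta> t \<le> 0"
proof -
  let ?w = "PiQ M (u t)"
  note cr = Qh_cellwise_const[OF Q]
  have T1: "0 \<le> vol_int M (\<lambda>x. \<rho> (t - \<tau>) x * (norm (Dtx \<tau> (\<lambda>s. PiQ M (u s)) t x))\<^sup>2)"
    using pos(2) elems_cover unfolding positive_on_cells_def
    by (intro vol_int_nonneg mult_nonneg_nonneg) (auto intro: less_imp_le)
  have T2: "0 \<le> vol_int M (\<lambda>x. (norm (Dtx \<tau> B t x))\<^sup>2)" by (intro vol_int_nonneg) simp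
  have T3: "0 \<le> vol_int M (\<lambda>x. Hpot'' a \<gamma> (\<xi> x) * \<bar>Dtx \<tau> \<rho> t x\<bar>\<^sup>2)"
    using \<xi> elems_cover unfolding positive_on_cells_def
    by (intro vol_int_nonneg mult_nonneg_nonneg Hpot''_nonneg a \<gamma>) auto
  have F1: "0 \<le> (\<Sum>\<sigma>\<in>int_faces M. surf_int M \<sigma> (\<lambda>x.
          (upw M (u t) \<sigma> (\<rho> t) x * (\<bar>u_sig M (u t) \<sigma>\<bar> / 2) + msize M powr \<epsilon> * avg M \<sigma> (\<rho> t) x)
          * (norm (jump M \<sigma> ?w x))\<^sup>2))"
  proof (rule sum_nonneg)
    fix \<sigma> assume \<sigma>: "\<sigma> \<in> int_faces M"
    note \<sigma>f = int_faces_faces[OF \<sigma>]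
    let ?s = "u_sig M (u t) \<sigma>" and ?ri = "cell_val (\<rho> t) (cell_in \<sigma>)" and ?ro = "cell_val (\<rho> t) (cell_out \<sigma>)"
    let ?c = "((if ?s \<ge> 0 then ?ri else ?ro) * (\<bar>?s\<bar> / 2) + msize M powr \<epsilon> * (1/2 * (?ro + ?ri)))
        * (norm (cell_val ?w (cell_out \<sigma>) - cell_val ?w (cell_in \<sigma>)))\<^sup>2"
    have "0 < ?ri" "0 < ?ro"
      using cell_val_pos[OF pos(1)] cell_in_cover[OF \<sigma>f] cell_out_cover[OF \<sigma>] by auto
    then have "0 \<le> ?c" by (intro mult_nonneg_nonneg add_nonneg_nonneg) auto
    then show "0 \<le> surf_int M \<sigma> (\<lambda>x. (upw M (u t) \<sigma> (\<rho> t) x * (\<bar>?s\<bar> / 2) + msize M powr \<epsilon> * avg M \<sigma> (\<rho> t) x)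
          * (norm (jump M \<sigma> ?w x))\<^sup>2)"
      unfolding velocity_face_term[OF cr cellwise_const_PiQ \<sigma>]
      by (rule mult_nonneg_nonneg[OF less_imp_le[OF area_pos[OF \<sigma>f]]])
  qed
  have F2: "0 \<le> (\<Sum>\<sigma>\<in>int_faces M. surf_int M \<sigma> (\<lambda>x.
          Hpot'' a \<gamma> (\<zeta> \<sigma>) * (jump M \<sigma> (\<rho> t) x)\<^sup>2 * (msize M powr \<epsilon> + \<bar>u_sig M (u t) \<sigma>\<bar> / 2)))"
  proof (rule sum_nonneg)
    fix \<sigma> assume \<sigma>: "\<sigma> \<in> int_faces M"
    show "0 \<le> surf_int M \<sigma> (\<lambda>x.
          Hpot'' a \<gamma> (\<zeta> \<sigma>) * (jump M \<sigma> (\<rho> t) x)\<^sup>2 * (msize M powr \<epsilon> + \<bar>u_sig M (u t) \<sigma>\<bar> / 2))"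
      unfolding surf_int_def set_lebesgue_integral_def
      using Hpot''_nonneg[OF \<zeta>[OF \<sigma>] \<gamma> a] by (intro integral_nonneg_AE AE_I2) simp
  qed
  show ?thesis
    using T1 T2 T3 F1 F2 \<tau> mult_nonneg_nonneg[of "\<tau> / 2"] unfolding dissipation_def
    by (smt (verit) divide_nonneg_nonneg minus_divide_left mult_minus_left)
qed

end

lemma pw_const_time_past: "pw_const_time \<tau> N v \<Longrightarrow> t \<le> 0 \<Longrightarrow> v t = v 0"
  unfolding pw_const_time_def by (metis order_refl)

text \<open>A choice that depends on the two densities alone, so that the resulting function is constant on cells and periodic
  whenever the densities are.\<close>
definition taylor_point :: "real \<Rightarrow> real \<Rightarrow> real \<Rightarrow> real \<Rightarrow> real" where
  "taylor_point a \<gamma> s r = (SOME \<xi>. taylor_at a \<gamma> s r \<xi>)"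

lemma taylor_point: "s > 0 \<Longrightarrow> r > 0 \<Longrightarrow> \<gamma> > 1 \<Longrightarrow> taylor_at a \<gamma> s r (taylor_point a \<gamma> s r)"
  unfolding taylor_point_def by (rule someI_ex[OF ex_taylor_at])

context mesh_geometry
begin

lemma scheme_spaces:
  assumes "scheme_I M \<mu> \<nu> a \<gamma> \<epsilon> \<tau> N \<rho>0 u0 B0 \<rho> u B E" and t: "t \<le> real N * \<tau>"
  shows "\<rho> t \<in> Qh M" "u t \<in> Vh M" "B t \<in> Rh M"
proof -
  have "\<rho> t \<in> Qh M \<and> u t \<in> Vh M \<and> B t \<in> Rh M"
  proof (cases "t \<le> 0")
    case True
    then have "\<rho> t = \<rho> 0" "u t = u 0" "B t = B 0"
      using assms(1) pw_const_time_past unfolding scheme_I_def by blast+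
    then show ?thesis using assms(1) unfolding scheme_I_def is_PiQ_def is_PiV_def is_PiR_def by simp
  next
    case False
    then show ?thesis using assms unfolding scheme_I_def V0h_def R0h_def by simp
  qed
  then show "\<rho> t \<in> Qh M" "u t \<in> Vh M" "B t \<in> Rh M" by auto
qed

lemma scheme_density_positive:
  assumes S: "scheme_I M \<mu> \<nu> a \<gamma> \<epsilon> \<tau> N \<rho>0 u0 B0 \<rho> u B E" and \<tau>: "\<tau> > 0"
    and init: "initial_data M \<rho>0 u0 B0" and pos: "\<forall>x\<in>region M. \<rho>0 x > 0"
    and t: "t \<le> real N * \<tau>"
  shows "positive_on_cells (\<rho> t)"
proof -
  have start: "positive_on_cells (\<rho> s)" if "s \<le> 0" for s
  proof -
    have "\<rho> s = \<rho> 0" using S pw_const_time_past[OF _ that] unfolding scheme_I_def by blast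
    moreover have "positive_on_cells (\<rho> 0)"
      using S init pos positive_initial[of \<rho>0 "\<rho> 0"] unfolding scheme_I_def initial_data_def by blast
    ultimately show ?thesis by simp
  qed
  have "positive_on_cells (\<rho> s)" if "s \<le> real N * \<tau>" "s \<le> real k * \<tau>" for k s
    using that
  proof (induction k arbitrary: s)
    case 0
    then show ?case using start by simp
  next
    case (Suc k)
    show ?case
    proof (cases "s \<le> 0")
      case False
      have "s - \<tau> \<le> real N * \<tau>" "s - \<tau> \<le> real k * \<tau>"
        using Suc.prems \<tau> by (simp_all add: algebra_simps)
      then have "positive_on_cells (\<rho> (s - \<tau>))" "\<rho> (s - \<tau>) \<in> Qh M"
        using Suc.IH scheme_spaces[OF S] by blast+
      moreover have "continuity_eq M \<epsilon> \<tau> \<rho> u s" using S False Suc.prems unfolding scheme_I_def by simp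
      ultimately show ?thesis
        using density_positive_step[OF _ \<tau>] scheme_spaces(1)[OF S Suc.prems(1)] by blast
    qed (rule start)
  qed
  then show ?thesis using t by blast
qed

end

theorem theorem4p2:
  fixes M :: "'n::finite mesh"
    and \<mu> lam \<nu> a \<gamma> \<epsilon> \<tau> :: real and N :: nat
    and \<rho>0 :: "real^'n \<Rightarrow> real" and u0 B0 :: "real^'n \<Rightarrow> real^'n"
    and \<rho> :: "real \<Rightarrow> real^'n \<Rightarrow> real" and u B E :: "real \<Rightarrow> real^'n \<Rightarrow> real^'n"
  assumes "mhd_mesh M"
    and "\<mu> > 0" and "\<nu> = (real CARD('n) - 2) / real CARD('n) * \<mu> + lam" and "\<nu> \<ge> 0"
    and "a > 0" and "\<gamma> > 1" and "\<epsilon> > -1" and "\<tau> > 0" and "N \<ge> 1"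
    and "initial_data M \<rho>0 u0 B0" and "\<forall>x\<in>region M. \<rho>0 x > 0"
    and "scheme_I M \<mu> \<nu> a \<gamma> \<epsilon> \<tau> N \<rho>0 u0 B0 \<rho> u B E"
  shows "\<exists>(\<xi> :: real \<Rightarrow> real^'n \<Rightarrow> real) (\<zeta> :: real \<Rightarrow> (real^'n) set \<Rightarrow> real).
     \<forall>t. 0 < t \<and> t \<le> real N * \<tau> \<longrightarrow>
       \<xi> t \<in> Qh M \<and>
       (\<forall>K\<in>cover M. \<forall>x\<in>interior K. \<xi> t x \<in> co (\<rho> (t - \<tau>) x) (\<rho> t x)) \<and>
       (\<forall>\<sigma>\<in>int_faces M. \<forall>x\<in>rel_interior \<sigma>. \<zeta> t \<sigma> \<in> co (tr_in M \<sigma> (\<rho> t) x) (tr_out M \<sigma> (\<rho> t) x)) \<and>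
       Dt \<tau> (\<lambda>s. total_energy M a \<gamma> (\<rho> s) (u s) (B s)) t
         + \<mu> * (L2_norm M (grad (u t)))\<^sup>2 + \<nu> * (L2_norm M (divg (u t)))\<^sup>2
         + (L2_norm M (current M \<tau> u B E t))\<^sup>2
       = dissipation M a \<gamma> \<epsilon> \<tau> \<rho> u B (\<xi> t) (\<zeta> t) t \<and>
       dissipation M a \<gamma> \<epsilon> \<tau> \<rho> u B (\<xi> t) (\<zeta> t) t \<le> 0"
proof -
  interpret mesh_geometry M by (rule mesh_geometry.intro[OF assms(1)])
  note a = assms(5) and \<gamma> = assms(6) and \<tau> = assms(8) and S = assms(12)
  define \<xi> where "\<xi> t x = taylor_point a \<gamma> (\<rho> (t - \<tau>) x) (\<rho> t x)" for t x
  define at_face where "at_face t \<sigma> = face_dissipation_at a \<gamma> (msize M powr \<epsilon>) (u_sig M (u t) \<sigma>)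
      (cell_val (\<rho> t) (cell_in \<sigma>)) (cell_val (\<rho> t) (cell_out \<sigma>))" for t \<sigma>
  define \<zeta> where "\<zeta> t \<sigma> = (SOME z. at_face t \<sigma> z)" for t \<sigma>
  show ?thesis
  proof (intro exI[of _ \<xi>] exI[of _ \<zeta>] allI impI, elim conjE, intro conjI ballI)
    fix t assume t: "0 < t" "t \<le> real N * \<tau>"
    have t': "t - \<tau> \<le> real N * \<tau>" using t \<tau> by simp
    note now = scheme_spaces[OF S t(2)] and past = scheme_spaces[OF S t']
    note pos = scheme_density_positive[OF S \<tau> assms(10,11) t(2)]
      and pos' = scheme_density_positive[OF S \<tau> assms(10,11) t']
    have sch: "u t \<in> V0h M" "E t \<in> Nh M" "continuity_eq M \<epsilon> \<tau> \<rho> u t"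
      "momentum_eq M \<mu> \<nu> a \<gamma> \<epsilon> \<tau> \<rho> u B E t" "induction_eq M \<tau> B E t" "ampere_eq M \<tau> u B E t"
      using S t unfolding scheme_I_def N0h_def by auto
    note cr = Qh_cellwise_const[OF now(1)] and cr' = Qh_cellwise_const[OF past(1)]
    have c\<xi>: "cellwise_const (\<xi> t)" unfolding \<xi>_def
      by (rule cellwise_const_comp2[OF cr' cr])
    show "\<xi> t \<in> Qh M"
      using Qh_periodic[OF now(1)] Qh_periodic[OF past(1)]
      by (intro cellwise_const_Qh[OF _ c\<xi>]) (simp add: periodic_def \<xi>_def)
    have \<xi>at: "taylor_at a \<gamma> (\<rho> (t - \<tau>) x) (\<rho> t x) (\<xi> t x)" if "K \<in> cover M" "x \<in> interior K" for K x
      using pos pos' that \<gamma> unfolding positive_on_cells_def \<xi>_def by (intro taylor_point) auto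
    then show \<xi>co: "\<xi> t x \<in> co (\<rho> (t - \<tau>) x) (\<rho> t x)" if "K \<in> cover M" "x \<in> interior K" for K x
      using that unfolding taylor_at_def by blast
    have \<xi>pos: "positive_on_cells (\<xi> t)"
      using \<xi>co pos pos' co_pos unfolding positive_on_cells_def by blast
    have vals: "0 < cell_val (\<rho> t) (cell_in \<sigma>)" "0 < cell_val (\<rho> t) (cell_out \<sigma>)" if "\<sigma> \<in> int_faces M" for \<sigma>
      using cell_val_pos[OF pos] cell_in_cover cell_out_cover int_faces_faces that by auto
    have \<zeta>at: "at_face t \<sigma> (\<zeta> t \<sigma>)" if "\<sigma> \<in> int_faces M" for \<sigma>
      unfolding \<zeta>_def
      by (rule someI_ex) (unfold at_face_def, rule ex_face_dissipation_at[OF vals[OF that] \<gamma> powr_msize_pos])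
    have \<zeta>co: "\<zeta> t \<sigma> \<in> co (cell_val (\<rho> t) (cell_in \<sigma>)) (cell_val (\<rho> t) (cell_out \<sigma>))" if "\<sigma> \<in> int_faces M" for \<sigma>
      using \<zeta>at[OF that] unfolding at_face_def face_dissipation_at_def by blast
    show "\<zeta> t \<sigma> \<in> co (tr_in M \<sigma> (\<rho> t) x) (tr_out M \<sigma> (\<rho> t) x)"
      if \<sigma>: "\<sigma> \<in> int_faces M" "x \<in> rel_interior \<sigma>" for \<sigma> x
      using \<zeta>co[OF \<sigma>(1)] by (simp only: tr_in_const[OF cr int_faces_faces[OF \<sigma>(1)] \<sigma>(2)] tr_out_const[OF cr \<sigma>])
    show "Dt \<tau> (\<lambda>s. total_energy M a \<gamma> (\<rho> s) (u s) (B s)) t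
         + \<mu> * (L2_norm M (grad (u t)))\<^sup>2 + \<nu> * (L2_norm M (divg (u t)))\<^sup>2
         + (L2_norm M (current M \<tau> u B E t))\<^sup>2
       = dissipation M a \<gamma> \<epsilon> \<tau> \<rho> u B (\<xi> t) (\<zeta> t) t"
      by (rule energy_identity[OF \<gamma> \<tau> now(1) past(1) sch(1) now(3) past(3) sch(2-6) c\<xi>
            \<xi>at[OF elems_cover] \<zeta>at[unfolded at_face_def]])
    have "0 < \<zeta> t \<sigma>" if "\<sigma> \<in> int_faces M" for \<sigma>
      using co_pos[OF vals[OF that] \<zeta>co[OF that]] .
    then show "dissipation M a \<gamma> \<epsilon> \<tau> \<rho> u B (\<xi> t) (\<zeta> t) t \<le> 0"
      by (rule dissipation_nonpos[OF a \<gamma> \<tau> now(1) pos pos' \<xi>pos])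
  qed
qed

end
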